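(* (i) There is a one-to-one correspondence between distributions of random elements $\Pi\in\mathcal P_\infty$ and distributions of exchangeable random infinite posets $R$ on $\mathbb N$, given by $R\overset{d}{=}P(\infty,\Pi)$ (with $\Pi$ random, independent of the other randomness in the construction). This relation between $\Pi$ and $R$ is equivalent to each of $$\mathbb E\,t(Q,\Pi)=\mathbb P(R\supseteq Q)\quad\text{and}\quad \mathbb E\,t_{\mathrm{ind}}(Q,\Pi)=\mathbb P(R|_A=Q)$$ holding for every finite labelled poset $Q$ with ground set $A\subset\mathbb N$. Furthermore, in this case $R|_{[n]}\to\Pi$ in distribution in $\overline{\mathcal P}$ as $n\to\infty$. (ii) There is a one-to-one correspondence between poset limits $\Pi\in\mathcal P_\infty$ and extreme points of the set of distributions of exchangeable random infinite posets $R$ on $\mathbb N$. This correspondence is given by $R\overset{d}{=}P(\infty,\Pi)$, or equivalently by either of $$t(Q,\Pi)=\mathbb P(R\supseteq Q)\quad\text{or}\quad t_{\mathrm{ind}}(Q,\Pi)=\mathbb P(R|_A=Q)$$ for every finite labelled poset $Q$ with ground set $A\subset\mathbb N$. Furthermore, in this case $R|_{[n]}\to\Pi$ almost surely in $\overline{\mathcal P}$ as $n\to\infty$.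
   Context: A poset is a nonempty set with a strict partial order $<$. For finite posets $Q,P$: $t(Q,P)$ is the proportion of all maps $\varphi$ from the ground set of $Q$ to that of $P$ with $x<_Qy\Rightarrow\varphi(x)<_P\varphi(y)$; $t_{\mathrm{ind}}(Q,P)$ is the proportion of injective maps with $x<_Qy\iff\varphi(x)<_P\varphi(y)$ (defined as $0$ if $|Q|>|P|$). Let $\mathcal P$ be the set of isomorphism classes of finite nonempty posets; identify $\mathcal P$ with its (injective) image under $P\mapsto((t(Q,P))_{Q\in\mathcal P},|P|^{-1})\in[0,1]^{\mathcal P}\times[0,1]$, let $\overline{\mathcal P}$ be the closure (product topology, compact metrizable) and $\mathcal P_\infty=\overline{\mathcal P}\setminus\mathcal P$; $t(Q,\cdot)$ and $t_{\mathrm{ind}}(Q,\cdot)$ extend continuously to $\overline{\mathcal P}$. An ordered probability space $(\mathcal S,\mathcal F,\mu,\prec)$ is a probability space with a strict partial order $\prec$ such that $\{(x,y):x\prec y\}\in\mathcal F\times\mathcal F$; a kernel on it is a measurable $W:\mathcal S^2\to[0,1]$ with $W(x,y)>0\Rightarrow x\prec y$ and ($W(x,y)>0$, $W(y,z)>0$) $\Rightarrow W(x,z)=1$ for all $x,y,z$. $\Pi_W\in\mathcal P_\infty$ is the element with $t(Q,\Pi_W)=\int\prod_{(i,j):i<_Qj}W(x_i,x_j)\,d\mu(x_1)\cdots d\mu(x_{|Q|})$ for all $Q$. For $n\in\mathbb N\cup\{\infty\}$, $[n]=\{1,\dots,n\}$ ($[\infty]=\mathbb N$), and $P(n,W)$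 is the random poset on $[n]$ obtained from i.i.d. $X_i\sim\mu$ and independent i.i.d. $\xi_{ij}\sim U(0,1)$ by setting $i\prec j$ iff $\xi_{ij}<W(X_i,X_j)$. Every $\Pi\in\mathcal P_\infty$ equals $\Pi_W$ for some kernel $W$, and the distribution of $P(n,W)$ depends only on $\Pi_W$; $P(n,\Pi)$ denotes $P(n,W)$ for any such $W$. A random poset $R$ on $\mathbb N$ is exchangeable if its distribution is invariant under all permutations of $\mathbb N$. For a labelled poset $Q$ with ground set $A\subset\mathbb N$, $R\supseteq Q$ means $x<_Qy\Rightarrow x<_Ry$, and $R|_A$ is $A$ with the order induced from $R$. The set of posets on $\mathbb N$ is regarded as a compact subset of $\{0,1\}^{\mathbb N\times\mathbb N}$ via the indicators $\mathbf 1\{i<j\}$. *)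

theory Defs
  imports "HOL-Probability.Probability"
begin

text \<open>A finite poset is coded as (n, rs): ground set {0..<n}, relation = set rs.
  The code type is countable, so the product topology below is metrizable.
  Several codes represent the same isomorphism class; this only duplicates coordinates.\<close>

type_synonym pcode = "nat \<times> (nat \<times> nat) list"

definition psize :: "pcode \<Rightarrow> nat" where
  "psize P = fst P"

definition prel :: "pcode \<Rightarrow> nat \<Rightarrow> nat \<Rightarrow> bool" where
  "prel P i j \<longleftrightarrow> (i, j) \<in> set (snd P)"

definition valid :: "pcode \<Rightarrow> bool" where
  "valid P \<longleftrightarrow> psize P \<ge> 1
     \<and> (\<forall>(i, j) \<in> set (snd P). i < psize P \<and> j < psize P)
     \<and> (\<forall>i. \<not> prel P i i)
     \<and> (\<forall>i j k. prel P i j \<longrightarrow> prel P j k \<longrightarrow> prel P i k)"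

definition hom_t :: "pcode \<Rightarrow> pcode \<Rightarrow> real" where
  "hom_t Q P = real (card {\<phi> \<in> {0..<psize Q} \<rightarrow>\<^sub>E {0..<psize P}.
        \<forall>i j. prel Q i j \<longrightarrow> prel P (\<phi> i) (\<phi> j)})
     / real (psize P ^ psize Q)"

definition ind_t :: "pcode \<Rightarrow> pcode \<Rightarrow> real" where
  "ind_t Q P = (if psize Q > psize P then 0 else
     real (card {\<phi> \<in> {0..<psize Q} \<rightarrow>\<^sub>E {0..<psize P}. inj_on \<phi> {0..<psize Q} \<and>
        (\<forall>i<psize Q. \<forall>j<psize Q. prel Q i j \<longleftrightarrow> prel P (\<phi> i) (\<phi> j))})
     / real (card {\<phi> \<in> {0..<psize Q} \<rightarrow>\<^sub>E {0..<psize P}. inj_on \<phi> {0..<psize Q}}))"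

type_synonym pt = "(pcode \<Rightarrow> real) \<times> real"

definition embed :: "pcode \<Rightarrow> pt" where
  "embed P = ((\<lambda>Q. if valid Q then hom_t Q P else 0), 1 / real (psize P))"

definition Pfin :: "pt set" where
  "Pfin = embed ` {P. valid P}"

definition Pbar :: "pt set" where
  "Pbar = closure Pfin"

definition Pinf :: "pt set" where
  "Pinf = Pbar - Pfin"

definition tlim :: "pcode \<Rightarrow> pt \<Rightarrow> real" where
  "tlim Q p = fst p Q"

definition tindlim :: "pcode \<Rightarrow> pt \<Rightarrow> real" where
  "tindlim Q p = (THE c. \<forall>X. (\<forall>n. valid (X n)) \<longrightarrow> (\<lambda>n. embed (X n)) \<longlonglongrightarrow> p
       \<longrightarrow> (\<lambda>n. ind_t Q (X n)) \<longlonglongrightarrow> c)"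

definition PinfM :: "pt measure" where
  "PinfM = restrict_space borel Pinf"

definition ord_prob_space :: "'a measure \<Rightarrow> ('a \<Rightarrow> 'a \<Rightarrow> bool) \<Rightarrow> bool" where
  "ord_prob_space M lt \<longleftrightarrow> prob_space M
     \<and> (\<forall>x\<in>space M. \<not> lt x x)
     \<and> (\<forall>x\<in>space M. \<forall>y\<in>space M. \<forall>z\<in>space M. lt x y \<longrightarrow> lt y z \<longrightarrow> lt x z)
     \<and> {(x, y). x \<in> space M \<and> y \<in> space M \<and> lt x y} \<in> sets (M \<Otimes>\<^sub>M M)"

definition is_kernel :: "'a measure \<Rightarrow> ('a \<Rightarrow> 'a \<Rightarrow> bool) \<Rightarrow> ('a \<Rightarrow> 'a \<Rightarrow> real) \<Rightarrow> bool" where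
  "is_kernel M lt W \<longleftrightarrow> ord_prob_space M lt
     \<and> (\<lambda>(x, y). W x y) \<in> borel_measurable (M \<Otimes>\<^sub>M M)
     \<and> (\<forall>x\<in>space M. \<forall>y\<in>space M. 0 \<le> W x y \<and> W x y \<le> 1)
     \<and> (\<forall>x\<in>space M. \<forall>y\<in>space M. W x y > 0 \<longrightarrow> lt x y)
     \<and> (\<forall>x\<in>space M. \<forall>y\<in>space M. \<forall>z\<in>space M.
          W x y > 0 \<longrightarrow> W y z > 0 \<longrightarrow> W x z = 1)"

definition kernel_pt :: "'a measure \<Rightarrow> ('a \<Rightarrow> 'a \<Rightarrow> real) \<Rightarrow> pt" where
  "kernel_pt M W = ((\<lambda>Q. if valid Q then
       (\<integral>x. (\<Prod>(i, j)\<in>set (snd Q). W (x i) (x j)) \<partial>(PiM {0..<psize Q} (\<lambda>_. M)))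
     else 0), 0)"

type_synonym nrel = "nat \<times> nat \<Rightarrow> bool"

definition Rel :: "nrel measure" where
  "Rel = PiM UNIV (\<lambda>_. count_space UNIV)"

definition is_poset_N :: "nrel \<Rightarrow> bool" where
  "is_poset_N r \<longleftrightarrow> (\<forall>i. \<not> r (i, i)) \<and> (\<forall>i j k. r (i, j) \<longrightarrow> r (j, k) \<longrightarrow> r (i, k))"

definition law_kernel :: "'a measure \<Rightarrow> ('a \<Rightarrow> 'a \<Rightarrow> real) \<Rightarrow> nrel measure" where
  "law_kernel M W = distr
     (PiM (UNIV :: nat set) (\<lambda>_. M) \<Otimes>\<^sub>M
      PiM (UNIV :: (nat \<times> nat) set) (\<lambda>_. uniform_measure lborel {0<..<1::real}))
     Rel (\<lambda>(x, \<xi>) (i, j). \<xi> (i, j) < W (x i) (x j))"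

definition Plaw :: "pt \<Rightarrow> nrel measure" where
  "Plaw p = (THE \<mu>. \<exists>(M :: real measure) lt W.
       is_kernel M lt W \<and> kernel_pt M W = p \<and> \<mu> = law_kernel M W)"

definition exch_law :: "nrel measure \<Rightarrow> bool" where
  "exch_law R \<longleftrightarrow> prob_space R \<and> sets R = sets Rel \<and> (AE r in R. is_poset_N r)
     \<and> (\<forall>\<pi>. bij \<pi> \<longrightarrow> distr R Rel (\<lambda>r (i, j). r (\<pi> i, \<pi> j)) = R)"

definition extreme_exch :: "nrel measure \<Rightarrow> bool" where
  "extreme_exch R \<longleftrightarrow> exch_law R \<and>
     (\<forall>R1 R2 (a::real). exch_law R1 \<longrightarrow> exch_law R2 \<longrightarrow> 0 < a \<longrightarrow> a < 1 \<longrightarrow>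
        (\<forall>A\<in>sets Rel. emeasure R A = ennreal a * emeasure R1 A + ennreal (1 - a) * emeasure R2 A)
        \<longrightarrow> R1 = R2)"

definition lposet :: "nat set \<Rightarrow> (nat \<Rightarrow> nat \<Rightarrow> bool) \<Rightarrow> bool" where
  "lposet A q \<longleftrightarrow> finite A \<and> A \<noteq> {} \<and> (\<forall>x y. q x y \<longrightarrow> x \<in> A \<and> y \<in> A)
     \<and> (\<forall>x. \<not> q x x) \<and> (\<forall>x y z. q x y \<longrightarrow> q y z \<longrightarrow> q x z)"

definition lcode :: "nat set \<Rightarrow> (nat \<Rightarrow> nat \<Rightarrow> bool) \<Rightarrow> pcode" where
  "lcode A q = (let e = sorted_list_of_set A in
     (card A, [(i, j). i \<leftarrow> [0..<card A], j \<leftarrow> [0..<card A], q (e ! i) (e ! j)]))"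

definition rcode :: "nat \<Rightarrow> nrel \<Rightarrow> pcode" where
  "rcode n r = (n, [(i, j). i \<leftarrow> [0..<n], j \<leftarrow> [0..<n], r (i, j)])"

text \<open>Convergence in distribution in Pbar (test functions continuous on the compact Pbar).\<close>
definition conv_distr :: "(nat \<Rightarrow> 'b \<Rightarrow> pt) \<Rightarrow> 'b measure \<Rightarrow> pt measure \<Rightarrow> bool" where
  "conv_distr X R \<nu> \<longleftrightarrow> (\<forall>f :: pt \<Rightarrow> real. continuous_on Pbar f \<longrightarrow>
     (\<lambda>n. \<integral>r. f (X n r) \<partial>R) \<longlonglongrightarrow> (\<integral>p. f p \<partial>\<nu>))"

end

theory Submission
  imports Defs
begin

text \<open>Every poset limit has a kernel: in a finite digraph, averaging the edge relation over the cells cut out by the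
  adjacencies to randomly chosen reference points changes densities little, by an energy increment argument. Along a
  subsequence the averaged weights converge on a nested binary scheme, and the resulting step kernels on the unit
  interval form an \<open>L\<^sup>2\<close>-bounded martingale, hence converge to a kernel that satisfies the poset
  conditions almost everywhere. Passing to Lebesgue density points makes them hold everywhere.

  The law of an exchangeable poset is determined by the probabilities of containing finite relations. A second moment
  computation along the fourth powers shows that the densities of its restrictions converge almost surely, so that the
  restrictions converge to a random poset limit, of which the law is the required mixing measure. Conversely, for the
  law sampled from a single limit the random limit is constant, which identifies the mixing measure of a mixture. A
  law is extreme iff its mixing measure takes only the values 0 and 1, which makes that measure a point mass.\<close>

section \<open>Averaging digraphs over random reference points\<close>

text \<open>\<open>Plaw\<close> is a description ranging over all kernels on the reals that
  represent \<open>p\<close>, so nothing can be said about it before every point of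
  \<open>Pinf\<close> is known to have such a kernel; this forces the first half. Reference points
  take the place of an abstract regular partition because counting then becomes conditioning: once
  all vertices but two are fixed, the other factors depend on these two only through adjacencies to
  fixed points, hence only through cells. This works as long as each pair of vertices carries at
  most one factor, which is why only relations without loops and 2-cycles are counted; strict orders
  contain neither. A kernel must satisfy its conditions at every point, while limits give them only
  almost everywhere, and this gap is the reason for working with density points. On the
  probabilistic side, the second moment of a difference of densities is O(1/N), so its mean absolute
  value is O(1/sqrt N), which becomes summable at N = j^4; between consecutive fourth powers a
  density can hardly move.\<close>

definition lists_of_length :: "'a set \<Rightarrow> nat \<Rightarrow> 'a list set" where
  "lists_of_length V k = {xs. set xs \<subseteq> V \<and> length xs = k}"

lemma finite_lists_of_length: "finite V \<Longrightarrow> finite (lists_of_length V k)"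
  unfolding lists_of_length_def by (rule finite_lists_length_eq)

lemma card_lists_of_length: "finite V \<Longrightarrow> card (lists_of_length V k) = card V ^ k"
  unfolding lists_of_length_def by (rule card_lists_length_eq)

text \<open>Reference points are kept as lists so that a longer tuple splits into a prefix, which
  gives the coarse partition, and fresh points that refine it.\<close>

lemma sum_lists_of_length_add:
  "(\<Sum>xs\<in>lists_of_length V (k + m). f xs) =
   (\<Sum>xs\<in>lists_of_length V k. \<Sum>ys\<in>lists_of_length V m. f (xs @ ys))" if "finite V"
proof -
  have "bij_betw (\<lambda>(xs, ys). xs @ ys) (lists_of_length V k \<times> lists_of_length V m) (lists_of_length V (k + m))"
    by (rule bij_betwI[where g = "\<lambda>zs. (take k zs, drop k zs)"])
      (auto simp: lists_of_length_def dest: in_set_takeD in_set_dropD)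
  from sum.reindex_bij_betw[OF this, of f] show ?thesis
    by (simp add: sum.cartesian_product case_prod_beta')
qed

text \<open>Turns an average over the positions of the vertices outside a given edge into an average
  over tuples of fresh reference points. Cells depend only on the set of these points, and an
  enumeration of \<open>J\<close> gives the bijection.\<close>

lemma sum_PiE_image:
  assumes "finite J" "finite V"
  shows "(\<Sum>y\<in>PiE J (\<lambda>_. V). f (y ` J)) = (\<Sum>ys\<in>lists_of_length V (card J). f (set ys))"
proof -
  obtain js where js: "set js = J" "distinct js" "length js = card J"
    using finite_distinct_list[OF assms(1)] distinct_card by metis
  have "bij_betw (\<lambda>y. map y js) (PiE J (\<lambda>_. V)) (lists_of_length V (card J))"
  proof (rule bij_betw_imageI)
    show "inj_on (\<lambda>y. map y js) (PiE J (\<lambda>_. V))"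
    proof (rule inj_onI)
      fix y y' assume "y \<in> PiE J (\<lambda>_. V)" "y' \<in> PiE J (\<lambda>_. V)" "map y js = map y' js"
      then show "y = y'" using js by (intro PiE_ext[of y J _ y']) auto
    qed
    show "(\<lambda>y. map y js) ` (PiE J (\<lambda>_. V)) = lists_of_length V (card J)"
    proof safe
      fix y assume "y \<in> PiE J (\<lambda>_. V)"
      then show "map y js \<in> lists_of_length V (card J)"
        using js by (auto simp: lists_of_length_def)
    next
      fix xs assume xs: "xs \<in> lists_of_length V (card J)"
      define y where "y = (\<lambda>j\<in>J. the (map_of (zip js xs) j))"
      have len: "length xs = length js" using xs js by (simp add: lists_of_length_def)
      have eq: "map y js = xs"
      proof (rule nth_equalityI)
        show "length (map y js) = length xs" using len by simp
        fix i assume "i < length (map y js)"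
        then show "map y js ! i = xs ! i"
          using js len by (auto simp: y_def map_of_zip_nth)
      qed
      have "y \<in> PiE J (\<lambda>_. V)"
      proof (rule PiE_I)
        fix j assume "j \<in> J"
        then have "y j \<in> set (map y js)" using js by auto
        then show "y j \<in> V" using eq xs by (auto simp: lists_of_length_def)
      qed (simp add: y_def)
      with eq show "xs \<in> (\<lambda>y. map y js) ` (PiE J (\<lambda>_. V))" by force
    qed
  qed
  from sum.reindex_bij_betw[OF this, of "\<lambda>ys. f (set ys)"] show ?thesis
    using js by simp
qed

lemma sum_PiE_insert:
  assumes "i \<notin> J"
  shows "(\<Sum>x\<in>PiE (insert i J) A. f x) = (\<Sum>u\<in>A i. \<Sum>y\<in>PiE J A. f (y(i := u)))"
proof -
  have "(\<Sum>x\<in>PiE (insert i J) A. f x) = (\<Sum>p\<in>A i \<times> PiE J A. f ((\<lambda>(u, y). y(i := u)) p))"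
    unfolding PiE_insert_eq by (rule sum.reindex_cong[OF inj_combinator[OF assms] refl refl])
  then show ?thesis by (simp add: sum.cartesian_product case_prod_beta')
qed

lemma abs_prod_le_1:
  fixes f :: "'a \<Rightarrow> real"
  assumes "\<And>i. i \<in> A \<Longrightarrow> \<bar>f i\<bar> \<le> 1"
  shows "\<bar>prod f A\<bar> \<le> 1"
  unfolding abs_prod by (rule prod_le_1) (use assms in auto)

section \<open>Cell averages as projections, and their mean energy\<close>

locale finite_digraph =
  fixes V :: "'v set" and g :: "'v \<Rightarrow> 'v \<Rightarrow> bool"
  assumes finite_V: "finite V" and nonempty_V: "V \<noteq> {}"
begin

definition cell :: "'v set \<Rightarrow> 'v \<Rightarrow> 'v set" where
  "cell B u = {u' \<in> V. \<forall>c\<in>B. g u c = g u' c \<and> g c u = g c u'}"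

text \<open>The conditional expectation of the edge relation, for two independent uniform vertices,
  given their cells.\<close>

definition avg :: "'v set \<Rightarrow> 'v \<Rightarrow> 'v \<Rightarrow> real" where
  "avg B u v = (\<Sum>u'\<in>cell B u. \<Sum>v'\<in>cell B v. of_bool (g u' v')) /
     (real (card (cell B u)) * real (card (cell B v)))"

definition energy :: "'v set \<Rightarrow> real" where
  "energy B = (\<Sum>u\<in>V. \<Sum>v\<in>V. (avg B u v)\<^sup>2)"

text \<open>The exponent \<open>k + 2\<close> accounts for the choice of \<open>k\<close> reference
  points and for the two summations inside \<open>energy\<close>, so the value lies in the unit
  interval.\<close>

definition mean_energy :: "nat \<Rightarrow> real" where
  "mean_energy k = (\<Sum>b\<in>lists_of_length V k. energy (set b)) / real (card V) ^ (k + 2)"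

definition dev :: "'v set \<Rightarrow> 'v set \<Rightarrow> real" where
  "dev B C = (\<Sum>u\<in>V. \<Sum>v\<in>V. \<bar>avg C u v - avg B u v\<bar>)"

definition mean_dev :: "nat \<Rightarrow> 'v set \<Rightarrow> real" where
  "mean_dev m B = (\<Sum>ys\<in>lists_of_length V m. dev B (B \<union> set ys)) / real (card V) ^ (m + 2)"

text \<open>The homomorphism density of the pattern \<open>S\<close> on the index set
  \<open>I\<close> in the weighted digraph \<open>f\<close>.\<close>

definition dens :: "nat set \<Rightarrow> (nat \<times> nat) set \<Rightarrow> ('v \<Rightarrow> 'v \<Rightarrow> real) \<Rightarrow> real" where
  "dens I S f = (\<Sum>x\<in>PiE I (\<lambda>_. V). \<Prod>(i, j)\<in>S. f (x i) (x j)) / real (card V) ^ card I"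

lemma card_V_pos: "card V > 0"
  using finite_V nonempty_V by (simp add: card_gt_0_iff)

lemma cell_subset: "cell B u \<subseteq> V"
  by (auto simp: cell_def)

lemma finite_cell: "finite (cell B u)"
  using finite_subset[OF cell_subset finite_V] .

lemma self_in_cell: "u \<in> V \<Longrightarrow> u \<in> cell B u"
  by (auto simp: cell_def)

lemma cell_cong: "u' \<in> cell B u \<Longrightarrow> cell B u' = cell B u"
  by (auto simp: cell_def)

lemma cell_sym: "u \<in> V \<Longrightarrow> u' \<in> V \<Longrightarrow> u' \<in> cell B u \<longleftrightarrow> u \<in> cell B u'"
  by (auto simp: cell_def)

lemma cell_mono: "B \<subseteq> C \<Longrightarrow> cell C u \<subseteq> cell B u"
  by (auto simp: cell_def)

lemma card_cell_pos: "u \<in> V \<Longrightarrow> card (cell B u) > 0"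
  using self_in_cell[of u B] finite_cell by (auto simp: card_gt_0_iff)

lemma avg_cong: "u' \<in> cell B u \<Longrightarrow> v' \<in> cell B v \<Longrightarrow> avg B u' v' = avg B u v"
  by (simp add: avg_def cell_cong)

lemma avg_nonneg: "0 \<le> avg B u v"
  unfolding avg_def by (intro divide_nonneg_nonneg sum_nonneg) auto

lemma avg_le_1: "avg B u v \<le> 1"
proof -
  have "(\<Sum>u'\<in>cell B u. \<Sum>v'\<in>cell B v. of_bool (g u' v')) \<le> (\<Sum>u'\<in>cell B u. \<Sum>v'\<in>cell B v. (1::real))"
    by (intro sum_mono) auto
  then show ?thesis
    unfolding avg_def by (auto simp: divide_le_eq_1)
qed

text \<open>Double counting: a vertex is counted once for each member of its own cell, each time
  with weight one over the size of that cell.\<close>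

lemma sum_cell_mean: "(\<Sum>u\<in>V. (\<Sum>u'\<in>cell B u. f u') / real (card (cell B u))) = (\<Sum>u\<in>V. f u)"
  for f :: "'v \<Rightarrow> real"
proof -
  have "(\<Sum>u\<in>V. (\<Sum>u'\<in>cell B u. f u') / real (card (cell B u)))
      = (\<Sum>u\<in>V. \<Sum>u'\<in>V. if u' \<in> cell B u then f u' / real (card (cell B u)) else 0)"
    by (intro sum.cong refl)
      (auto simp: sum_divide_distrib sum.If_cases finite_V cell_subset Int_absorb1)
  also have "\<dots> = (\<Sum>u'\<in>V. \<Sum>u\<in>V. if u' \<in> cell B u then f u' / real (card (cell B u)) else 0)"
    by (rule sum.swap)
  also have "\<dots> = (\<Sum>u'\<in>V. \<Sum>u\<in>V. if u \<in> cell B u' then f u' / real (card (cell B u')) else 0)"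
    by (intro sum.cong refl) (auto simp: cell_sym cell_cong)
  also have "\<dots> = (\<Sum>u'\<in>V. f u')"
  proof (intro sum.cong refl)
    fix u' assume "u' \<in> V"
    then show "(\<Sum>u\<in>V. if u \<in> cell B u' then f u' / real (card (cell B u')) else 0) = f u'"
      using card_cell_pos[of u' B] by (auto simp: sum.If_cases finite_V cell_subset Int_absorb1)
  qed
  finally show ?thesis .
qed

text \<open>\<open>avg B\<close> is the orthogonal projection of the edge relation onto functions
  that are constant on pairs of cells, so test functions of this kind cannot tell the two apart.
  Both the energy identity and the replacement of edges rest on this.\<close>

lemma sum_avg_mult:
  assumes h: "\<And>u v u' v'. u \<in> V \<Longrightarrow> v \<in> V \<Longrightarrow> u' \<in> cell B u \<Longrightarrow> v' \<in> cell B v \<Longrightarrow> h u' v' = h u v"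
  shows "(\<Sum>u\<in>V. \<Sum>v\<in>V. of_bool (g u v) * h u v) = (\<Sum>u\<in>V. \<Sum>v\<in>V. avg B u v * h u v)"
proof -
  let ?c = "\<lambda>u. real (card (cell B u))"
  have "(\<Sum>u\<in>V. \<Sum>v\<in>V. avg B u v * h u v) =
     (\<Sum>u\<in>V. (\<Sum>u'\<in>cell B u. \<Sum>v\<in>V. (\<Sum>v'\<in>cell B v. of_bool (g u' v') * h u' v') / ?c v) / ?c u)"
  proof (intro sum.cong refl)
    fix u assume u: "u \<in> V"
    have "(\<Sum>u'\<in>cell B u. \<Sum>v\<in>V. (\<Sum>v'\<in>cell B v. of_bool (g u' v') * h u' v') / ?c v) / ?c u
       = (\<Sum>v\<in>V. \<Sum>u'\<in>cell B u. (\<Sum>v'\<in>cell B v. of_bool (g u' v') * h u' v') / ?c v) / ?c u"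
      by (subst sum.swap) simp
    also have "\<dots> = (\<Sum>v\<in>V. \<Sum>u'\<in>cell B u. (\<Sum>v'\<in>cell B v. of_bool (g u' v') * h u v) / ?c v) / ?c u"
      using h[OF u] by (intro arg_cong2[where f = "(/)"] sum.cong refl) auto
    also have "\<dots> = (\<Sum>v\<in>V. avg B u v * h u v)"
      by (simp add: avg_def sum_distrib_right sum_distrib_left sum_divide_distrib field_simps)
    finally show "(\<Sum>v\<in>V. avg B u v * h u v) =
      (\<Sum>u'\<in>cell B u. \<Sum>v\<in>V. (\<Sum>v'\<in>cell B v. of_bool (g u' v') * h u' v') / ?c v) / ?c u" ..
  qed
  also have "\<dots> = (\<Sum>u\<in>V. \<Sum>v\<in>V. of_bool (g u v) * h u v)"
    by (simp add: sum_cell_mean)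
  finally show ?thesis ..
qed

text \<open>Pythagoras: as the cells of \<open>C\<close> refine those of \<open>B\<close>,
  projecting first for \<open>C\<close> and then for \<open>B\<close> reduces the mixed term to
  \<open>energy B\<close>.\<close>

lemma energy_diff:
  assumes "B \<subseteq> C"
  shows "(\<Sum>u\<in>V. \<Sum>v\<in>V. (avg C u v - avg B u v)\<^sup>2) = energy C - energy B"
proof -
  have "(\<Sum>u\<in>V. \<Sum>v\<in>V. avg C u v * avg B u v) = (\<Sum>u\<in>V. \<Sum>v\<in>V. of_bool (g u v) * avg B u v)"
    by (rule sum_avg_mult[symmetric]) (use cell_mono[OF assms] in \<open>auto intro!: avg_cong\<close>)
  also have "\<dots> = (\<Sum>u\<in>V. \<Sum>v\<in>V. avg B u v * avg B u v)"
    by (rule sum_avg_mult) (auto intro: avg_cong)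
  finally have *: "(\<Sum>u\<in>V. \<Sum>v\<in>V. avg C u v * avg B u v) = energy B"
    by (simp add: energy_def power2_eq_square)
  have "(\<Sum>u\<in>V. \<Sum>v\<in>V. (avg C u v - avg B u v)\<^sup>2) =
     (\<Sum>u\<in>V. \<Sum>v\<in>V. (avg C u v)\<^sup>2 + (avg B u v)\<^sup>2 - 2 * (avg C u v * avg B u v))"
    by (simp add: power2_diff algebra_simps)
  also have "\<dots> = energy C + energy B - 2 * (\<Sum>u\<in>V. \<Sum>v\<in>V. avg C u v * avg B u v)"
    by (simp add: sum.distrib sum_subtractf energy_def sum_distrib_left)
  finally show ?thesis using * by simp
qed

lemma energy_mono: "B \<subseteq> C \<Longrightarrow> energy B \<le> energy C"
  using energy_diff[of B C] sum_nonneg[of V "\<lambda>u. \<Sum>v\<in>V. (avg C u v - avg B u v)\<^sup>2"]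
  by (simp add: sum_nonneg)

lemma energy_nonneg: "0 \<le> energy B"
  unfolding energy_def by (intro sum_nonneg) auto

lemma energy_le: "energy B \<le> real (card V) ^ 2"
proof -
  have "energy B \<le> (\<Sum>u\<in>V. \<Sum>v\<in>V. 1)"
    unfolding energy_def by (intro sum_mono) (auto simp: avg_nonneg avg_le_1 power_le_one)
  then show ?thesis by (simp add: power2_eq_square)
qed

lemma mean_energy_nonneg: "0 \<le> mean_energy k"
  unfolding mean_energy_def by (intro divide_nonneg_nonneg sum_nonneg energy_nonneg) auto

lemma mean_energy_le_1: "mean_energy k \<le> 1"
proof -
  have "(\<Sum>b\<in>lists_of_length V k. energy (set b)) \<le> (\<Sum>b\<in>lists_of_length V k. real (card V) ^ 2)"
    by (intro sum_mono energy_le)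
  also have "\<dots> = real (card V) ^ (k + 2)"
    by (simp add: card_lists_of_length finite_V power_add power2_eq_square)
  finally show ?thesis
    using card_V_pos by (simp add: mean_energy_def divide_le_eq_1)
qed

text \<open>Both energies are averaged over the same tuples of length \<open>k + m\<close>; the
  coarse one looks only at the first \<open>k\<close> entries.\<close>

lemma mean_energy_diff:
  "mean_energy (k + m) - mean_energy k =
   (\<Sum>b\<in>lists_of_length V k. \<Sum>ys\<in>lists_of_length V m. energy (set b \<union> set ys) - energy (set b))
     / real (card V) ^ (k + m + 2)"
proof -
  have "mean_energy k = (\<Sum>b\<in>lists_of_length V k. \<Sum>ys\<in>lists_of_length V m. energy (set b))
     / real (card V) ^ (k + m + 2)"
    using card_V_pos
    by (simp add: mean_energy_def card_lists_of_length finite_V power_add flip: sum_distrib_left)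
  then show ?thesis
    by (simp add: mean_energy_def[of "k + m"] sum_lists_of_length_add finite_V sum_subtractf diff_divide_distrib)
qed

lemma mean_energy_mono: "k \<le> l \<Longrightarrow> mean_energy k \<le> mean_energy l"
proof -
  assume "k \<le> l"
  then obtain m where m: "l = k + m" using le_iff_add by blast
  have "0 \<le> mean_energy (k + m) - mean_energy k"
    unfolding mean_energy_diff
    by (intro divide_nonneg_nonneg sum_nonneg) (auto intro: energy_mono)
  then show ?thesis using m by simp
qed

lemma dev_nonneg: "0 \<le> dev B C"
  unfolding dev_def by (intro sum_nonneg) auto

lemma mean_dev_nonneg: "0 \<le> mean_dev m B"
  unfolding mean_dev_def by (intro divide_nonneg_nonneg sum_nonneg dev_nonneg) auto

text \<open>A gain in mean energy is a mean square distance between coarse and refined averages;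
  here it becomes a mean absolute distance, the form in which errors of densities arise.\<close>

lemma sum_mean_dev_le:
  assumes "\<eta> > 0" and "mean_energy (k + m) - mean_energy k \<le> \<eta>\<^sup>2"
  shows "(\<Sum>b\<in>lists_of_length V k. mean_dev m (set b)) \<le> \<eta> * real (card V) ^ k"
proof -
  let ?N = "real (card V)"
  \<comment> \<open>Young's inequality in place of Cauchy-Schwarz. With this weight, the constant
    part and the energy part each contribute half of the final \<open>\<eta>\<close>.\<close>
  have young: "\<bar>d\<bar> \<le> \<eta> / 2 + d\<^sup>2 / (2 * \<eta>)" for d :: real
  proof -
    have "0 \<le> (\<eta> - \<bar>d\<bar>)\<^sup>2" by simp
    then show ?thesis using assms(1) by (simp add: field_simps power2_eq_square)
  qed
  have dev_le: "dev B C \<le> \<eta> / 2 * ?N\<^sup>2 + (energy C - energy B) / (2 * \<eta>)" if "B \<subseteq> C" for B C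
  proof -
    have "dev B C \<le> (\<Sum>u\<in>V. \<Sum>v\<in>V. \<eta> / 2 + (avg C u v - avg B u v)\<^sup>2 / (2 * \<eta>))"
      unfolding dev_def by (intro sum_mono young)
    also have "\<dots> = \<eta> / 2 * ?N\<^sup>2 + (\<Sum>u\<in>V. \<Sum>v\<in>V. (avg C u v - avg B u v)\<^sup>2) / (2 * \<eta>)"
      by (simp add: sum.distrib sum_divide_distrib power2_eq_square)
    finally show ?thesis using energy_diff[OF that] by simp
  qed
  have "(\<Sum>b\<in>lists_of_length V k. mean_dev m (set b)) * ?N ^ (m + 2)
      = (\<Sum>b\<in>lists_of_length V k. \<Sum>ys\<in>lists_of_length V m. dev (set b) (set b \<union> set ys))"
    using card_V_pos by (simp add: mean_dev_def flip: sum_divide_distrib)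
  also have "\<dots> \<le> (\<Sum>b\<in>lists_of_length V k. \<Sum>ys\<in>lists_of_length V m.
       \<eta> / 2 * ?N\<^sup>2 + (energy (set b \<union> set ys) - energy (set b)) / (2 * \<eta>))"
    by (intro sum_mono dev_le) auto
  also have "\<dots> = \<eta> / 2 * ?N ^ (k + m + 2) +
      (mean_energy (k + m) - mean_energy k) * ?N ^ (k + m + 2) / (2 * \<eta>)"
    using card_V_pos unfolding mean_energy_diff
    by (simp add: sum.distrib card_lists_of_length finite_V nonempty_V power_add power2_eq_square flip: sum_divide_distrib)
  also have "\<dots> \<le> \<eta> / 2 * ?N ^ (k + m + 2) + \<eta>\<^sup>2 * ?N ^ (k + m + 2) / (2 * \<eta>)"
    using assms by (intro add_left_mono divide_right_mono mult_right_mono) auto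
  also have "\<dots> = (\<eta> * ?N ^ k) * ?N ^ (m + 2)"
    using assms(1) by (simp add: field_simps power2_eq_square power_add)
  finally show ?thesis
    using card_V_pos by (simp only: mult_le_cancel_right) auto
qed

text \<open>Fix the positions \<open>y\<close> of all vertices other than \<open>i\<close> and
  \<open>j\<close>. Every other factor then involves at most one of the two free vertices and
  depends on it only through its cell for \<open>B\<close> together with the fixed points, so the
  edge may be replaced exactly by the average over these finer cells. Passing from there to
  \<open>avg B\<close> costs \<open>dev\<close>, whose mean over \<open>y\<close> is
  \<open>mean_dev\<close> with \<open>card I - 2\<close> fresh points. Excluding
  \<open>(i, j)\<close> and \<open>(j, i)\<close> from \<open>R\<close> keeps the two free vertices
  in separate factors.\<close>

lemma dens_replace_edge:
  assumes I: "finite I" "i \<in> I" "j \<in> I" "i \<noteq> j"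
    and e: "(i, j) \<notin> R" "(j, i) \<notin> R" "R \<subseteq> I \<times> I" "\<And>l. (l, l) \<notin> R"
    and F: "\<And>p. p \<in> R \<Longrightarrow> F p = (\<lambda>u v. of_bool (g u v)) \<or> F p = avg B"
  shows "\<bar>(\<Sum>x\<in>PiE I (\<lambda>_. V). of_bool (g (x i) (x j)) * (\<Prod>(k, l)\<in>R. F (k, l) (x k) (x l))) -
          (\<Sum>x\<in>PiE I (\<lambda>_. V). avg B (x i) (x j) * (\<Prod>(k, l)\<in>R. F (k, l) (x k) (x l)))\<bar>
        \<le> mean_dev (card I - 2) B * real (card V) ^ card I"
proof -
  define J where "J = I - {i, j}"
  have IJ: "I = insert i (insert j J)" "i \<notin> insert j J" "j \<notin> J" "finite J"
    using I by (auto simp: J_def)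
  have card_I: "card I = card J + 2"
    unfolding IJ(1) using IJ(2-4) by (subst card_insert_disjoint; simp)
  define H where "H x = (\<Prod>(k, l)\<in>R. F (k, l) (x k) (x l))" for x
  have split: "(\<Sum>x\<in>PiE I (\<lambda>_. V). f (x i) (x j) * H x) =
     (\<Sum>y\<in>PiE J (\<lambda>_. V). \<Sum>u\<in>V. \<Sum>v\<in>V. f u v * H (y(j := v, i := u)))" for f :: "'v \<Rightarrow> 'v \<Rightarrow> real"
  proof -
    have "(\<Sum>x\<in>PiE I (\<lambda>_. V). f (x i) (x j) * H x) =
      (\<Sum>u\<in>V. \<Sum>v\<in>V. \<Sum>y\<in>PiE J (\<lambda>_. V). f u v * H (y(j := v, i := u)))"
      unfolding IJ(1) using IJ(2,3) I(4) by (simp add: sum_PiE_insert)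
    also have "\<dots> = (\<Sum>u\<in>V. \<Sum>y\<in>PiE J (\<lambda>_. V). \<Sum>v\<in>V. f u v * H (y(j := v, i := u)))"
      by (intro sum.cong refl sum.swap)
    also have "\<dots> = (\<Sum>y\<in>PiE J (\<lambda>_. V). \<Sum>u\<in>V. \<Sum>v\<in>V. f u v * H (y(j := v, i := u)))"
      by (rule sum.swap)
    finally show ?thesis .
  qed
  have absH: "\<bar>H x\<bar> \<le> 1" for x
    unfolding H_def
  proof (rule abs_prod_le_1)
    fix p assume "p \<in> R"
    then show "\<bar>case p of (k, l) \<Rightarrow> F (k, l) (x k) (x l)\<bar> \<le> 1"
      using F[of p] by (cases p) (auto simp: avg_nonneg avg_le_1)
  qed
  have bound: "\<bar>(\<Sum>u\<in>V. \<Sum>v\<in>V. of_bool (g u v) * H (y(j := v, i := u))) -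
      (\<Sum>u\<in>V. \<Sum>v\<in>V. avg B u v * H (y(j := v, i := u)))\<bar> \<le> dev B (B \<union> y ` J)"
    if y: "y \<in> PiE J (\<lambda>_. V)" for y
  proof -
    let ?C = "B \<union> y ` J"
    have "(\<Sum>u\<in>V. \<Sum>v\<in>V. of_bool (g u v) * H (y(j := v, i := u))) =
       (\<Sum>u\<in>V. \<Sum>v\<in>V. avg ?C u v * H (y(j := v, i := u)))"
    proof (rule sum_avg_mult)
      fix u v u' v' assume uv: "u \<in> V" "v \<in> V" "u' \<in> cell ?C u" "v' \<in> cell ?C v"
      have uB: "u' \<in> cell B u" "v' \<in> cell B v" using uv cell_mono[of B ?C] by auto
      have sB: "w \<in> V \<Longrightarrow> w \<in> cell B w" for w by (rule self_in_cell)
      show "H (y(j := v', i := u')) = H (y(j := v, i := u))"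
        unfolding H_def
      proof (intro prod.cong refl)
        fix p assume p: "p \<in> R"
        obtain k l where kl: "p = (k, l)" by (cases p)
        have "k \<in> I" "l \<in> I" "k \<noteq> l" "(k, l) \<noteq> (i, j)" "(k, l) \<noteq> (j, i)"
          using p kl e by auto
        \<comment> \<open>A factor joining a free to a fixed vertex is constant on cells for one of
          two reasons: an edge by its adjacency to the fixed point, an average because the coarser
          cell for \<open>B\<close> stays the same.\<close>
        then consider "k = i" "l \<in> J" "l \<noteq> i" "l \<noteq> j" | "k = j" "l \<in> J" "l \<noteq> i" "l \<noteq> j" | "k \<in> J" "l = i" "k \<noteq> i" "k \<noteq> j"
          | "k \<in> J" "l = j" "k \<noteq> i" "k \<noteq> j" | "k \<in> J" "l \<in> J" "l \<noteq> i" "l \<noteq> j" "k \<noteq> i" "k \<noteq> j" by (auto simp: J_def)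
        then show "(case p of (k, l) \<Rightarrow> F (k, l) ((y(j := v', i := u')) k) ((y(j := v', i := u')) l)) =
          (case p of (k, l) \<Rightarrow> F (k, l) ((y(j := v, i := u)) k) ((y(j := v, i := u)) l))"
          using F[OF p] uv uB kl I(4) PiE_mem[OF y] by cases (auto simp: cell_def intro!: avg_cong)
      qed
    qed
    then have "\<bar>(\<Sum>u\<in>V. \<Sum>v\<in>V. of_bool (g u v) * H (y(j := v, i := u))) -
      (\<Sum>u\<in>V. \<Sum>v\<in>V. avg B u v * H (y(j := v, i := u)))\<bar> =
      \<bar>\<Sum>u\<in>V. \<Sum>v\<in>V. (avg ?C u v - avg B u v) * H (y(j := v, i := u))\<bar>"
      by (simp add: sum_subtractf left_diff_distrib)
    also have "\<dots> \<le> (\<Sum>u\<in>V. \<bar>\<Sum>v\<in>V. (avg ?C u v - avg B u v) * H (y(j := v, i := u))\<bar>)"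
      by (rule sum_abs)
    also have "\<dots> \<le> (\<Sum>u\<in>V. \<Sum>v\<in>V. \<bar>(avg ?C u v - avg B u v) * H (y(j := v, i := u))\<bar>)"
      by (intro sum_mono sum_abs)
    also have "\<dots> \<le> dev B ?C"
      unfolding dev_def by (intro sum_mono) (auto simp: abs_mult intro!: mult_left_le absH)
    finally show ?thesis .
  qed
  have "\<bar>(\<Sum>x\<in>PiE I (\<lambda>_. V). of_bool (g (x i) (x j)) * H x) - (\<Sum>x\<in>PiE I (\<lambda>_. V). avg B (x i) (x j) * H x)\<bar>
     = \<bar>\<Sum>y\<in>PiE J (\<lambda>_. V). (\<Sum>u\<in>V. \<Sum>v\<in>V. of_bool (g u v) * H (y(j := v, i := u))) -
      (\<Sum>u\<in>V. \<Sum>v\<in>V. avg B u v * H (y(j := v, i := u)))\<bar>"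
    unfolding split[of "\<lambda>u v. of_bool (g u v)"] split[of "avg B"] by (simp add: sum_subtractf)
  also have "\<dots> \<le> (\<Sum>y\<in>PiE J (\<lambda>_. V). dev B (B \<union> y ` J))"
    by (rule order_trans[OF sum_abs sum_mono[OF bound]])
  also have "\<dots> = mean_dev (card J) B * real (card V) ^ card I"
    using card_V_pos card_I IJ(4) finite_V nonempty_V
    by (simp add: sum_PiE_image[where f = "\<lambda>C. dev B (B \<union> C)"] mean_dev_def)
  finally show ?thesis unfolding H_def card_I by simp
qed

lemma dens_avg_close:
  assumes I: "finite I" and S: "S \<subseteq> I \<times> I" "\<And>i. (i, i) \<notin> S" "\<And>i j. (i, j) \<in> S \<Longrightarrow> (j, i) \<notin> S"
  shows "\<bar>dens I S (\<lambda>u v. of_bool (g u v)) - dens I S (avg B)\<bar> \<le> real (card S) * mean_dev (card I - 2) B"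
proof -
  let ?N = "real (card V)" and ?G = "\<lambda>u v. of_bool (g u v) :: real"
  \<comment> \<open>\<open>T R\<close> is the count with the edges in \<open>R\<close> already
    averaged. A hybrid argument leads from \<open>T {}\<close> to \<open>T S\<close>, changing one
    edge at a time.\<close>
  define T where "T R = (\<Sum>x\<in>PiE I (\<lambda>_. V). \<Prod>(k, l)\<in>S. (if (k, l) \<in> R then avg B else ?G) (x k) (x l))" for R
  have finS: "finite S" using S(1) I by (meson finite_SigmaI finite_subset)
  have "\<bar>T {} - T R\<bar> \<le> real (card R) * (mean_dev (card I - 2) B * ?N ^ card I)" if "R \<subseteq> S" for R
    using finite_subset[OF that finS] that
  proof (induction R rule: finite_induct)
    case (insert p R)
    obtain i j where p: "p = (i, j)" by (cases p)
    let ?R' = "S - {p}"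
    define F where "F q = (if q \<in> R then avg B else ?G)" for q
    have eq1: "T R = (\<Sum>x\<in>PiE I (\<lambda>_. V). ?G (x i) (x j) * (\<Prod>(k, l)\<in>?R'. F (k, l) (x k) (x l)))"
      unfolding T_def using insert p finS
      by (intro sum.cong refl) (subst prod.remove[of S p], auto simp: F_def)
    have eq2: "T (insert p R) = (\<Sum>x\<in>PiE I (\<lambda>_. V). avg B (x i) (x j) * (\<Prod>(k, l)\<in>?R'. F (k, l) (x k) (x l)))"
      unfolding T_def using insert p finS
      by (intro sum.cong refl, subst prod.remove[of S p]) (auto simp: F_def split: if_splits intro!: prod.cong)
    have "i \<in> I" "j \<in> I" "i \<noteq> j" "(j, i) \<notin> ?R'"
      using insert.prems S p by auto
    then have "\<bar>T R - T (insert p R)\<bar> \<le> mean_dev (card I - 2) B * ?N ^ card I"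
      unfolding eq1 eq2 using S p I by (intro dens_replace_edge) (auto simp: F_def)
    moreover have "\<bar>T {} - T R\<bar> \<le> real (card R) * (mean_dev (card I - 2) B * ?N ^ card I)"
      using insert by auto
    ultimately have "\<bar>T {} - T (insert p R)\<bar> \<le> (real (card R) + 1) * (mean_dev (card I - 2) B * ?N ^ card I)"
      unfolding distrib_right by linarith
    then show ?case using insert by (simp add: add.commute)
  qed simp
  from this[of S] have *: "\<bar>T {} - T S\<bar> \<le> real (card S) * mean_dev (card I - 2) B * ?N ^ card I"
    by simp
  have "dens I S ?G = T {} / ?N ^ card I"
    unfolding dens_def T_def by simp
  moreover have "dens I S (avg B) = T S / ?N ^ card I"
    unfolding dens_def T_def by (intro arg_cong2[where f = "(/)"] sum.cong prod.cong refl) auto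
  ultimately have "\<bar>dens I S ?G - dens I S (avg B)\<bar> = \<bar>T {} - T S\<bar> / ?N ^ card I"
    by (simp add: diff_divide_distrib[symmetric])
  also have "\<dots> \<le> real (card S) * mean_dev (card I - 2) B"
    using * card_V_pos by (simp add: divide_le_eq)
  finally show ?thesis .
qed

text \<open>First moment method. One list has to serve all levels at once, its prefix of length
  \<open>ks j\<close> at level \<open>j\<close>. The bound \<open>1 / (4 ^ j * (real j + 1))\<close>
  on the mean deviation absorbs the \<open>j + 1\<close> values of \<open>m\<close> and leaves a
  factor \<open>4 ^ j\<close>: one power \<open>2 ^ j\<close> is spent on the weights in
  \<open>X\<close>, the other makes the mean of \<open>X\<close> at most 2, so some list has all
  weighted terms at most 2.\<close>

lemma exists_good_references:
  assumes ks: "\<And>j. j \<le> J \<Longrightarrow> mean_energy (ks j + j) - mean_energy (ks j) \<le> (1 / (4 ^ j * (real j + 1)))\<^sup>2"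
    and L: "\<And>j. j \<le> J \<Longrightarrow> ks j \<le> L"
  obtains b where "b \<in> lists_of_length V L"
    "\<And>j m. m \<le> j \<Longrightarrow> j \<le> J \<Longrightarrow> mean_dev m (set (take (ks j) b)) \<le> 2 * (1 / 2) ^ j"
proof -
  let ?N = "real (card V)"
  define X where "X b = (\<Sum>j\<le>J. 2 ^ j * (\<Sum>m\<le>j. mean_dev m (set (take (ks j) b))))" for b
  have *: "(\<Sum>b\<in>lists_of_length V L. mean_dev m (set (take (ks j) b))) \<le> 1 / (4 ^ j * (real j + 1)) * ?N ^ L"
    if mj: "m \<le> j" "j \<le> J" for m j
  proof -
    let ?\<eta> = "1 / (4 ^ j * (real j + 1))"
    obtain d where d: "L = ks j + d" using L[OF mj(2)] le_iff_add by blast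
    have "(\<Sum>b\<in>lists_of_length V L. mean_dev m (set (take (ks j) b))) =
      (\<Sum>b\<in>lists_of_length V (ks j). mean_dev m (set b)) * ?N ^ d"
      unfolding d sum_lists_of_length_add[OF finite_V] sum_distrib_right
      by (intro sum.cong refl)
        (auto simp: lists_of_length_def card_lists_of_length[OF finite_V, unfolded lists_of_length_def])
    also have "\<dots> \<le> (?\<eta> * ?N ^ ks j) * ?N ^ d"
    proof (intro mult_right_mono sum_mean_dev_le)
      have "mean_energy (ks j + m) \<le> mean_energy (ks j + j)"
        using mj by (intro mean_energy_mono) auto
      then show "mean_energy (ks j + m) - mean_energy (ks j) \<le> ?\<eta>\<^sup>2"
        using ks[OF mj(2)] by linarith
    qed (auto intro!: divide_pos_pos mult_pos_pos)
    finally show ?thesis by (simp add: d power_add)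
  qed
  have "(\<Sum>b\<in>lists_of_length V L. X b) =
     (\<Sum>j\<le>J. 2 ^ j * (\<Sum>m\<le>j. \<Sum>b\<in>lists_of_length V L. mean_dev m (set (take (ks j) b))))"
    unfolding X_def by (subst sum.swap, intro sum.cong refl, subst sum_distrib_left[symmetric], subst sum.swap) simp
  also have "\<dots> \<le> (\<Sum>j\<le>J. 2 ^ j * (\<Sum>m\<le>j. 1 / (4 ^ j * (real j + 1)) * ?N ^ L))"
    by (intro sum_mono mult_left_mono *) auto
  also have "\<dots> = (\<Sum>j\<le>J. (1 / 2) ^ j * ?N ^ L)"
  proof (intro sum.cong refl)
    fix j
    have "(4::real) ^ j = 2 ^ j * 2 ^ j" "real j + 1 \<noteq> 0" by (simp_all flip: power_mult_distrib)
    then show "2 ^ j * (\<Sum>m\<le>j. 1 / (4 ^ j * (real j + 1)) * ?N ^ L) = (1 / 2) ^ j * ?N ^ L"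
      by (simp add: power_divide add.commute[of 1])
  qed
  also have "\<dots> = (\<Sum>j\<le>J. (1 / 2) ^ j) * ?N ^ L"
    by (simp add: sum_distrib_right)
  also have "\<dots> \<le> 2 * ?N ^ L"
  proof (intro mult_right_mono)
    have "(\<Sum>j\<le>J. (1 / 2 :: real) ^ j) = 2 - (1 / 2) ^ J" by (induction J) auto
    then show "(\<Sum>j\<le>J. (1 / 2 :: real) ^ j) \<le> 2" by simp
  qed simp
  finally have sum_X: "(\<Sum>b\<in>lists_of_length V L. X b) \<le> 2 * ?N ^ L" .
  have "\<exists>b\<in>lists_of_length V L. X b \<le> 2"
  proof (rule ccontr)
    assume "\<not> ?thesis"
    then have "(\<Sum>b\<in>lists_of_length V L. 2) < (\<Sum>b\<in>lists_of_length V L. X b)"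
      using card_V_pos finite_V card_lists_of_length[OF finite_V, of L]
      by (intro sum_strict_mono) (auto simp: finite_lists_of_length not_le)
    then show False using sum_X by (simp add: card_lists_of_length finite_V)
  qed
  then obtain b where b: "b \<in> lists_of_length V L" "X b \<le> 2" by blast
  show ?thesis
  proof (rule that[OF b(1)])
    fix j m assume mj: "m \<le> j" "j \<le> J"
    have "2 ^ j * mean_dev m (set (take (ks j) b)) \<le> 2 ^ j * (\<Sum>m\<le>j. mean_dev m (set (take (ks j) b)))"
      using mj by (intro mult_left_mono member_le_sum) (auto simp: mean_dev_nonneg)
    also have "\<dots> \<le> X b"
      unfolding X_def using mj by (intro member_le_sum[where f = "\<lambda>j. 2 ^ j * (\<Sum>m\<le>j. mean_dev m (set (take (ks j) b)))"])
        (auto intro!: mult_nonneg_nonneg sum_nonneg mean_dev_nonneg)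
    finally show "mean_dev m (set (take (ks j) b)) \<le> 2 * (1 / 2) ^ j"
      using b(2) by (simp add: field_simps)
  qed
qed

end

section \<open>Limits of finite digraphs as nested step densities\<close>

lemma compact_PiE_unit: "compact (PiE UNIV (\<lambda>_. {0..1::real}) :: ('c \<Rightarrow> real) set)"
proof -
  have "compactin (product_topology (\<lambda>_::'c. euclidean::real topology) UNIV) (PiE UNIV (\<lambda>_. {0..1}))"
    by (subst compactin_PiE) auto
  then show ?thesis
    by (simp add: euclidean_product_topology)
qed

lemma tendsto_fun_coordinate:
  fixes f :: "'a \<Rightarrow> 'c \<Rightarrow> 'b::topological_space"
  assumes "(f \<longlongrightarrow> l) F"
  shows "((\<lambda>n. f n c) \<longlongrightarrow> l c) F"
  using continuous_on_tendsto_compose[OF continuous_on_product_coordinates[of c] assms] by simp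

text \<open>A countable index type makes the compact cube sequentially compact, which takes the
  place of an explicit diagonal argument.\<close>

lemma diagonal_subseq_unit:
  fixes f :: "nat \<Rightarrow> 'c::countable \<Rightarrow> real"
  assumes "\<And>n c. 0 \<le> f n c" "\<And>n c. f n c \<le> 1"
  obtains \<sigma> l where "strict_mono \<sigma>" "\<And>c. (\<lambda>n. f (\<sigma> n) c) \<longlonglongrightarrow> l c"
proof -
  have "seq_compact (PiE UNIV (\<lambda>_. {0..1::real}) :: ('c \<Rightarrow> real) set)"
    by (intro compact_imp_seq_compact compact_PiE_unit)
  moreover have "\<forall>n. f n \<in> PiE UNIV (\<lambda>_. {0..1})"
    using assms by auto
  ultimately obtain l \<sigma> where "strict_mono \<sigma>" "(f \<circ> \<sigma>) \<longlonglongrightarrow> l"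
    unfolding seq_compact_def by meson
  then show ?thesis
    using that[of \<sigma> l] tendsto_fun_coordinate[of "f \<circ> \<sigma>" l sequentially] by (auto simp: o_def)
qed

lemma strict_mono_diagonal:
  assumes "\<And>J::nat. eventually (P J) sequentially"
  obtains \<sigma> where "strict_mono \<sigma>" "\<And>J. P J (\<sigma> J)"
proof -
  from assms obtain s0 where s0: "\<And>J s. s \<ge> s0 J \<Longrightarrow> P J s"
    unfolding eventually_sequentially by metis
  \<comment> \<open>Every summand \<open>s0 i + 1\<close> is positive, which gives strict growth,
    and the last one alone exceeds \<open>s0 J\<close>.\<close>
  define \<sigma> where "\<sigma> J = (\<Sum>i\<le>J. s0 i + 1)" for J
  have "strict_mono \<sigma>"
    by (rule strict_monoI_Suc) (simp add: \<sigma>_def)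
  moreover have "\<sigma> J \<ge> s0 J" for J
    unfolding \<sigma>_def using member_le_sum[of J "{..J}" "\<lambda>i. s0 i + 1"] by auto
  ultimately show ?thesis using that s0 by blast
qed

text \<open>The homomorphism density of a step kernel with class weights \<open>\<omega>\<close> and
  edge masses \<open>e\<close>; the quotient is the value of the kernel on a pair of classes. For
  finite \<open>I\<close> and \<open>S\<close> within \<open>I\<close>, a division by zero occurs
  only in terms that carry a factor zero.\<close>

definition step_dens :: "('c \<Rightarrow> real) \<Rightarrow> ('c \<Rightarrow> 'c \<Rightarrow> real) \<Rightarrow> 'c set \<Rightarrow> nat set \<Rightarrow> (nat \<times> nat) set \<Rightarrow> real" where
  "step_dens \<omega> e P I S = (\<Sum>\<zeta>\<in>PiE I (\<lambda>_. P).
     (\<Prod>i\<in>I. \<omega> (\<zeta> i)) * (\<Prod>(i, j)\<in>S. e (\<zeta> i) (\<zeta> j) / (\<omega> (\<zeta> i) * \<omega> (\<zeta> j))))"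

text \<open>Where a limiting weight vanishes, the quotients need not converge. The bound of
  \<open>e'\<close> by products of weights keeps them at most one, and the vanishing weight then
  drives the whole term to zero.\<close>

lemma tendsto_step_dens:
  assumes \<omega>: "\<And>z. z \<in> P \<Longrightarrow> (\<lambda>n. \<omega>' n z) \<longlonglongrightarrow> \<omega> z"
    and e: "\<And>z z'. z \<in> P \<Longrightarrow> z' \<in> P \<Longrightarrow> (\<lambda>n. e' n z z') \<longlonglongrightarrow> e z z'"
    and bounds: "\<And>n z. 0 \<le> \<omega>' n z" "\<And>n z. \<omega>' n z \<le> 1" "\<And>n z z'. 0 \<le> e' n z z'"
      "\<And>n z z'. e' n z z' \<le> \<omega>' n z * \<omega>' n z'"
    and fin: "finite I" "S \<subseteq> I \<times> I"
  shows "(\<lambda>n. step_dens (\<omega>' n) (e' n) P I S) \<longlonglongrightarrow> step_dens \<omega> e P I S"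
  unfolding step_dens_def
proof (rule tendsto_sum)
  fix \<zeta> assume \<zeta>: "\<zeta> \<in> PiE I (\<lambda>_. P)"
  let ?f = "\<lambda>\<omega> e. (\<Prod>i\<in>I. \<omega> (\<zeta> i)) * (\<Prod>(i, j)\<in>S. e (\<zeta> i) (\<zeta> j) / (\<omega> (\<zeta> i) * \<omega> (\<zeta> j)) :: real)"
  show "(\<lambda>n. ?f (\<omega>' n) (e' n)) \<longlonglongrightarrow> ?f \<omega> e"
  proof (cases "\<exists>i\<in>I. \<omega> (\<zeta> i) = 0")
    case True
    then obtain i where i: "i \<in> I" "\<omega> (\<zeta> i) = 0" by blast
    have le1: "0 \<le> e' n z z' / (\<omega>' n z * \<omega>' n z')" "e' n z z' / (\<omega>' n z * \<omega>' n z') \<le> 1" for n z z'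
      using bounds(1,3,4)[of n] by (auto simp: divide_le_eq_1 less_le intro!: divide_nonneg_nonneg)
    have "norm (?f (\<omega>' n) (e' n)) \<le> \<omega>' n (\<zeta> i)" for n
    proof -
      have "?f (\<omega>' n) (e' n) \<le> (\<Prod>i\<in>I. \<omega>' n (\<zeta> i)) * 1"
        using le1 bounds by (intro mult_left_mono prod_le_1 prod_nonneg) auto
      also have "\<dots> = \<omega>' n (\<zeta> i) * (\<Prod>i\<in>I - {i}. \<omega>' n (\<zeta> i))"
        using i fin by (simp add: prod.remove)
      also have "\<dots> \<le> \<omega>' n (\<zeta> i) * 1"
        using bounds by (intro mult_left_mono prod_le_1) auto
      finally have "?f (\<omega>' n) (e' n) \<le> \<omega>' n (\<zeta> i)" by simp
      moreover have "0 \<le> ?f (\<omega>' n) (e' n)"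
        using le1 bounds by (intro mult_nonneg_nonneg prod_nonneg) auto
      ultimately show ?thesis by simp
    qed
    moreover have "(\<lambda>n. \<omega>' n (\<zeta> i)) \<longlonglongrightarrow> 0"
      using \<omega>[of "\<zeta> i"] i \<zeta> by auto
    ultimately have "(\<lambda>n. ?f (\<omega>' n) (e' n)) \<longlonglongrightarrow> 0"
      by (rule Lim_null_comparison[OF always_eventually[OF allI]])
    moreover have "(\<Prod>i\<in>I. \<omega> (\<zeta> i)) = 0"
      by (rule prod_zero) (use i fin in auto)
    ultimately show ?thesis by (simp only: mult_zero_left)
  next
    case False
    show ?thesis
    proof (intro tendsto_mult tendsto_prod)
      show "(\<lambda>n. \<omega>' n (\<zeta> i)) \<longlonglongrightarrow> \<omega> (\<zeta> i)" if "i \<in> I" for i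
        using \<omega> PiE_mem[OF \<zeta> that] by simp
      fix p assume "p \<in> S"
      then obtain i j where p: "p = (i, j)" "i \<in> I" "j \<in> I" using fin by auto
      have "(\<lambda>n. e' n (\<zeta> i) (\<zeta> j) / (\<omega>' n (\<zeta> i) * \<omega>' n (\<zeta> j))) \<longlonglongrightarrow>
        e (\<zeta> i) (\<zeta> j) / (\<omega> (\<zeta> i) * \<omega> (\<zeta> j))"
        using PiE_mem[OF \<zeta>] p False by (intro tendsto_divide tendsto_mult \<omega> e) auto
      then show "(\<lambda>n. case p of (i, j) \<Rightarrow> e' n (\<zeta> i) (\<zeta> j) / (\<omega>' n (\<zeta> i) * \<omega>' n (\<zeta> j))) \<longlonglongrightarrow>
        (case p of (i, j) \<Rightarrow> e (\<zeta> i) (\<zeta> j) / (\<omega> (\<zeta> i) * \<omega> (\<zeta> j)))"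
        by (simp add: p)
    qed
  qed
qed

section \<open>Label frequencies of a digraph\<close>

context finite_digraph
begin

definition wt :: "('v \<Rightarrow> 'c) \<Rightarrow> 'c \<Rightarrow> real" where
  "wt f z = real (card {v \<in> V. f v = z}) / real (card V)"

text \<open>Two labellings are allowed so that the two arguments can be refined separately.\<close>

definition edge_wt :: "('v \<Rightarrow> 'c) \<Rightarrow> ('v \<Rightarrow> 'c) \<Rightarrow> 'c \<Rightarrow> 'c \<Rightarrow> real" where
  "edge_wt f f' z z' = (\<Sum>u\<in>{u \<in> V. f u = z}. \<Sum>v\<in>{v \<in> V. f' v = z'}. of_bool (g u v)) / (real (card V))\<^sup>2"

lemma wt_nonneg: "0 \<le> wt f z"
  by (simp add: wt_def)

lemma wt_le_1: "wt f z \<le> 1"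
  using card_V_pos finite_V by (auto simp: wt_def divide_le_eq_1 intro!: card_mono)

lemma edge_wt_nonneg: "0 \<le> edge_wt f f' z z'"
  unfolding edge_wt_def by (intro divide_nonneg_nonneg sum_nonneg) auto

lemma edge_wt_le: "edge_wt f f' z z' \<le> wt f z * wt f' z'"
proof -
  have "(\<Sum>u\<in>{u \<in> V. f u = z}. \<Sum>v\<in>{v \<in> V. f' v = z'}. of_bool (g u v)) \<le>
     (\<Sum>u\<in>{u \<in> V. f u = z}. \<Sum>v\<in>{v \<in> V. f' v = z'}. 1 :: real)"
    by (intro sum_mono) auto
  then show ?thesis
    by (simp add: edge_wt_def wt_def power2_eq_square divide_right_mono)
qed

lemma wt_split:
  assumes "\<And>v. v \<in> V \<Longrightarrow> f v = z \<longleftrightarrow> f1 v = z1 \<or> f1 v = z2" "z1 \<noteq> z2"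
  shows "wt f z = wt f1 z1 + wt f1 z2"
proof -
  have "{v \<in> V. f v = z} = {v \<in> V. f1 v = z1} \<union> {v \<in> V. f1 v = z2}"
    using assms by auto
  then have "card {v \<in> V. f v = z} = card {v \<in> V. f1 v = z1} + card {v \<in> V. f1 v = z2}"
    using assms(2) finite_V by (simp add: card_Un_disjoint disjoint_iff)
  then show ?thesis by (simp add: wt_def add_divide_distrib)
qed

lemma edge_wt_split1:
  assumes "\<And>v. v \<in> V \<Longrightarrow> f v = z \<longleftrightarrow> f1 v = z1 \<or> f1 v = z2" "z1 \<noteq> z2"
  shows "edge_wt f f' z z' = edge_wt f1 f' z1 z' + edge_wt f1 f' z2 z'"
proof -
  have "{v \<in> V. f v = z} = {v \<in> V. f1 v = z1} \<union> {v \<in> V. f1 v = z2}"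
    using assms by auto
  then show ?thesis
    using assms(2) finite_V by (simp add: edge_wt_def add_divide_distrib sum.union_disjoint disjoint_iff)
qed

lemma edge_wt_split2:
  assumes "\<And>v. v \<in> V \<Longrightarrow> f v = z \<longleftrightarrow> f1 v = z1 \<or> f1 v = z2" "z1 \<noteq> z2"
  shows "edge_wt f' f z' z = edge_wt f' f1 z' z1 + edge_wt f' f1 z' z2"
proof -
  have "{v \<in> V. f v = z} = {v \<in> V. f1 v = z1} \<union> {v \<in> V. f1 v = z2}"
    using assms by auto
  then show ?thesis
    using assms(2) finite_V
    by (simp add: edge_wt_def sum.union_disjoint disjoint_iff sum.distrib del: sum_of_bool_eq flip: add_divide_distrib)
qed

text \<open>Group the placements by the labels that they receive. When the cells are the fibres of
  \<open>f\<close>, the averaged density is a function of label frequencies alone; unlike the cells,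
  these can be compared between digraphs of different sizes.\<close>

lemma dens_avg_eq_step_dens:
  fixes f :: "'v \<Rightarrow> 'c"
  assumes f: "\<And>u. u \<in> V \<Longrightarrow> cell B u = {u' \<in> V. f u' = f u}"
    and P: "f ` V \<subseteq> P" "finite P" and I: "finite I" "S \<subseteq> I \<times> I"
  shows "dens I S (avg B) = step_dens (wt f) (edge_wt f f) P I S"
proof -
  let ?N = "real (card V)"
  define F where "F \<zeta> = (\<Prod>(i, j)\<in>S. edge_wt f f (\<zeta> i) (\<zeta> j) / (wt f (\<zeta> i) * wt f (\<zeta> j)))" for \<zeta> :: "nat \<Rightarrow> 'c"
  define r where "r x = restrict (f \<circ> x) I" for x :: "nat \<Rightarrow> 'v"
  have avg: "avg B u v = edge_wt f f (f u) (f v) / (wt f (f u) * wt f (f v))" if "u \<in> V" "v \<in> V" for u v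
    using card_V_pos that by (simp add: avg_def edge_wt_def wt_def f power2_eq_square)
  have fin: "finite (PiE I (\<lambda>_. V))" "finite (PiE I (\<lambda>_. P))"
    using I finite_V P by (auto intro: finite_PiE)
  have "(\<Sum>x\<in>PiE I (\<lambda>_. V). \<Prod>(i, j)\<in>S. avg B (x i) (x j)) = (\<Sum>x\<in>PiE I (\<lambda>_. V). F (r x))"
    unfolding F_def
  proof (intro sum.cong prod.cong refl)
    fix x p assume x: "x \<in> PiE I (\<lambda>_. V)" and p: "p \<in> S"
    then obtain i j where "p = (i, j)" "i \<in> I" "j \<in> I" using I by auto
    then show "(case p of (i, j) \<Rightarrow> avg B (x i) (x j)) =
      (case p of (i, j) \<Rightarrow> edge_wt f f (r x i) (r x j) / (wt f (r x i) * wt f (r x j)))"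
      using PiE_mem[OF x] by (simp add: avg r_def)
  qed
  also have "\<dots> = (\<Sum>\<zeta>\<in>PiE I (\<lambda>_. P). \<Sum>x\<in>{x \<in> PiE I (\<lambda>_. V). r x = \<zeta>}. F (r x))"
    using fin P by (intro sum.group[symmetric]) (auto simp: r_def PiE_iff)
  also have "\<dots> = (\<Sum>\<zeta>\<in>PiE I (\<lambda>_. P). real (card {x \<in> PiE I (\<lambda>_. V). r x = \<zeta>}) * F \<zeta>)"
    by (intro sum.cong refl) simp
  also have "\<dots> = (\<Sum>\<zeta>\<in>PiE I (\<lambda>_. P). (\<Prod>i\<in>I. real (card {v \<in> V. f v = \<zeta> i})) * F \<zeta>)"
  proof (intro sum.cong refl)
    fix \<zeta> assume \<zeta>: "\<zeta> \<in> PiE I (\<lambda>_. P)"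
    have "{x \<in> PiE I (\<lambda>_. V). r x = \<zeta>} = PiE I (\<lambda>i. {v \<in> V. f v = \<zeta> i})"
    proof safe
      fix x assume "x \<in> PiE I (\<lambda>i. {v \<in> V. f v = \<zeta> i})"
      then show "r x = \<zeta>"
        using \<zeta> unfolding r_def by (intro ext) (auto simp: restrict_def PiE_iff extensional_def)
    qed (auto simp: r_def PiE_iff extensional_def)
    then show "real (card {x \<in> PiE I (\<lambda>_. V). r x = \<zeta>}) * F \<zeta> = (\<Prod>i\<in>I. real (card {v \<in> V. f v = \<zeta> i})) * F \<zeta>"
      using I by (simp add: card_PiE)
  qed
  finally show ?thesis
    using card_V_pos
    by (simp add: dens_def step_dens_def F_def sum_divide_distrib wt_def prod_dividef)
qed

end

text \<open>Labels are bit strings, so the frequencies from all digraphs become functions on one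
  countable set and converge along a subsequence. The last clause is an estimate and not a limit,
  because a partition of fixed level only approximates the densities, with an error that decays in
  \<open>j\<close>.\<close>

lemma digraph_sequence_limit:
  fixes N :: "nat \<Rightarrow> nat" and g :: "nat \<Rightarrow> nat \<Rightarrow> nat \<Rightarrow> bool"
  assumes N: "\<And>s. N s \<ge> 1"
  obtains \<sigma> :: "nat \<Rightarrow> nat" and \<omega> :: "bool list \<Rightarrow> real" and e :: "bool list \<Rightarrow> bool list \<Rightarrow> real"
    and level :: "nat \<Rightarrow> nat"
  where "strict_mono \<sigma>" "\<And>j. level j \<ge> j"
    "\<omega> [] = 1" "\<And>z. 0 \<le> \<omega> z" "\<And>z. \<omega> z = \<omega> (z @ [False]) + \<omega> (z @ [True])"
    "\<And>z z'. e z z' = e (z @ [False]) z' + e (z @ [True]) z'"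
    "\<And>z z'. e z z' = e z (z' @ [False]) + e z (z' @ [True])"
    "\<And>z z'. 0 \<le> e z z'" "\<And>z z'. e z z' \<le> \<omega> z * \<omega> z'"
    "\<And>n S j \<epsilon>. S \<subseteq> {..<n} \<times> {..<n} \<Longrightarrow> (\<And>i. (i, i) \<notin> S) \<Longrightarrow>
      (\<And>i j. (i, j) \<in> S \<Longrightarrow> (j, i) \<notin> S) \<Longrightarrow> n \<le> j \<Longrightarrow> \<epsilon> > 0 \<Longrightarrow>
      eventually (\<lambda>J. \<bar>finite_digraph.dens {..<N (\<sigma> J)} {..<n} S (\<lambda>u v. of_bool (g (\<sigma> J) u v)) -
        step_dens \<omega> e (lists_of_length UNIV (level j)) {..<n} S\<bar> \<le> real (card S) * (2 * (1 / 2) ^ j) + \<epsilon>) sequentially"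
proof -
  have fd: "finite_digraph {..<N s}" for s
    using N[of s] by unfold_locales (auto simp: lessThan_empty_iff)
  define a where "a s k = finite_digraph.mean_energy {..<N s} (g s) k" for s k
  define \<eta> where "\<eta> j = (1 / (4 ^ j * (real j + 1)))\<^sup>2" for j :: nat
  have \<eta>_pos: "\<eta> j > 0" for j
    unfolding \<eta>_def by (intro zero_less_power divide_pos_pos mult_pos_pos) auto
  have a: "0 \<le> a s k" "a s k \<le> 1" "k \<le> l \<Longrightarrow> a s k \<le> a s l" for s k l
    unfolding a_def using finite_digraph.mean_energy_nonneg[OF fd] finite_digraph.mean_energy_le_1[OF fd]
      finite_digraph.mean_energy_mono[OF fd] by blast+
  obtain \<sigma>1 ai where \<sigma>1: "strict_mono \<sigma>1" "\<And>k. (\<lambda>n. a (\<sigma>1 n) k) \<longlonglongrightarrow> ai k"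
    using diagonal_subseq_unit[of a] a by metis
  have "incseq ai"
    unfolding incseq_def
    using LIMSEQ_le[OF \<sigma>1(2) \<sigma>1(2)] a(3) by blast
  moreover have "ai k \<le> 1" for k
    using LIMSEQ_le_const2[OF \<sigma>1(2)] a(2) by blast
  ultimately obtain A where A: "ai \<longlonglongrightarrow> A" "\<And>k. ai k \<le> A"
    using incseq_convergent by metis
  \<comment> \<open>The limiting mean energies increase and are bounded, so beyond some index every
    further gain is below \<open>\<eta> j\<close>. Asking for \<open>k \<ge> j\<close> makes the
    levels grow.\<close>
  have "\<exists>k\<ge>j. ai (k + j) - ai k < \<eta> j" for j
  proof -
    have "eventually (\<lambda>k. A - \<eta> j < ai k) sequentially"
      using A(1) \<eta>_pos[of j] by (intro order_tendstoD) auto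
    then obtain k where k: "\<And>k'. k' \<ge> k \<Longrightarrow> A - \<eta> j < ai k'"
      unfolding eventually_sequentially by blast
    show ?thesis
      using k[of "max k j"] A(2)[of "max k j + j"] by (intro exI[of _ "max k j"]) auto
  qed
  then obtain ks where ks: "\<And>j. ks j \<ge> j" "\<And>j. ai (ks j + j) - ai (ks j) < \<eta> j"
    by metis
  \<comment> \<open>Small gains of the limits pass to all but finitely many digraphs, for finitely
    many levels at a time. The digraph with index \<open>J\<close> in the new subsequence only has
    to meet the levels up to \<open>J\<close>.\<close>
  have "eventually (\<lambda>s. \<forall>j\<le>J. a (\<sigma>1 s) (ks j + j) - a (\<sigma>1 s) (ks j) < \<eta> j) sequentially" for J
  proof -
    have "eventually (\<lambda>s. a (\<sigma>1 s) (ks j + j) - a (\<sigma>1 s) (ks j) < \<eta> j) sequentially" for j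
      by (rule order_tendstoD(2)[OF tendsto_diff[OF \<sigma>1(2) \<sigma>1(2)] ks(2)])
    then have "eventually (\<lambda>s. \<forall>j\<in>{..J}. a (\<sigma>1 s) (ks j + j) - a (\<sigma>1 s) (ks j) < \<eta> j) sequentially"
      by (intro eventually_ball_finite) auto
    then show ?thesis by (simp add: Ball_def)
  qed
  from strict_mono_diagonal[of "\<lambda>J s. \<forall>j\<le>J. a (\<sigma>1 s) (ks j + j) - a (\<sigma>1 s) (ks j) < \<eta> j", OF this]
  obtain \<sigma>2 where \<sigma>2: "strict_mono \<sigma>2"
    "\<And>J. \<forall>j\<le>J. a (\<sigma>1 (\<sigma>2 J)) (ks j + j) - a (\<sigma>1 (\<sigma>2 J)) (ks j) < \<eta> j"
    by blast
  define t where "t J = \<sigma>1 (\<sigma>2 J)" for J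
  define V where "V J = {..<N (t J)}" for J
  define h where "h J = g (t J)" for J
  have fdV: "finite_digraph (V J)" for J
    unfolding V_def by (rule fd)
  define L where "L J = (\<Sum>j\<le>J. ks j)" for J
  have ks_le: "ks j \<le> L J" if "j \<le> J" for j J
    unfolding L_def using that by (intro member_le_sum) auto
  have "\<exists>b\<in>lists_of_length (V J) (L J). \<forall>j m. m \<le> j \<longrightarrow> j \<le> J \<longrightarrow>
     finite_digraph.mean_dev (V J) (h J) m (set (take (ks j) b)) \<le> 2 * (1 / 2) ^ j" for J
  proof -
    have "finite_digraph.mean_energy (V J) (h J) (ks j + j) - finite_digraph.mean_energy (V J) (h J) (ks j)
      \<le> (1 / (4 ^ j * (real j + 1)))\<^sup>2" if "j \<le> J" for j
      using \<sigma>2(2)[of J] that unfolding a_def \<eta>_def t_def[symmetric] V_def[symmetric] h_def[symmetric]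
      by (auto intro: less_imp_le)
    from finite_digraph.exists_good_references[OF fdV this ks_le] obtain b
      where b: "b \<in> lists_of_length (V J) (L J)" "\<And>j m. m \<le> j \<Longrightarrow> j \<le> J \<Longrightarrow>
        finite_digraph.mean_dev (V J) (h J) m (set (take (ks j) b)) \<le> 2 * (1 / 2) ^ j"
      by metis
    show ?thesis by (rule bexI[OF _ b(1)]) (intro allI impI b(2))
  qed
  then have "\<forall>J. \<exists>b. b \<in> lists_of_length (V J) (L J) \<and> (\<forall>j m. m \<le> j \<longrightarrow> j \<le> J \<longrightarrow>
     finite_digraph.mean_dev (V J) (h J) m (set (take (ks j) b)) \<le> 2 * (1 / 2) ^ j)"
    by (simp add: Bex_def)
  from choice[OF this] obtain b where "\<forall>J. b J \<in> lists_of_length (V J) (L J) \<and> (\<forall>j m. m \<le> j \<longrightarrow> j \<le> J \<longrightarrow>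
     finite_digraph.mean_dev (V J) (h J) m (set (take (ks j) (b J))) \<le> 2 * (1 / 2) ^ j)" ..
  then have b: "\<And>J. b J \<in> lists_of_length (V J) (L J)"
    "\<And>J j m. m \<le> j \<Longrightarrow> j \<le> J \<Longrightarrow> finite_digraph.mean_dev (V J) (h J) m (set (take (ks j) (b J))) \<le> 2 * (1 / 2) ^ j"
    by simp_all
  \<comment> \<open>Two bits for each reference point, one for each direction of adjacency, whence
    the level \<open>2 * ks j\<close> below. Past the end of the reference list the bits are
    \<open>False\<close>, so profiles of every length exist in every digraph.\<close>
  define bit where "bit J v m = (m div 2 < length (b J) \<and>
     (if even m then h J v (b J ! (m div 2)) else h J (b J ! (m div 2)) v))" for J v m
  define prof where "prof J l v = map (bit J v) [0..<l]" for J l v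
  have prof_Suc: "prof J (length z) v = z \<longleftrightarrow>
     prof J (length (z @ [True])) v = z @ [False] \<or> prof J (length (z @ [True])) v = z @ [True]" for J z v
    by (auto simp: prof_def)
  define om where "om J z = finite_digraph.wt (V J) (prof J (length z)) z" for J z
  define ee where "ee J z z' = finite_digraph.edge_wt (V J) (h J) (prof J (length z)) (prof J (length z')) z z'" for J z z'
  have om: "0 \<le> om J z" "om J z \<le> 1" for J z
    unfolding om_def by (rule finite_digraph.wt_nonneg[OF fdV] finite_digraph.wt_le_1[OF fdV])+
  have om_split: "om J z = om J (z @ [False]) + om J (z @ [True])" for J z
  proof -
    have "finite_digraph.wt (V J) (prof J (length z)) z =
      finite_digraph.wt (V J) (prof J (length (z @ [True]))) (z @ [False]) +
      finite_digraph.wt (V J) (prof J (length (z @ [True]))) (z @ [True])"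
      by (rule finite_digraph.wt_split[OF fdV]) (rule prof_Suc, simp)
    then show ?thesis by (simp add: om_def)
  qed
  have om_Nil: "om J [] = 1" for J
    unfolding om_def finite_digraph.wt_def[OF fdV] prof_def
    using finite_digraph.card_V_pos[OF fdV, of J] by simp
  have ee: "0 \<le> ee J z z'" "ee J z z' \<le> om J z * om J z'" for J z z'
    unfolding om_def ee_def by (rule finite_digraph.edge_wt_nonneg[OF fdV] finite_digraph.edge_wt_le[OF fdV])+
  have ee_split1: "ee J z z' = ee J (z @ [False]) z' + ee J (z @ [True]) z'" for J z z'
  proof -
    have "finite_digraph.edge_wt (V J) (h J) (prof J (length z)) (prof J (length z')) z z' =
      finite_digraph.edge_wt (V J) (h J) (prof J (length (z @ [True]))) (prof J (length z')) (z @ [False]) z' +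
      finite_digraph.edge_wt (V J) (h J) (prof J (length (z @ [True]))) (prof J (length z')) (z @ [True]) z'"
      by (rule finite_digraph.edge_wt_split1[OF fdV]) (rule prof_Suc, simp)
    then show ?thesis by (simp add: ee_def)
  qed
  have ee_split2: "ee J z' z = ee J z' (z @ [False]) + ee J z' (z @ [True])" for J z z'
  proof -
    have "finite_digraph.edge_wt (V J) (h J) (prof J (length z')) (prof J (length z)) z' z =
      finite_digraph.edge_wt (V J) (h J) (prof J (length z')) (prof J (length (z @ [True]))) z' (z @ [False]) +
      finite_digraph.edge_wt (V J) (h J) (prof J (length z')) (prof J (length (z @ [True]))) z' (z @ [True])"
      by (rule finite_digraph.edge_wt_split2[OF fdV]) (rule prof_Suc, simp)
    then show ?thesis by (simp add: ee_def)
  qed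
  have ee_le_1: "ee J z z' \<le> 1" for J z z'
    using ee(2)[of J z z'] om[of J z] om[of J z'] mult_le_one[of "om J z" "om J z'"] by linarith
  obtain \<sigma>3 l where \<sigma>3: "strict_mono \<sigma>3"
    "\<And>c. (\<lambda>n. case c of Inl z \<Rightarrow> om (\<sigma>3 n) z | Inr (z, z') \<Rightarrow> ee (\<sigma>3 n) z z') \<longlonglongrightarrow> l c"
    by (rule diagonal_subseq_unit[of "\<lambda>n c. case c of Inl z \<Rightarrow> om n z | Inr (z, z') \<Rightarrow> ee n z z'"])
      (auto split: sum.splits simp: om ee ee_le_1)
  define \<omega> where "\<omega> z = l (Inl z)" for z
  define e where "e z z' = l (Inr (z, z'))" for z z'
  have lim: "(\<lambda>n. om (\<sigma>3 n) z) \<longlonglongrightarrow> \<omega> z" "(\<lambda>n. ee (\<sigma>3 n) z z') \<longlonglongrightarrow> e z z'" for z z'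
    using \<sigma>3(2)[of "Inl z"] \<sigma>3(2)[of "Inr (z, z')"] by (simp_all add: \<omega>_def e_def)
  show ?thesis
  proof (rule that[of "\<sigma>1 \<circ> (\<sigma>2 \<circ> \<sigma>3)" "\<lambda>j. 2 * ks j" \<omega> e])
    show "strict_mono (\<sigma>1 \<circ> (\<sigma>2 \<circ> \<sigma>3))"
      using \<sigma>1(1) \<sigma>2(1) \<sigma>3(1) by (intro strict_mono_o)
    show "2 * ks j \<ge> j" for j using ks(1)[of j] by simp
    show "\<omega> [] = 1"
      using LIMSEQ_unique[OF lim(1)[of "[]"]] by (simp add: om_Nil)
    show "0 \<le> \<omega> z" for z
      using LIMSEQ_le_const[OF lim(1)] om(1) by blast
    show "\<omega> z = \<omega> (z @ [False]) + \<omega> (z @ [True])" for z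
      using lim(1)[of z] unfolding om_split[of _ z]
      by (rule LIMSEQ_unique) (intro tendsto_add lim)
    show "e z z' = e (z @ [False]) z' + e (z @ [True]) z'" for z z'
      using lim(2)[of z z'] unfolding ee_split1[of _ z z']
      by (rule LIMSEQ_unique) (intro tendsto_add lim)
    show "e z z' = e z (z' @ [False]) + e z (z' @ [True])" for z z'
      using lim(2)[of z z'] unfolding ee_split2[of _ z z']
      by (rule LIMSEQ_unique) (intro tendsto_add lim)
    show "0 \<le> e z z'" for z z'
      using LIMSEQ_le_const[OF lim(2)] ee(1) by blast
    show "e z z' \<le> \<omega> z * \<omega> z'" for z z'
      using LIMSEQ_le[OF lim(2) tendsto_mult[OF lim(1) lim(1)]] ee(2) by blast
    fix n j :: nat and S and \<epsilon> :: real
    assume S: "S \<subseteq> {..<n} \<times> {..<n}" "\<And>i. (i, i) \<notin> S" "\<And>i j. (i, j) \<in> S \<Longrightarrow> (j, i) \<notin> S"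
      and j: "n \<le> j" and \<epsilon>: "\<epsilon> > 0"
    let ?P = "lists_of_length UNIV (2 * ks j) :: bool list set"
    have len: "length (b J) = L J" for J
      using b(1)[of J] by (simp add: lists_of_length_def)
    \<comment> \<open>For \<open>j \<le> J\<close> the first \<open>2 * ks j\<close> bits cut out
      exactly the cells of the first \<open>ks j\<close> reference points, so the finite estimate
      applies. From \<open>n \<le> j\<close> it follows that \<open>n - 2\<close> fresh points are
      covered by the choice of references.\<close>
    have close: "\<bar>finite_digraph.dens (V J) {..<n} S (\<lambda>u v. of_bool (h J u v)) -
       step_dens (om J) (ee J) ?P {..<n} S\<bar> \<le> real (card S) * (2 * (1 / 2) ^ j)" if J: "j \<le> J" for J
    proof -
      let ?B = "set (take (ks j) (b J))"
      have kl: "ks j \<le> length (b J)" using ks_le[OF J] len by simp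
      have cell: "finite_digraph.cell (V J) (h J) ?B u = {u' \<in> V J. prof J (2 * ks j) u' = prof J (2 * ks j) u}" for u
      proof -
        have "(\<forall>c\<in>?B. h J u c = h J u' c \<and> h J c u = h J c u') \<longleftrightarrow>
           (\<forall>m<2 * ks j. bit J u' m = bit J u m)" (is "?l = ?r") for u'
        proof
          assume ?l
          show ?r
          proof (intro allI impI)
            fix m assume "m < 2 * ks j"
            then have "m div 2 < ks j" by auto
            then have "b J ! (m div 2) \<in> ?B"
              using kl by (auto simp: in_set_conv_nth)
            then show "bit J u' m = bit J u m" using \<open>?l\<close> by (auto simp: bit_def)
          qed
        next
          assume r: ?r
          show ?l
          proof
            fix c assume "c \<in> ?B"
            then obtain i where i: "i < ks j" "c = b J ! i" using kl by (auto simp: in_set_conv_nth)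
            then show "h J u c = h J u' c \<and> h J c u = h J c u'"
              using r[rule_format, of "2 * i"] r[rule_format, of "2 * i + 1"] kl by (auto simp: bit_def)
          qed
        qed
        then show ?thesis
          by (auto simp: finite_digraph.cell_def[OF fdV] prof_def)
      qed
      have fin: "finite ?P" by (rule finite_lists_of_length) simp
      have "finite_digraph.dens (V J) {..<n} S (finite_digraph.avg (V J) (h J) ?B) =
        step_dens (finite_digraph.wt (V J) (prof J (2 * ks j)))
          (finite_digraph.edge_wt (V J) (h J) (prof J (2 * ks j)) (prof J (2 * ks j))) ?P {..<n} S"
        using S(1) fin by (intro finite_digraph.dens_avg_eq_step_dens[OF fdV] cell) (auto simp: lists_of_length_def prof_def)
      also have "\<dots> = step_dens (om J) (ee J) ?P {..<n} S"
        unfolding step_dens_def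
      proof (intro sum.cong arg_cong2[where f = "(*)"] prod.cong refl)
        fix \<zeta> assume "\<zeta> \<in> PiE {..<n} (\<lambda>_. ?P)"
        then have len: "length (\<zeta> i) = 2 * ks j" if "i < n" for i
          using that by (auto simp: lists_of_length_def PiE_iff)
        then show "finite_digraph.wt (V J) (prof J (2 * ks j)) (\<zeta> i) = om J (\<zeta> i)" if "i \<in> {..<n}" for i
          using that by (simp add: om_def)
        fix p assume "p \<in> S"
        then obtain i i' where "p = (i, i')" "i < n" "i' < n" using S(1) by auto
        then show "(case p of (i, i') \<Rightarrow> finite_digraph.edge_wt (V J) (h J) (prof J (2 * ks j)) (prof J (2 * ks j)) (\<zeta> i) (\<zeta> i') /
            (finite_digraph.wt (V J) (prof J (2 * ks j)) (\<zeta> i) * finite_digraph.wt (V J) (prof J (2 * ks j)) (\<zeta> i'))) =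
          (case p of (i, i') \<Rightarrow> ee J (\<zeta> i) (\<zeta> i') / (om J (\<zeta> i) * om J (\<zeta> i')))"
          by (simp add: om_def ee_def len)
      qed
      finally have eq: "step_dens (om J) (ee J) ?P {..<n} S =
        finite_digraph.dens (V J) {..<n} S (finite_digraph.avg (V J) (h J) ?B)" ..
      have "\<bar>finite_digraph.dens (V J) {..<n} S (\<lambda>u v. of_bool (h J u v)) -
       step_dens (om J) (ee J) ?P {..<n} S\<bar> \<le> real (card S) * finite_digraph.mean_dev (V J) (h J) (n - 2) ?B"
      proof -
        have "\<bar>finite_digraph.dens (V J) {..<n} S (\<lambda>u v. of_bool (h J u v)) -
          finite_digraph.dens (V J) {..<n} S (finite_digraph.avg (V J) (h J) ?B)\<bar>
          \<le> real (card S) * finite_digraph.mean_dev (V J) (h J) (card {..<n} - 2) ?B"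
          by (rule finite_digraph.dens_avg_close[OF fdV _ S]) simp
        then show ?thesis unfolding eq by simp
      qed
      also have "\<dots> \<le> real (card S) * (2 * (1 / 2) ^ j)"
        using b(2)[of "n - 2" j J] j J by (intro mult_left_mono) auto
      finally show ?thesis .
    qed
    have "(\<lambda>n'. step_dens (om (\<sigma>3 n')) (ee (\<sigma>3 n')) ?P {..<n} S) \<longlonglongrightarrow> step_dens \<omega> e ?P {..<n} S"
      using S(1) by (intro tendsto_step_dens lim om ee) auto
    then have "eventually (\<lambda>n'. dist (step_dens (om (\<sigma>3 n')) (ee (\<sigma>3 n')) ?P {..<n} S) (step_dens \<omega> e ?P {..<n} S) < \<epsilon>) sequentially"
      using \<epsilon> by (rule tendstoD)
    moreover have "eventually (\<lambda>n'. j \<le> \<sigma>3 n') sequentially"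
      using filterlim_subseq[OF \<sigma>3(1)] by (simp add: filterlim_at_top)
    ultimately show "eventually (\<lambda>J. \<bar>finite_digraph.dens {..<N ((\<sigma>1 \<circ> (\<sigma>2 \<circ> \<sigma>3)) J)} {..<n} S
        (\<lambda>u v. of_bool (g ((\<sigma>1 \<circ> (\<sigma>2 \<circ> \<sigma>3)) J) u v)) -
        step_dens \<omega> e ?P {..<n} S\<bar> \<le> real (card S) * (2 * (1 / 2) ^ j) + \<epsilon>) sequentially"
    proof eventually_elim
      case (elim n')
      then show ?case
        using close[of "\<sigma>3 n'"] by (auto simp: V_def h_def t_def dist_real_def)
    qed
  qed
qed

section \<open>A limiting kernel on the unit interval\<close>

lemma AE_summable_of_summable_integral:
  fixes f :: "nat \<Rightarrow> 'a \<Rightarrow> real"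
  assumes [measurable]: "\<And>i. integrable M (f i)" and s: "summable (\<lambda>i. \<integral>x. \<bar>f i x\<bar> \<partial>M)"
  shows "AE x in M. summable (\<lambda>i. \<bar>f i x\<bar>)"
proof -
  have [measurable]: "f i \<in> borel_measurable M" for i
    using assms(1) by blast
  have "(\<integral>\<^sup>+x. (\<Sum>i. ennreal \<bar>f i x\<bar>) \<partial>M) = (\<Sum>i. \<integral>\<^sup>+x. ennreal \<bar>f i x\<bar> \<partial>M)"
    by (intro nn_integral_suminf) auto
  also have "\<dots> = (\<Sum>i. ennreal (\<integral>x. \<bar>f i x\<bar> \<partial>M))"
    by (intro suminf_cong nn_integral_eq_integral) (auto intro: assms)
  also have "\<dots> \<noteq> \<infinity>"
    using s by (simp add: ennreal_suminf_neq_top)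
  finally have "AE x in M. (\<Sum>i. ennreal \<bar>f i x\<bar>) \<noteq> \<infinity>"
    by (intro nn_integral_noteq_infinite) auto
  then show ?thesis
    by eventually_elim (auto intro: summable_suminf_not_top)
qed

text \<open>The variance of the absolute value is non-negative.\<close>

lemma (in prob_space) expectation_abs_le_sqrt:
  fixes X :: "'a \<Rightarrow> real"
  assumes "integrable M X" "integrable M (\<lambda>x. (X x)\<^sup>2)"
  shows "expectation (\<lambda>x. \<bar>X x\<bar>) \<le> sqrt (expectation (\<lambda>x. (X x)\<^sup>2))"
proof -
  have "0 \<le> variance (\<lambda>x. \<bar>X x\<bar>)" by simp
  also have "\<dots> = expectation (\<lambda>x. (X x)\<^sup>2) - (expectation (\<lambda>x. \<bar>X x\<bar>))\<^sup>2"
    using assms by (subst variance_eq) auto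
  finally show ?thesis by (intro real_le_rsqrt) simp
qed

lemma (in prob_space) integrable_real_bounded:
  fixes f :: "'a \<Rightarrow> real"
  assumes "f \<in> borel_measurable M" "\<And>x. x \<in> space M \<Longrightarrow> \<bar>f x\<bar> \<le> B"
  shows "integrable M f"
  by (rule integrable_const_bound[of _ B]) (use assms in auto)

lemma distr_PiM_pair:
  assumes "prob_space M" "i \<in> I" "j \<in> I" "i \<noteq> j"
  shows "distr (PiM I (\<lambda>_. M)) (M \<Otimes>\<^sub>M M) (\<lambda>x. (x i, x j)) = M \<Otimes>\<^sub>M M"
proof -
  interpret M: prob_space M by fact
  interpret product_prob_space "\<lambda>_. M" I by unfold_locales
  show ?thesis
  proof (rule pair_measure_eqI[symmetric])
    fix A B assume AB: "A \<in> sets M" "B \<in> sets M"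
    have meas: "(\<lambda>x. (x i, x j)) \<in> measurable (PiM I (\<lambda>_. M)) (M \<Otimes>\<^sub>M M)"
      using assms by measurable
    have "emeasure (distr (PiM I (\<lambda>_. M)) (M \<Otimes>\<^sub>M M) (\<lambda>x. (x i, x j))) (A \<times> B) =
      emeasure (PiM I (\<lambda>_. M)) {x \<in> space (PiM I (\<lambda>_. M)). \<forall>k\<in>{i, j}. x k \<in> (if k = i then A else B)}"
      using AB assms meas by (subst emeasure_distr) (auto intro!: arg_cong2[where f = emeasure])
    also have "\<dots> = (\<Prod>k\<in>{i, j}. emeasure M (if k = i then A else B))"
      using AB assms by (intro emeasure_PiM_Collect) auto
    also have "\<dots> = emeasure M A * emeasure M B"
      using assms by simp
    finally show "emeasure M A * emeasure M B = emeasure (distr (PiM I (\<lambda>_. M)) (M \<Otimes>\<^sub>M M) (\<lambda>x. (x i, x j))) (A \<times> B)" ..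
  qed (auto intro: M.sigma_finite_measure_axioms)
qed

text \<open>The coordinates have to be distinct: a property that holds almost everywhere on the
  square may fail on the whole diagonal. For this reason the relations \<open>S\<close> below are
  taken without loops.\<close>

lemma AE_PiM_pair:
  assumes "prob_space M" "i \<in> I" "j \<in> I" "i \<noteq> j" and "AE z in M \<Otimes>\<^sub>M M. P z"
  shows "AE x in PiM I (\<lambda>_. M). P (x i, x j)"
proof -
  have meas: "(\<lambda>x. (x i, x j)) \<in> measurable (PiM I (\<lambda>_. M)) (M \<Otimes>\<^sub>M M)"
    using assms by measurable
  have "AE z in distr (PiM I (\<lambda>_. M)) (M \<Otimes>\<^sub>M M) (\<lambda>x. (x i, x j)). P z"
    using assms(5) by (simp only: distr_PiM_pair[OF assms(1-4)])
  from AE_distrD[OF meas this] show ?thesis .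
qed

abbreviation unif01 :: "real measure" where
  "unif01 \<equiv> uniform_measure lborel {0<..<1}"

lemma prob_space_unif01: "prob_space unif01"
  by (rule prob_space_uniform_measure) auto

section \<open>Step kernels on the unit interval as a bounded martingale\<close>

locale nested_weights =
  fixes \<omega> :: "bool list \<Rightarrow> real" and e :: "bool list \<Rightarrow> bool list \<Rightarrow> real"
  assumes \<omega>_Nil: "\<omega> [] = 1" and \<omega>_nonneg: "0 \<le> \<omega> z" and \<omega>_split: "\<omega> z = \<omega> (z @ [False]) + \<omega> (z @ [True])"
    and e_split1: "e z z' = e (z @ [False]) z' + e (z @ [True]) z'"
    and e_split2: "e z z' = e z (z' @ [False]) + e z (z' @ [True])"
    and e_nonneg: "0 \<le> e z z'" and e_le: "e z z' \<le> \<omega> z * \<omega> z'"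
begin

text \<open>The left end of the interval with address \<open>z\<close> when every interval is cut
  into a left part for \<open>False\<close> and a right part for \<open>True\<close>, of lengths
  given by \<open>\<omega>\<close>.\<close>

definition start :: "bool list \<Rightarrow> real" where
  "start z = (\<Sum>i<length z. if z ! i then \<omega> (take i z @ [False]) else 0)"

primrec cell_of :: "nat \<Rightarrow> real \<Rightarrow> bool list" where
  "cell_of 0 u = []"
| "cell_of (Suc l) u = cell_of l u @ [start (cell_of l u) + \<omega> (cell_of l u @ [False]) \<le> u]"

definition W_step :: "nat \<Rightarrow> real \<Rightarrow> real \<Rightarrow> real" where
  "W_step l x y = e (cell_of l x) (cell_of l y) / (\<omega> (cell_of l x) * \<omega> (cell_of l y))"

lemma start_snoc: "start (z @ [c]) = start z + (if c then \<omega> (z @ [False]) else 0)"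
  unfolding start_def by (auto intro!: sum.cong simp: nth_append)

lemma length_cell_of [simp]: "length (cell_of l u) = l"
  by (induction l) auto

lemma start_bounds: "0 \<le> start z \<and> start z + \<omega> z \<le> 1"
proof (induction z rule: rev_induct)
  case Nil
  then show ?case by (simp add: start_def \<omega>_Nil)
next
  case (snoc c z)
  then show ?case
    using \<omega>_split[of z] \<omega>_nonneg[of "z @ [False]"] \<omega>_nonneg[of "z @ [True]"]
    by (cases c) (auto simp: start_snoc)
qed

lemma cell_of_eq_iff:
  assumes "0 \<le> u" "u < 1" "length z = l"
  shows "cell_of l u = z \<longleftrightarrow> start z \<le> u \<and> u < start z + \<omega> z"
  using assms(3)
proof (induction l arbitrary: z)
  case 0
  then show ?case using assms by (simp add: start_def \<omega>_Nil)
next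
  case (Suc l)
  obtain y c where z: "z = y @ [c]" "length y = l"
    using Suc.prems by (cases z rule: rev_cases) auto
  have "cell_of (Suc l) u = z \<longleftrightarrow> cell_of l u = y \<and> c = (start y + \<omega> (y @ [False]) \<le> u)"
    by (auto simp: z)
  also have "\<dots> \<longleftrightarrow> start z \<le> u \<and> u < start z + \<omega> z"
    using Suc.IH[OF z(2)] \<omega>_split[of y] \<omega>_nonneg[of "y @ [False]"] \<omega>_nonneg[of "y @ [True]"]
    by (cases c) (auto simp: z start_snoc)
  finally show ?case .
qed

lemma measurable_cell_of [measurable]: "cell_of l \<in> measurable borel (count_space UNIV)"
proof (induction l)
  case 0
  then show ?case by simp
next
  case (Suc l)
  have "(\<lambda>u. (\<lambda>z u. z @ [start z + \<omega> (z @ [False]) \<le> u]) (cell_of l u) u) \<in> measurable borel (count_space UNIV)"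
    by (rule measurable_compose_countable[OF _ Suc]) measurable
  then show ?case by simp
qed

definition level_set :: "bool list \<Rightarrow> real set" where
  "level_set z = {u. cell_of (length z) u = z}"

lemma sets_level_set [measurable]: "level_set z \<in> sets borel"
proof -
  have "cell_of (length z) -` {z} \<inter> space borel \<in> sets borel"
    by (intro measurable_sets[OF measurable_cell_of]) auto
  then show ?thesis by (simp add: level_set_def vimage_def)
qed

lemma measure_level_set: "measure unif01 (level_set z) = \<omega> z"
proof -
  have "emeasure lborel ({0<..<1} \<inter> level_set z) = ennreal (\<omega> z)"
  \<comment> \<open>The uniform measure is taken on the open interval, so a cell that starts at zero
    loses its end point and has a different shape.\<close>
  proof (cases "start z = 0")
    case True
    then have "{0<..<1} \<inter> level_set z = {0<..<\<omega> z}"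
      using start_bounds[of z] by (auto simp: level_set_def cell_of_eq_iff)
    then show ?thesis using \<omega>_nonneg[of z] by simp
  next
    case False
    then have "{0<..<1} \<inter> level_set z = {start z..<start z + \<omega> z}"
      using start_bounds[of z] by (auto simp: level_set_def cell_of_eq_iff)
    then show ?thesis using \<omega>_nonneg[of z] by simp
  qed
  then have "emeasure unif01 (level_set z) = ennreal (\<omega> z)"
    using divide_ennreal[of "\<omega> z" 1] \<omega>_nonneg[of z] by (simp add: emeasure_uniform_measure)
  then show ?thesis using \<omega>_nonneg[of z] by (simp add: measure_def)
qed

lemma level_set_split: "level_set z = level_set (z @ [False]) \<union> level_set (z @ [True])" "level_set (z @ [False]) \<inter> level_set (z @ [True]) = {}"
  by (auto simp: level_set_def)

lemma W_step_nonneg: "0 \<le> W_step l x y"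
  unfolding W_step_def by (intro divide_nonneg_nonneg mult_nonneg_nonneg e_nonneg \<omega>_nonneg)

lemma W_step_le_1: "W_step l x y \<le> 1"
  unfolding W_step_def using e_le \<omega>_nonneg by (auto simp: divide_le_eq_1 less_le)

lemma measurable_W_step [measurable]: "(\<lambda>(x, y). W_step l x y) \<in> borel_measurable (borel \<Otimes>\<^sub>M borel)"
proof -
  have "(\<lambda>p. (\<lambda>(z, z') p. e z z' / (\<omega> z * \<omega> z')) (cell_of l (fst p), cell_of l (snd p)) p)
     \<in> measurable (borel \<Otimes>\<^sub>M borel) borel"
    by (rule measurable_compose_countable) (auto split: prod.splits simp: pair_measure_countable)
  then show ?thesis by (simp add: W_step_def case_prod_beta')
qed

lemma W_step_rectangle: "x \<in> level_set z \<Longrightarrow> y \<in> level_set z' \<Longrightarrow> length z = l \<Longrightarrow> length z' = l \<Longrightarrow>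
    W_step l x y = e z z' / (\<omega> z * \<omega> z')"
  by (auto simp: level_set_def W_step_def)

text \<open>The expansion in indicators of rectangles reduces integrals against a coarse step kernel
  to masses of rectangles.\<close>

lemma W_step_eq_sum: "W_step l x y = (\<Sum>z\<in>lists_of_length UNIV l. \<Sum>z'\<in>lists_of_length UNIV l.
    e z z' / (\<omega> z * \<omega> z') * (indicator (level_set z) x * indicator (level_set z') y))"
proof -
  have fin: "finite (lists_of_length UNIV l :: bool list set)" by (rule finite_lists_of_length) simp
  have ind: "indicator (level_set z) u = (if cell_of l u = z then 1 else 0 :: real)" if "z \<in> lists_of_length UNIV l" for z u
    using that by (auto simp: level_set_def lists_of_length_def indicator_def)
  have "(\<Sum>z\<in>lists_of_length UNIV l. \<Sum>z'\<in>lists_of_length UNIV l.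
    e z z' / (\<omega> z * \<omega> z') * (indicator (level_set z) x * indicator (level_set z') y)) =
    (\<Sum>z\<in>lists_of_length UNIV l. \<Sum>z'\<in>lists_of_length UNIV l.
      if cell_of l x = z then if cell_of l y = z' then e z z' / (\<omega> z * \<omega> z') else 0 else 0)"
    by (intro sum.cong refl) (simp add: ind)
  also have "\<dots> = (\<Sum>z\<in>lists_of_length UNIV l. if cell_of l x = z then
      \<Sum>z'\<in>lists_of_length UNIV l. if cell_of l y = z' then e z z' / (\<omega> z * \<omega> z') else 0 else 0)"
    by (intro sum.cong refl) simp
  also have "\<dots> = W_step l x y"
    using fin by (simp add: sum.delta lists_of_length_def W_step_def)
  finally show ?thesis ..
qed

text \<open>At each point exactly one assignment of addresses has all its indicators equal to one.
  After expanding the product in this way, the integral factorises into the weights of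
  cells.\<close>

lemma integral_W_step_prod:
  assumes S: "S \<subseteq> {..<n} \<times> {..<n}"
  shows "(\<integral>x. (\<Prod>(i, j)\<in>S. W_step l (x i) (x j)) \<partial>PiM {..<n} (\<lambda>_. unif01)) =
     step_dens \<omega> e (lists_of_length UNIV l) {..<n} S"
proof -
  interpret U: prob_space unif01 by (rule prob_space_unif01)
  interpret product_sigma_finite "\<lambda>_::nat. unif01"
    by unfold_locales
  let ?P = "lists_of_length UNIV l :: bool list set" and ?I = "{..<n}"
  have fin: "finite ?P" "finite (PiE ?I (\<lambda>_. ?P))"
    by (auto intro!: finite_lists_of_length finite_PiE)
  define F where "F \<zeta> = (\<Prod>(i, j)\<in>S. e (\<zeta> i) (\<zeta> j) / (\<omega> (\<zeta> i) * \<omega> (\<zeta> j)))" for \<zeta> :: "nat \<Rightarrow> bool list"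
  have eq: "(\<Prod>(i, j)\<in>S. W_step l (x i) (x j)) =
     (\<Sum>\<zeta>\<in>PiE ?I (\<lambda>_. ?P). (\<Prod>i\<in>?I. indicator (level_set (\<zeta> i)) (x i)) * F \<zeta>)" for x :: "nat \<Rightarrow> real"
  proof -
    define \<zeta>0 where "\<zeta>0 = restrict (cell_of l \<circ> x) ?I"
    have \<zeta>0: "\<zeta>0 \<in> PiE ?I (\<lambda>_. ?P)"
      by (auto simp: \<zeta>0_def lists_of_length_def)
    have "(\<Prod>i\<in>?I. indicator (level_set (\<zeta> i)) (x i)) * F \<zeta> = (if \<zeta>0 = \<zeta> then F \<zeta> else 0)"
      if \<zeta>: "\<zeta> \<in> PiE ?I (\<lambda>_. ?P)" for \<zeta>
    proof (cases "\<zeta>0 = \<zeta>")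
      case True
      then have "\<And>i. i < n \<Longrightarrow> \<zeta> i = cell_of l (x i)" by (auto simp: \<zeta>0_def)
      then show ?thesis using True by (auto simp: level_set_def)
    next
      case False
      then obtain i where i: "i < n" "\<zeta> i \<noteq> cell_of l (x i)"
        using PiE_ext[OF \<zeta> \<zeta>0] by (auto simp: \<zeta>0_def)
      have "length (\<zeta> i) = l" using PiE_mem[OF \<zeta>, of i] i by (simp add: lists_of_length_def)
      then have "x i \<notin> level_set (\<zeta> i)" using i by (auto simp: level_set_def)
      then have "(\<Prod>i\<in>?I. indicator (level_set (\<zeta> i)) (x i)) = (0::real)"
        using i by (intro prod_zero bexI[of _ i]) auto
      then show ?thesis using False by simp
    qed
    then have "(\<Sum>\<zeta>\<in>PiE ?I (\<lambda>_. ?P). (\<Prod>i\<in>?I. indicator (level_set (\<zeta> i)) (x i)) * F \<zeta>) =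
      (\<Sum>\<zeta>\<in>PiE ?I (\<lambda>_. ?P). if \<zeta>0 = \<zeta> then F \<zeta> else 0)"
      by (intro sum.cong refl) auto
    also have "\<dots> = F \<zeta>0" using fin \<zeta>0 by (simp add: sum.delta)
    also have "\<dots> = (\<Prod>(i, j)\<in>S. W_step l (x i) (x j))"
      unfolding F_def using S by (intro prod.cong refl) (auto simp: \<zeta>0_def W_step_def)
    finally show ?thesis ..
  qed
  have int: "integrable unif01 (indicator (level_set z) :: real \<Rightarrow> real)" for z
    by (rule U.integrable_real_bounded[of _ 1]) auto
  have int_prod: "integrable (PiM ?I (\<lambda>_. unif01)) (\<lambda>x. (\<Prod>i\<in>?I. indicator (level_set (\<zeta> i)) (x i)) :: real)" for \<zeta>
    by (rule product_integrable_prod) (auto intro: int)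
  have "(\<integral>x. (\<Prod>(i, j)\<in>S. W_step l (x i) (x j)) \<partial>PiM ?I (\<lambda>_. unif01)) =
    (\<Sum>\<zeta>\<in>PiE ?I (\<lambda>_. ?P). \<integral>x. (\<Prod>i\<in>?I. indicator (level_set (\<zeta> i)) (x i)) * F \<zeta> \<partial>PiM ?I (\<lambda>_. unif01))"
    unfolding eq by (rule Bochner_Integration.integral_sum) (rule integrable_mult_left, rule int_prod)
  also have "\<dots> = (\<Sum>\<zeta>\<in>PiE ?I (\<lambda>_. ?P). (\<Prod>i\<in>?I. \<omega> (\<zeta> i)) * F \<zeta>)"
  proof (rule sum.cong[OF refl])
    fix \<zeta>
    have "(\<integral>x. (\<Prod>i\<in>?I. indicator (level_set (\<zeta> i)) (x i)) \<partial>PiM ?I (\<lambda>_. unif01)) =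
      (\<Prod>i\<in>?I. \<integral>u. indicator (level_set (\<zeta> i)) u \<partial>unif01 :: real)"
      by (rule product_integral_prod) (auto intro: int)
    also have "\<dots> = (\<Prod>i\<in>?I. \<omega> (\<zeta> i))" by (simp add: measure_level_set)
    finally show "(\<integral>x. (\<Prod>i\<in>?I. indicator (level_set (\<zeta> i)) (x i)) * F \<zeta> \<partial>PiM ?I (\<lambda>_. unif01)) = (\<Prod>i\<in>?I. \<omega> (\<zeta> i)) * F \<zeta>"
      by simp
  qed
  finally show ?thesis by (simp add: step_dens_def F_def)
qed

abbreviation UU :: "(real \<times> real) measure" where "UU \<equiv> unif01 \<Otimes>\<^sub>M unif01"

lemma sets_UU: "sets UU = sets (borel \<Otimes>\<^sub>M borel)"
  by (intro sets_pair_measure_cong) auto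

lemma prob_space_UU: "prob_space UU"
proof -
  interpret U: prob_space unif01 by (rule prob_space_unif01)
  interpret pair_prob_space unif01 unif01 ..
  show ?thesis by (rule prob_space_axioms)
qed

lemma measurable_W_step_UU: "(\<lambda>p. W_step l (fst p) (snd p)) \<in> borel_measurable UU"
  using measurable_W_step[of l] by (simp add: measurable_cong_sets[OF sets_UU refl] case_prod_beta')

lemma measure_UU_rect: "A \<in> sets borel \<Longrightarrow> B \<in> sets borel \<Longrightarrow> measure UU (A \<times> B) = measure unif01 A * measure unif01 B"
proof -
  assume "A \<in> sets borel" "B \<in> sets borel"
  interpret U: prob_space unif01 by (rule prob_space_unif01)
  show ?thesis
    using \<open>A \<in> sets borel\<close> \<open>B \<in> sets borel\<close>
    by (subst measure_def) (simp add: U.emeasure_pair_measure_Times U.emeasure_eq_measure enn2real_mult)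
qed

lemma integrable_W_step_mult:
  assumes "f \<in> borel_measurable UU" "\<And>p. \<bar>f p\<bar> \<le> 1"
  shows "integrable UU (\<lambda>p. W_step l (fst p) (snd p) * f p)"
proof -
  interpret prob_space UU by (rule prob_space_UU)
  show ?thesis
    by (rule integrable_real_bounded[of _ 1])
      (use assms measurable_W_step_UU in \<open>auto simp: abs_mult W_step_nonneg W_step_le_1 intro!: mult_le_one\<close>)
qed

lemma ind_rect_measurable: "(\<lambda>p. indicator (level_set z) (fst p) * indicator (level_set z') (snd p) :: real) \<in> borel_measurable UU"
  unfolding measurable_cong_sets[OF sets_UU refl] by measurable

text \<open>The martingale property: refining keeps the mass of a coarse rectangle, because
  \<open>e\<close> is additive under splitting in either argument. The induction cuts the rectangle
  into four and moves one unit of depth from \<open>d\<close> to \<open>l\<close>.\<close>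

lemma integral_rect_W_step:
  assumes "length z = l" "length z' = l"
  shows "(\<integral>p. W_step (l + d) (fst p) (snd p) * (indicator (level_set z) (fst p) * indicator (level_set z') (snd p)) \<partial>UU) = e z z'"
  using assms
proof (induction d arbitrary: l z z')
  case 0
  have "(\<integral>p. W_step l (fst p) (snd p) * (indicator (level_set z) (fst p) * indicator (level_set z') (snd p)) \<partial>UU) =
     (\<integral>p. e z z' / (\<omega> z * \<omega> z') * indicator (level_set z \<times> level_set z') p \<partial>UU)"
    using 0 by (intro Bochner_Integration.integral_cong) (auto simp: indicator_def W_step_rectangle split: if_splits)
  also have "\<dots> = e z z' / (\<omega> z * \<omega> z') * measure UU (level_set z \<times> level_set z')"
    by simp
  \<comment> \<open>If one of the weights is zero, the quotient has the default value zero, and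
    \<open>e_le\<close> makes \<open>e z z'\<close> zero as well.\<close>
  also have "\<dots> = e z z'"
    using e_nonneg[of z z'] e_le[of z z'] by (auto simp: measure_UU_rect measure_level_set)
  finally show ?case by simp
next
  case (Suc d)
  let ?g = "\<lambda>z z' p. W_step (Suc l + d) (fst p) (snd p) * (indicator (level_set z) (fst p) * indicator (level_set z') (snd p))"
  have int: "integrable UU (?g z z')" for z z'
    by (intro integrable_W_step_mult ind_rect_measurable) (auto simp: indicator_def)
  have ind: "indicator (level_set z) u = indicator (level_set (z @ [False])) u + (indicator (level_set (z @ [True])) u :: real)" for z u
    using level_set_split[of z] by (auto simp: indicator_def)
  have "?g z z' p = ?g (z @ [False]) (z' @ [False]) p + ?g (z @ [False]) (z' @ [True]) p
      + ?g (z @ [True]) (z' @ [False]) p + ?g (z @ [True]) (z' @ [True]) p" for p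
    unfolding ind[of z] ind[of z'] by (simp add: algebra_simps)
  then have "(\<integral>p. ?g z z' p \<partial>UU) = (\<integral>p. ?g (z @ [False]) (z' @ [False]) p \<partial>UU) + (\<integral>p. ?g (z @ [False]) (z' @ [True]) p \<partial>UU)
     + (\<integral>p. ?g (z @ [True]) (z' @ [False]) p \<partial>UU) + (\<integral>p. ?g (z @ [True]) (z' @ [True]) p \<partial>UU)"
    using int by (simp only: Bochner_Integration.integral_add Bochner_Integration.integrable_add)
  also have "\<dots> = e z z'"
    using Suc.prems by (subst Suc.IH, simp, simp)+ (simp add: e_split1[of z z'] e_split2[of "z @ [False]" z'] e_split2[of "z @ [True]" z'])
  finally show ?case by simp
qed

definition step_energy :: "nat \<Rightarrow> real" where
  "step_energy l = (\<integral>p. (W_step l (fst p) (snd p))\<^sup>2 \<partial>UU)"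

text \<open>The coarse kernel is a combination of rectangles of level \<open>l\<close>, on each of
  which every finer kernel has the same mass. So the coarse kernel is the projection of the finer
  one.\<close>

lemma integral_W_step_mult: "(\<integral>p. W_step (l + d) (fst p) (snd p) * W_step l (fst p) (snd p) \<partial>UU) = step_energy l"
proof -
  let ?P = "lists_of_length UNIV l :: bool list set"
  let ?I = "\<lambda>z z' p. indicator (level_set z) (fst p) * indicator (level_set z') (snd p) :: real"
  have fin: "finite ?P" by (rule finite_lists_of_length) simp
  have int: "integrable UU (\<lambda>p. W_step m (fst p) (snd p) * ?I z z' p)" for m z z'
    by (intro integrable_W_step_mult ind_rect_measurable) (auto simp: indicator_def)
  have "(\<integral>p. W_step (l + d) (fst p) (snd p) * W_step l (fst p) (snd p) \<partial>UU) =
     (\<Sum>z\<in>?P. \<Sum>z'\<in>?P. e z z' / (\<omega> z * \<omega> z') * e z z')" for d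
  proof -
    have "(\<integral>p. W_step (l + d) (fst p) (snd p) * W_step l (fst p) (snd p) \<partial>UU) =
       (\<integral>p. (\<Sum>z\<in>?P. \<Sum>z'\<in>?P. e z z' / (\<omega> z * \<omega> z') * (W_step (l + d) (fst p) (snd p) * ?I z z' p)) \<partial>UU)"
      unfolding W_step_eq_sum[of l] sum_distrib_left by (simp add: mult_ac)
    also have "\<dots> = (\<Sum>z\<in>?P. \<Sum>z'\<in>?P. e z z' / (\<omega> z * \<omega> z') * (\<integral>p. W_step (l + d) (fst p) (snd p) * ?I z z' p \<partial>UU))"
      using int by (simp add: Bochner_Integration.integral_sum)
    also have "\<dots> = (\<Sum>z\<in>?P. \<Sum>z'\<in>?P. e z z' / (\<omega> z * \<omega> z') * e z z')"
      by (intro sum.cong refl) (simp add: integral_rect_W_step lists_of_length_def)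
    finally show ?thesis .
  qed
  from this[of d] this[of 0] show ?thesis by (simp add: step_energy_def power2_eq_square)
qed

lemma step_energy_diff: "(\<integral>p. (W_step (l + d) (fst p) (snd p) - W_step l (fst p) (snd p))\<^sup>2 \<partial>UU) = step_energy (l + d) - step_energy l"
proof -
  have int: "integrable UU (\<lambda>p. W_step m (fst p) (snd p) * W_step k (fst p) (snd p))" for m k
    by (intro integrable_W_step_mult measurable_W_step_UU) (auto simp: W_step_nonneg W_step_le_1)
  have "(\<integral>p. (W_step (l + d) (fst p) (snd p) - W_step l (fst p) (snd p))\<^sup>2 \<partial>UU) =
    (\<integral>p. W_step (l + d) (fst p) (snd p) * W_step (l + d) (fst p) (snd p)
       + W_step l (fst p) (snd p) * W_step l (fst p) (snd p)
       - 2 * (W_step (l + d) (fst p) (snd p) * W_step l (fst p) (snd p)) \<partial>UU)"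
    by (simp add: power2_eq_square algebra_simps)
  also have "\<dots> = step_energy (l + d) + step_energy l - 2 * step_energy l"
    using int integral_W_step_mult[of l d] integral_W_step_mult[of l 0] integral_W_step_mult[of "l + d" 0] by simp
  finally show ?thesis by simp
qed

lemma step_energy_mono: "l \<le> m \<Longrightarrow> step_energy l \<le> step_energy m"
proof -
  assume "l \<le> m"
  have "0 \<le> (\<integral>p. (W_step (l + (m - l)) (fst p) (snd p) - W_step l (fst p) (snd p))\<^sup>2 \<partial>UU)"
    by (rule integral_nonneg_AE) simp
  then show ?thesis unfolding step_energy_diff using \<open>l \<le> m\<close> by simp
qed

lemma step_energy_le_1: "step_energy l \<le> 1"
proof -
  interpret prob_space UU by (rule prob_space_UU)
  have "step_energy l \<le> (\<integral>p. 1 \<partial>UU)"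
    unfolding step_energy_def power2_eq_square
    by (intro integral_mono integrable_W_step_mult measurable_W_step_UU)
      (auto simp: W_step_nonneg W_step_le_1 mult_le_one)
  then show ?thesis by (simp add: prob_space)
qed

lemma W_step_L1_le:
  assumes "l \<le> m"
  shows "(\<integral>p. \<bar>W_step m (fst p) (snd p) - W_step l (fst p) (snd p)\<bar> \<partial>UU) \<le> sqrt (step_energy m - step_energy l)"
proof -
  interpret prob_space UU by (rule prob_space_UU)
  have *: "\<bar>W_step m x y - W_step l x y\<bar> \<le> 1" for x y
    using W_step_nonneg[of m x y] W_step_le_1[of m x y] W_step_nonneg[of l x y] W_step_le_1[of l x y] by linarith
  have m: "(\<lambda>p. W_step m (fst p) (snd p) - W_step l (fst p) (snd p)) \<in> borel_measurable UU"
    by (intro borel_measurable_diff measurable_W_step_UU)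
  have "(\<integral>p. \<bar>W_step m (fst p) (snd p) - W_step l (fst p) (snd p)\<bar> \<partial>UU) \<le>
     sqrt (\<integral>p. (W_step m (fst p) (snd p) - W_step l (fst p) (snd p))\<^sup>2 \<partial>UU)"
    by (intro expectation_abs_le_sqrt integrable_real_bounded[of _ 1] borel_measurable_power m)
      (auto simp: * abs_square_le_1)
  then show ?thesis using step_energy_diff[of l "m - l"] assms by simp
qed

text \<open>Bounded energies make the step kernels Cauchy in mean square. Energy gaps below
  \<open>(1 / 4) ^ i\<close> give mean distances of at most \<open>(1 / 2) ^ i\<close>, whose
  summability yields convergence almost everywhere along \<open>r\<close>. Densities follow by
  dominated convergence, since a loop-free relation only sees pairs of distinct coordinates.\<close>

lemma exists_limit_kernel:
  assumes level: "\<And>j. level j \<ge> j"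
  obtains W :: "real \<Rightarrow> real \<Rightarrow> real" and r :: "nat \<Rightarrow> nat"
  where "(\<lambda>(x, y). W x y) \<in> borel_measurable (borel \<Otimes>\<^sub>M borel)" "\<And>x y. 0 \<le> W x y" "\<And>x y. W x y \<le> 1"
    "\<And>i. r i \<ge> i"
    "\<And>n S. S \<subseteq> {..<n} \<times> {..<n} \<Longrightarrow> (\<And>i. (i, i) \<notin> S) \<Longrightarrow>
      (\<lambda>i. step_dens \<omega> e (lists_of_length UNIV (level (r i))) {..<n} S) \<longlonglongrightarrow>
      (\<integral>x. (\<Prod>(i, j)\<in>S. W (x i) (x j)) \<partial>PiM {..<n} (\<lambda>_. unif01))"
proof -
  interpret UU: prob_space UU by (rule prob_space_UU)
  have "incseq step_energy" by (simp add: incseq_def step_energy_mono)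
  then obtain A0 where A0: "step_energy \<longlonglongrightarrow> A0" "\<And>k. step_energy k \<le> A0"
    using incseq_convergent[of step_energy 1] step_energy_le_1 by metis
  have "\<exists>k. \<forall>l\<ge>k. A0 - step_energy l < (1 / 4) ^ i" for i :: nat
  proof -
    have "eventually (\<lambda>k. A0 - (1 / 4) ^ i < step_energy k) sequentially"
      using A0(1) by (intro order_tendstoD) auto
    then obtain k where "\<And>l. l \<ge> k \<Longrightarrow> A0 - (1 / 4) ^ i < step_energy l"
      unfolding eventually_sequentially by blast
    then show ?thesis by (intro exI[of _ k]) (auto simp: algebra_simps)
  qed
  then obtain k where k: "\<And>i l. l \<ge> k i \<Longrightarrow> A0 - step_energy l < (1 / 4) ^ i" by metis
  define r where "r i = i + k i" for i
  define f where "f i p = W_step (level (r i)) (fst p) (snd p)" for i p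
  \<comment> \<open>\<open>level\<close> is not assumed to be monotone, so consecutive energies are
    compared in absolute value.\<close>
  have near: "\<bar>step_energy (level (r (Suc i))) - step_energy (level (r i))\<bar> < (1 / 4) ^ i" for i
  proof -
    have "level (r i) \<ge> k i" "level (r (Suc i)) \<ge> k (Suc i)"
      using level[of "r i"] level[of "r (Suc i)"] by (auto simp: r_def)
    then have "A0 - step_energy (level (r i)) < (1 / 4) ^ i" "A0 - step_energy (level (r (Suc i))) < (1 / 4) ^ Suc i"
      using k[of i "level (r i)"] k[of "Suc i" "level (r (Suc i))"] by blast+
    moreover have "(1 / 4 :: real) ^ Suc i \<le> (1 / 4) ^ i" by (intro power_decreasing) auto
    ultimately show ?thesis using A0(2)[of "level (r i)"] A0(2)[of "level (r (Suc i))"] by linarith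
  qed
  have [measurable]: "f i \<in> borel_measurable UU" for i
    unfolding f_def by (rule measurable_W_step_UU)
  have f_bounds: "0 \<le> f i p" "f i p \<le> 1" for i p
    by (auto simp: f_def W_step_nonneg W_step_le_1)
  have f_diff: "\<bar>f j p - f i p\<bar> \<le> 1" for i j p
    using f_bounds[of i p] f_bounds[of j p] by linarith
  have L1: "(\<integral>p. \<bar>f (Suc i) p - f i p\<bar> \<partial>UU) \<le> (1 / 2) ^ i" for i
  proof -
    have "(\<integral>p. \<bar>f (Suc i) p - f i p\<bar> \<partial>UU) \<le> sqrt \<bar>step_energy (level (r (Suc i))) - step_energy (level (r i))\<bar>"
    proof (cases "level (r i) \<le> level (r (Suc i))")
      case True
      then show ?thesis using W_step_L1_le[OF True] step_energy_mono[OF True] by (simp add: f_def)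
    next
      case False
      then show ?thesis
        using W_step_L1_le[of "level (r (Suc i))" "level (r i)"] step_energy_mono[of "level (r (Suc i))" "level (r i)"]
        by (simp add: f_def abs_minus_commute)
    qed
    also have "\<dots> \<le> sqrt ((1 / 4) ^ i)" using near[of i] by simp
    also have "\<dots> = (1 / 2) ^ i" by (simp add: real_sqrt_power real_sqrt_divide)
    finally show ?thesis .
  qed
  have "AE p in UU. summable (\<lambda>i. \<bar>f (Suc i) p - f i p\<bar>)"
  proof (rule AE_summable_of_summable_integral)
    show "integrable UU (\<lambda>p. f (Suc i) p - f i p)" for i
      by (rule UU.integrable_real_bounded[of _ 1]) (auto simp: f_diff)
    show "summable (\<lambda>i. \<integral>p. \<bar>f (Suc i) p - f i p\<bar> \<partial>UU)"
      using L1 by (intro summable_comparison_test'[OF summable_geometric[of "1 / 2"], of 0]) auto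
  qed
  then have conv: "AE p in UU. convergent (\<lambda>i. f i p)"
  proof eventually_elim
    case (elim p)
    from summable_rabs_cancel[OF elim] have "convergent (\<lambda>n. \<Sum>i<n. f (Suc i) p - f i p)"
      by (simp add: summable_iff_convergent)
    then have "convergent (\<lambda>n. f 0 p + (\<Sum>i<n. f (Suc i) p - f i p))"
      by (rule convergent_add[OF convergent_const])
    then show ?case using sum_lessThan_telescope[of "\<lambda>i. f i p"] by simp
  qed
  \<comment> \<open>Clipping puts the values in the unit interval also at points where the limit
    does not exist.\<close>
  define W where "W x y = max 0 (min 1 (lim (\<lambda>i. f i (x, y))))" for x y
  have W_lim: "(\<lambda>i. f i (x, y)) \<longlonglongrightarrow> W x y" if "convergent (\<lambda>i. f i (x, y))" for x y
  proof -
    have lim: "(\<lambda>i. f i (x, y)) \<longlonglongrightarrow> lim (\<lambda>i. f i (x, y))"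
      by (rule iffD1[OF convergent_LIMSEQ_iff that])
    have "0 \<le> lim (\<lambda>i. f i (x, y))" "lim (\<lambda>i. f i (x, y)) \<le> 1"
      by (intro LIMSEQ_le_const[OF lim] LIMSEQ_le_const2[OF lim] exI[of _ 0] allI impI f_bounds)+
    then show ?thesis using lim by (simp only: W_def min_absorb2 max_absorb2)
  qed
  have fB [measurable]: "f i \<in> borel_measurable (borel \<Otimes>\<^sub>M borel)" for i
  proof -
    have "f i = (\<lambda>(x, y). W_step (level (r i)) x y)" by (auto simp: f_def)
    then show ?thesis using measurable_W_step[of "level (r i)"] by simp
  qed
  have meas: "(\<lambda>(x, y). W x y) \<in> borel_measurable (borel \<Otimes>\<^sub>M borel)"
    unfolding W_def case_prod_beta' prod.collapse
    by (intro borel_measurable_max borel_measurable_min borel_measurable_lim_metric borel_measurable_const fB)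
  have W0: "0 \<le> W x y" "W x y \<le> 1" for x y
    by (simp_all add: W_def)
  show ?thesis
  proof (rule that[OF meas W0])
    show "r i \<ge> i" for i by (simp add: r_def)
    fix n and S :: "(nat \<times> nat) set" assume S: "S \<subseteq> {..<n} \<times> {..<n}" "\<And>i. (i, i) \<notin> S"
    have finS: "finite S" using S(1) finite_subset by blast
    interpret U: prob_space unif01 by (rule prob_space_unif01)
    interpret P: prob_space "PiM {..<n} (\<lambda>_. unif01)"
      by (intro prob_space_PiM prob_space_unif01)
    have coord: "(\<lambda>x. (x i, x j)) \<in> measurable (PiM {..<n} (\<lambda>_. unif01)) (borel \<Otimes>\<^sub>M borel)"
      if "(i, j) \<in> S" for i j
    proof -
      have "i < n" "j < n" using that S(1) by auto
      then have "(\<lambda>x. (x i, x j)) \<in> measurable (PiM {..<n} (\<lambda>_. unif01)) UU"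
        by (intro measurable_Pair measurable_component_singleton) auto
      then show ?thesis by (simp add: measurable_cong_sets[OF refl sets_UU])
    qed
    have "AE x in PiM {..<n} (\<lambda>_. unif01). \<forall>p\<in>S. convergent (\<lambda>i. f i (x (fst p), x (snd p)))"
    proof (intro AE_finite_allI finS)
      fix p assume "p \<in> S"
      then have p: "fst p \<in> {..<n}" "snd p \<in> {..<n}" "fst p \<noteq> snd p"
        using S(1) S(2)[of "fst p"] by (cases p; auto)+
      show "AE x in PiM {..<n} (\<lambda>_. unif01). convergent (\<lambda>i. f i (x (fst p), x (snd p)))"
        by (rule AE_PiM_pair[OF prob_space_unif01 p conv])
    qed
    then have AE: "AE x in PiM {..<n} (\<lambda>_. unif01). (\<lambda>i. \<Prod>(k, l)\<in>S. f i (x k, x l)) \<longlonglongrightarrow> (\<Prod>(k, l)\<in>S. W (x k) (x l))"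
    proof eventually_elim
      case (elim x)
      show ?case
        unfolding case_prod_beta' using elim by (intro tendsto_prod W_lim) (rule bspec)
    qed
    have prod1: "\<bar>\<Prod>(k, l)\<in>S. f i (x k, x l)\<bar> \<le> 1" for i x
      by (rule abs_prod_le_1) (auto simp: f_bounds)
    have "(\<lambda>i. \<integral>x. (\<Prod>(k, l)\<in>S. f i (x k, x l)) \<partial>PiM {..<n} (\<lambda>_. unif01)) \<longlonglongrightarrow>
      (\<integral>x. (\<Prod>(k, l)\<in>S. W (x k) (x l)) \<partial>PiM {..<n} (\<lambda>_. unif01))"
    proof (rule integral_dominated_convergence[where w = "\<lambda>_. 1"])
      show "(\<lambda>x. \<Prod>(k, l)\<in>S. W (x k) (x l)) \<in> borel_measurable (PiM {..<n} (\<lambda>_. unif01))"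
        using measurable_compose[OF coord meas] by (intro borel_measurable_prod) (auto split: prod.splits)
      show "(\<lambda>x. \<Prod>(k, l)\<in>S. f i (x k, x l)) \<in> borel_measurable (PiM {..<n} (\<lambda>_. unif01))" for i
        using measurable_compose[OF coord fB] by (intro borel_measurable_prod) (auto split: prod.splits)
    qed (use AE prod1 in auto)
    moreover have "(\<integral>x. (\<Prod>(k, l)\<in>S. f i (x k, x l)) \<partial>PiM {..<n} (\<lambda>_. unif01)) =
       step_dens \<omega> e (lists_of_length UNIV (level (r i))) {..<n} S" for i
      using integral_W_step_prod[OF S(1), of "level (r i)"] by (simp add: f_def)
    ultimately show "(\<lambda>i. step_dens \<omega> e (lists_of_length UNIV (level (r i))) {..<n} S) \<longlonglongrightarrow>
      (\<integral>x. (\<Prod>(i, j)\<in>S. W (x i) (x j)) \<partial>PiM {..<n} (\<lambda>_. unif01))"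
      by simp
  qed
qed

end

text \<open>An exchange of two limits: a level is fixed for which both the discretisation error and
  the distance of the step density to the kernel density are small, and only then does the digraph
  vary.\<close>

lemma digraph_sequence_kernel:
  fixes N :: "nat \<Rightarrow> nat" and g :: "nat \<Rightarrow> nat \<Rightarrow> nat \<Rightarrow> bool"
  assumes N: "\<And>s. N s \<ge> 1"
  obtains \<sigma> :: "nat \<Rightarrow> nat" and W :: "real \<Rightarrow> real \<Rightarrow> real"
  where "strict_mono \<sigma>" "(\<lambda>(x, y). W x y) \<in> borel_measurable (borel \<Otimes>\<^sub>M borel)"
    "\<And>x y. 0 \<le> W x y" "\<And>x y. W x y \<le> 1"
    "\<And>n S. S \<subseteq> {..<n} \<times> {..<n} \<Longrightarrow> (\<And>i. (i, i) \<notin> S) \<Longrightarrow> (\<And>i j. (i, j) \<in> S \<Longrightarrow> (j, i) \<notin> S) \<Longrightarrow>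
      (\<lambda>s. finite_digraph.dens {..<N (\<sigma> s)} {..<n} S (\<lambda>u v. of_bool (g (\<sigma> s) u v))) \<longlonglongrightarrow>
      (\<integral>x. (\<Prod>(i, j)\<in>S. W (x i) (x j)) \<partial>PiM {..<n} (\<lambda>_. unif01))"
proof -
  obtain \<sigma> \<omega> e level where *: "strict_mono \<sigma>" "\<And>j. level j \<ge> j"
    "\<omega> [] = 1" "\<And>z. 0 \<le> \<omega> z" "\<And>z. \<omega> z = \<omega> (z @ [False]) + \<omega> (z @ [True])"
    "\<And>z z'. e z z' = e (z @ [False]) z' + e (z @ [True]) z'"
    "\<And>z z'. e z z' = e z (z' @ [False]) + e z (z' @ [True])"
    "\<And>z z'. 0 \<le> e z z'" "\<And>z z'. e z z' \<le> \<omega> z * \<omega> z'"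
    and lim: "\<And>n S j \<epsilon>. S \<subseteq> {..<n} \<times> {..<n} \<Longrightarrow> (\<And>i. (i, i) \<notin> S) \<Longrightarrow>
      (\<And>i j. (i, j) \<in> S \<Longrightarrow> (j, i) \<notin> S) \<Longrightarrow> n \<le> j \<Longrightarrow> \<epsilon> > 0 \<Longrightarrow>
      eventually (\<lambda>J. \<bar>finite_digraph.dens {..<N (\<sigma> J)} {..<n} S (\<lambda>u v. of_bool (g (\<sigma> J) u v)) -
        step_dens \<omega> e (lists_of_length UNIV (level j)) {..<n} S\<bar> \<le> real (card S) * (2 * (1 / 2) ^ j) + \<epsilon>) sequentially"
    by (rule digraph_sequence_limit[of N g, OF N]) blast
  interpret nested_weights \<omega> e
    by unfold_locales (rule *)+
  obtain W r where W: "(\<lambda>(x, y). W x y) \<in> borel_measurable (borel \<Otimes>\<^sub>M borel)" "\<And>x y. 0 \<le> W x y" "\<And>x y. W x y \<le> 1"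
    and r: "\<And>i. r i \<ge> i"
    and Wlim: "\<And>n S. S \<subseteq> {..<n} \<times> {..<n} \<Longrightarrow> (\<And>i. (i, i) \<notin> S) \<Longrightarrow>
      (\<lambda>i. step_dens \<omega> e (lists_of_length UNIV (level (r i))) {..<n} S) \<longlonglongrightarrow>
      (\<integral>x. (\<Prod>(i, j)\<in>S. W (x i) (x j)) \<partial>PiM {..<n} (\<lambda>_. unif01))"
    by (rule exists_limit_kernel[of level, OF *(2)]) blast
  show ?thesis
  proof (rule that[OF *(1) W])
    fix n and S :: "(nat \<times> nat) set"
    assume S: "S \<subseteq> {..<n} \<times> {..<n}" "\<And>i. (i, i) \<notin> S" "\<And>i j. (i, j) \<in> S \<Longrightarrow> (j, i) \<notin> S"
    let ?L = "\<integral>x. (\<Prod>(i, j)\<in>S. W (x i) (x j)) \<partial>PiM {..<n} (\<lambda>_. unif01)"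
    let ?T = "\<lambda>j. step_dens \<omega> e (lists_of_length UNIV (level j)) {..<n} S"
    show "(\<lambda>s. finite_digraph.dens {..<N (\<sigma> s)} {..<n} S (\<lambda>u v. of_bool (g (\<sigma> s) u v))) \<longlonglongrightarrow> ?L"
    proof (rule tendstoI)
      fix \<epsilon> :: real assume \<epsilon>: "\<epsilon> > 0"
      have "(\<lambda>i. real (card S) * (2 * (1 / 2) ^ i)) \<longlonglongrightarrow> real (card S) * (2 * 0)"
        by (intro tendsto_intros LIMSEQ_power_zero) auto
      then have "eventually (\<lambda>i. real (card S) * (2 * (1 / 2) ^ i) < \<epsilon> / 4) sequentially"
        using \<epsilon> by (intro order_tendstoD(2)) auto
      moreover have "eventually (\<lambda>i. dist (?T (r i)) ?L < \<epsilon> / 4) sequentially"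
        using Wlim[OF S(1,2)] \<epsilon> by (intro tendstoD) auto
      moreover have "eventually (\<lambda>i. i \<ge> n) sequentially" by (rule eventually_ge_at_top)
      ultimately have "eventually (\<lambda>i. real (card S) * (2 * (1 / 2) ^ i) < \<epsilon> / 4 \<and> dist (?T (r i)) ?L < \<epsilon> / 4 \<and> i \<ge> n) sequentially"
        by eventually_elim auto
      then obtain i where i: "real (card S) * (2 * (1 / 2) ^ i) < \<epsilon> / 4" "dist (?T (r i)) ?L < \<epsilon> / 4" "i \<ge> n"
        using eventually_happens'[OF sequentially_bot] by blast
      have "real (card S) * (2 * (1 / 2) ^ r i) \<le> real (card S) * (2 * (1 / 2) ^ i)"
        using r[of i] by (intro mult_left_mono power_decreasing) auto
      then have ri: "real (card S) * (2 * (1 / 2) ^ r i) < \<epsilon> / 4" using i(1) by linarith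
      have "n \<le> r i" "\<epsilon> / 4 > 0" using i(3) r[of i] \<epsilon> by auto
      from lim[OF S this] show "eventually (\<lambda>s. dist (finite_digraph.dens {..<N (\<sigma> s)} {..<n} S (\<lambda>u v. of_bool (g (\<sigma> s) u v))) ?L < \<epsilon>) sequentially"
      proof (rule eventually_mono)
        fix s
        assume "\<bar>finite_digraph.dens {..<N (\<sigma> s)} {..<n} S (\<lambda>u v. of_bool (g (\<sigma> s) u v)) - ?T (r i)\<bar>
          \<le> real (card S) * (2 * (1 / 2) ^ r i) + \<epsilon> / 4"
        then show "dist (finite_digraph.dens {..<N (\<sigma> s)} {..<n} S (\<lambda>u v. of_bool (g (\<sigma> s) u v))) ?L < \<epsilon>"
          using ri i(2) \<epsilon> unfolding dist_real_def by linarith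
      qed
    qed
  qed
qed

section \<open>A version satisfying the poset conditions everywhere\<close>

text \<open>The area of \<open>F\<close> within the square of side \<open>h\<close> with lower left
  corner \<open>(x, y)\<close>. The iterated integral makes measurability in the corner visible and
  suits the argument with three variables below.\<close>

definition sq_mass :: "(real \<times> real) set \<Rightarrow> real \<Rightarrow> real \<Rightarrow> real \<Rightarrow> ennreal" where
  "sq_mass F h x y =
    (\<integral>\<^sup>+x'. \<integral>\<^sup>+y'. indicator F (x', y') * indicator {x..x + h} x' * indicator {y..y + h} y' \<partial>lborel \<partial>lborel)"

text \<open>For Borel \<open>F\<close> this says that the density of \<open>F\<close> in the squares
  of side \<open>1 / (n + 1)\<close> at the corner \<open>(x, y)\<close> tends to one. Only
  countable quantifiers occur, which makes it a measurable condition on the corner.\<close>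

definition dense_at :: "(real \<times> real) set \<Rightarrow> real \<Rightarrow> real \<Rightarrow> bool" where
  "dense_at F x y \<longleftrightarrow> (\<forall>k::nat. \<exists>m::nat. \<forall>n\<ge>m.
     1 - 1 / (real k + 1) < enn2real (sq_mass F (1 / (real n + 1)) x y) * (real n + 1)\<^sup>2)"

lemma sets_borel_pair: "sets (borel \<Otimes>\<^sub>M borel :: (real \<times> real) measure) = sets borel"
  by (rule arg_cong[OF borel_prod])

lemma sq_mass_eq_emeasure:
  assumes [measurable]: "F \<in> sets borel"
  shows "sq_mass F h x y = emeasure lborel (F \<inter> {x..x + h} \<times> {y..y + h})"
proof -
  have F: "F \<in> sets (borel \<Otimes>\<^sub>M borel)" using assms by (simp only: sets_borel_pair)
  let ?G = "F \<inter> {x..x + h} \<times> {y..y + h}"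
  have G: "?G \<in> sets (lborel \<Otimes>\<^sub>M lborel)"
    using F by (auto simp: sets_pair_measure_cong[OF sets_lborel sets_lborel])
  have "emeasure lborel ?G = emeasure (lborel \<Otimes>\<^sub>M lborel) ?G" by (simp add: lborel_prod)
  also have "\<dots> = (\<integral>\<^sup>+x'. \<integral>\<^sup>+y'. indicator ?G (x', y') \<partial>lborel \<partial>lborel)"
    by (rule lborel.emeasure_pair_measure[OF G])
  also have "\<dots> = sq_mass F h x y"
    unfolding sq_mass_def by (intro nn_integral_cong) (auto simp: indicator_def)
  finally show ?thesis ..
qed

lemma emeasure_square: "0 \<le> h \<Longrightarrow> emeasure lborel ({x..x + h} \<times> {y..y + h}) = ennreal (h\<^sup>2)" for x y h :: real
  by (simp add: lborel_prod[symmetric] lborel.emeasure_pair_measure_Times ennreal_mult[symmetric] power2_eq_square)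

lemma sets_square: "{x..x + h} \<times> {y..y + h} \<in> sets borel" for x y h :: real
  by (intro borel_closed closed_Times) auto

lemma sq_mass_mono: "F \<subseteq> G \<Longrightarrow> F \<in> sets borel \<Longrightarrow> G \<in> sets borel \<Longrightarrow> sq_mass F h x y \<le> sq_mass G h x y"
  by (auto simp: sq_mass_eq_emeasure sets_square intro!: emeasure_mono sets.Int)

lemma sq_mass_le: "0 \<le> h \<Longrightarrow> F \<in> sets borel \<Longrightarrow> sq_mass F h x y \<le> ennreal (h\<^sup>2)"
  unfolding emeasure_square[of h x y, symmetric] sq_mass_eq_emeasure
  by (intro emeasure_mono) (auto simp: sets_square)

lemma sq_mass_compl:
  assumes "0 \<le> h" "F \<in> sets borel"
  shows "sq_mass F h x y + sq_mass (- F) h x y = ennreal (h\<^sup>2)"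
proof -
  have "sq_mass F h x y + sq_mass (- F) h x y =
    emeasure lborel ((F \<inter> {x..x + h} \<times> {y..y + h}) \<union> (- F \<inter> {x..x + h} \<times> {y..y + h}))"
    using assms sets_square[of x h y]
    by (subst plus_emeasure[symmetric]) (auto simp: sq_mass_eq_emeasure borel_comp)
  also have "(F \<inter> {x..x + h} \<times> {y..y + h}) \<union> (- F \<inter> {x..x + h} \<times> {y..y + h}) = {x..x + h} \<times> {y..y + h}"
    by auto
  finally show ?thesis using assms by (simp add: emeasure_square)
qed

lemma sq_mass_swap:
  assumes F: "F \<in> sets borel"
  shows "sq_mass (prod.swap -` F) h x y = sq_mass F h y x"
proof -
  have [measurable]: "F \<in> sets (borel \<Otimes>\<^sub>M borel)" using F by (simp only: sets_borel_pair)
  have "sq_mass F h y x =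
    (\<integral>\<^sup>+y'. \<integral>\<^sup>+x'. indicator F (x', y') * indicator {y..y + h} x' * indicator {x..x + h} y' \<partial>lborel \<partial>lborel)"
    unfolding sq_mass_def by (rule lborel_pair.Fubini') measurable
  also have "\<dots> = sq_mass (prod.swap -` F) h x y"
    unfolding sq_mass_def by (intro nn_integral_cong) (auto simp: indicator_def)
  finally show ?thesis ..
qed

text \<open>A union bound in the cube over the three intervals: for a triple in it, the first pair
  is outside \<open>F\<close>, or the second is outside \<open>G\<close>, or the outer pair is in
  \<open>H\<close>, or the integrand of \<open>tri\<close> is one. The coordinate that does not
  occur in a pair contributes the factor \<open>h\<close>.\<close>

lemma sq_mass_triangle:
  assumes F: "F \<in> sets borel" "G \<in> sets borel" "H \<in> sets borel" and h: "0 \<le> h"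
    and tri: "(\<integral>\<^sup>+x. \<integral>\<^sup>+y. \<integral>\<^sup>+z. indicator F (x, y) * indicator G (y, z) * indicator (- H) (x, z) \<partial>lborel \<partial>lborel \<partial>lborel) = 0"
  shows "ennreal h * ennreal (h\<^sup>2) \<le>
    ennreal h * sq_mass (- F) h x y + ennreal h * sq_mass (- G) h y z + ennreal h * sq_mass H h x z"
proof -
  have [measurable]: "F \<in> sets (borel \<Otimes>\<^sub>M borel)" "G \<in> sets (borel \<Otimes>\<^sub>M borel)" "H \<in> sets (borel \<Otimes>\<^sub>M borel)"
    "- F \<in> sets (borel \<Otimes>\<^sub>M borel)" "- G \<in> sets (borel \<Otimes>\<^sub>M borel)" "- H \<in> sets (borel \<Otimes>\<^sub>M borel)"
    unfolding sets_borel_pair using F by (auto simp: borel_comp)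
  let ?I = "indicator {x..x + h} :: real \<Rightarrow> ennreal" and ?J = "indicator {y..y + h} :: real \<Rightarrow> ennreal"
    and ?K = "indicator {z..z + h} :: real \<Rightarrow> ennreal"
  have len: "(\<integral>\<^sup>+u. indicator {a..a + h} u \<partial>lborel) = ennreal h" for a :: real
    using h by simp
  have "(\<integral>\<^sup>+x'. \<integral>\<^sup>+y'. \<integral>\<^sup>+z'. ?I x' * ?J y' * ?K z' \<partial>lborel \<partial>lborel \<partial>lborel) =
     (\<integral>\<^sup>+x'. \<integral>\<^sup>+y'. ?I x' * ?J y' * ennreal h \<partial>lborel \<partial>lborel)"
    by (intro nn_integral_cong) (simp add: nn_integral_cmult len)
  also have "\<dots> = (\<integral>\<^sup>+x'. ?I x' * (ennreal h * ennreal h) \<partial>lborel)"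
    by (intro nn_integral_cong) (simp add: nn_integral_cmult nn_integral_multc len mult.assoc)
  also have "\<dots> = ennreal h * (ennreal h * ennreal h)"
    by (simp add: nn_integral_multc len)
  also have "\<dots> = ennreal h * ennreal (h\<^sup>2)"
    using h by (simp add: ennreal_mult power2_eq_square)
  finally have vol: "ennreal h * ennreal (h\<^sup>2) = (\<integral>\<^sup>+x'. \<integral>\<^sup>+y'. \<integral>\<^sup>+z'. ?I x' * ?J y' * ?K z' \<partial>lborel \<partial>lborel \<partial>lborel)" ..
  let ?a = "\<lambda>x' y'. indicator (- F) (x', y') * ?I x' * ?J y'"
  let ?b = "\<lambda>y' z'. indicator (- G) (y', z') * ?J y' * ?K z'"
  let ?c = "\<lambda>x' z'. indicator H (x', z') * ?I x' * ?K z'"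
  let ?d = "\<lambda>x' y' z'. indicator F (x', y') * indicator G (y', z') * indicator (- H) (x', z') :: ennreal"
  have "(\<integral>\<^sup>+x'. \<integral>\<^sup>+y'. \<integral>\<^sup>+z'. ?I x' * ?J y' * ?K z' \<partial>lborel \<partial>lborel \<partial>lborel) \<le>
     (\<integral>\<^sup>+x'. \<integral>\<^sup>+y'. \<integral>\<^sup>+z'. ?a x' y' * ?K z' + ?I x' * ?b y' z' + ?J y' * ?c x' z' + ?d x' y' z' \<partial>lborel \<partial>lborel \<partial>lborel)"
    by (intro nn_integral_mono) (auto simp: indicator_def)
  also have "\<dots> = (\<integral>\<^sup>+x'. \<integral>\<^sup>+y'. ?a x' y' * ennreal h + ?I x' * (\<integral>\<^sup>+z'. ?b y' z' \<partial>lborel)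
      + ?J y' * (\<integral>\<^sup>+z'. ?c x' z' \<partial>lborel) + (\<integral>\<^sup>+z'. ?d x' y' z' \<partial>lborel) \<partial>lborel \<partial>lborel)"
    by (intro nn_integral_cong) (simp add: nn_integral_add nn_integral_cmult len)
  also have "\<dots> = (\<integral>\<^sup>+x'. (\<integral>\<^sup>+y'. ?a x' y' \<partial>lborel) * ennreal h + ?I x' * sq_mass (- G) h y z
      + ennreal h * (\<integral>\<^sup>+z'. ?c x' z' \<partial>lborel) + (\<integral>\<^sup>+y'. \<integral>\<^sup>+z'. ?d x' y' z' \<partial>lborel \<partial>lborel) \<partial>lborel)"
    by (intro nn_integral_cong) (simp add: nn_integral_add nn_integral_cmult nn_integral_multc len sq_mass_def)
  also have "\<dots> = sq_mass (- F) h x y * ennreal h + ennreal h * sq_mass (- G) h y z + ennreal h * sq_mass H h x z + 0"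
    unfolding tri[symmetric]
    by (simp add: nn_integral_add nn_integral_cmult nn_integral_multc len sq_mass_def)
  finally show ?thesis unfolding vol by (simp add: mult.commute)
qed

lemma sq_mass_triangle_real:
  assumes F: "F \<in> sets borel" "G \<in> sets borel" "H \<in> sets borel" and h: "0 < h"
    and tri: "(\<integral>\<^sup>+x. \<integral>\<^sup>+y. \<integral>\<^sup>+z. indicator F (x, y) * indicator G (y, z) * indicator (- H) (x, z) \<partial>lborel \<partial>lborel \<partial>lborel) = 0"
  shows "enn2real (sq_mass F h x y) + enn2real (sq_mass G h y z) \<le> h\<^sup>2 + enn2real (sq_mass H h x z)"
proof -
  let ?r = "\<lambda>F x y. enn2real (sq_mass F h x y)"
  have eq: "sq_mass E h u v = ennreal (?r E u v)" if "E \<in> sets borel" for E u v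
  proof -
    have "sq_mass E h u v < \<top>"
      using sq_mass_le[of h E u v] that h by (auto intro: le_less_trans)
    then show ?thesis by simp
  qed
  have compl: "?r E u v + ?r (- E) u v = h\<^sup>2" if "E \<in> sets borel" for E u v
  proof -
    have "sq_mass E h u v < \<top>" "sq_mass (- E) h u v < \<top>"
      using eq[OF that, of u v] eq[OF borel_comp[OF that], of u v] by (metis ennreal_less_top)+
    then have "?r E u v + ?r (- E) u v = enn2real (sq_mass E h u v + sq_mass (- E) h u v)"
      by (rule enn2real_plus[symmetric])
    then show ?thesis using that h by (simp add: sq_mass_compl)
  qed
  have "ennreal (h * h\<^sup>2) \<le> ennreal (h * ?r (- F) x y + h * ?r (- G) y z + h * ?r H x z)"
    using sq_mass_triangle[OF F less_imp_le[OF h] tri, of x y z] F h eq[of "- F" x y] eq[of "- G" y z] eq[of H x z]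
    by (simp add: borel_comp ennreal_mult)
  then have "h * h\<^sup>2 \<le> h * (?r (- F) x y + ?r (- G) y z + ?r H x z)"
    using h by (subst (asm) ennreal_le_iff) (auto simp: algebra_simps intro!: add_nonneg_nonneg mult_nonneg_nonneg)
  then have "h\<^sup>2 \<le> ?r (- F) x y + ?r (- G) y z + ?r H x z" using h by simp
  then show ?thesis using compl[OF F(1), of x y] compl[OF F(2), of y z] by linarith
qed

text \<open>The triangle estimate survives the limit of small squares. What is known for almost all
  triples is thereby forced for every triple whose first two pairs are density points.\<close>

lemma dense_at_triangle:
  assumes F: "F \<in> sets borel" "G \<in> sets borel" "H \<in> sets borel"
    and tri: "(\<integral>\<^sup>+x. \<integral>\<^sup>+y. \<integral>\<^sup>+z. indicator F (x, y) * indicator G (y, z) * indicator (- H) (x, z) \<partial>lborel \<partial>lborel \<partial>lborel) = 0"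
    and d: "dense_at F x y" "dense_at G y z"
  shows "dense_at H x z"
  unfolding dense_at_def
proof
  fix k :: nat
  let ?q = "\<lambda>F x y n. enn2real (sq_mass F (1 / (real n + 1)) x y) * (real n + 1)\<^sup>2"
  \<comment> \<open>Each of the two given densities may use up half of the allowed error.\<close>
  have half: "1 - 1 / (real (2 * k + 1) + 1) = 1 - 1 / (real k + 1) / 2" by (simp add: field_simps)
  obtain m1 where m1: "\<And>n. n \<ge> m1 \<Longrightarrow> 1 - 1 / (real k + 1) / 2 < ?q F x y n"
    using d(1) unfolding dense_at_def half[symmetric] by blast
  obtain m2 where m2: "\<And>n. n \<ge> m2 \<Longrightarrow> 1 - 1 / (real k + 1) / 2 < ?q G y z n"
    using d(2) unfolding dense_at_def half[symmetric] by blast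
  show "\<exists>m. \<forall>n\<ge>m. 1 - 1 / (real k + 1) < ?q H x z n"
  proof (intro exI allI impI)
    fix n assume n: "n \<ge> max m1 m2"
    let ?h = "1 / (real n + 1)"
    have h: "?h > 0" "?h\<^sup>2 * (real n + 1)\<^sup>2 = 1" by (auto simp: power_divide)
    have "(enn2real (sq_mass F ?h x y) + enn2real (sq_mass G ?h y z)) * (real n + 1)\<^sup>2 \<le>
      (?h\<^sup>2 + enn2real (sq_mass H ?h x z)) * (real n + 1)\<^sup>2"
      by (intro mult_right_mono sq_mass_triangle_real[OF F h(1) tri]) simp
    then have "?q F x y n + ?q G y z n \<le> 1 + ?q H x z n"
      unfolding distrib_right h(2) .
    moreover have "1 - 1 / (real k + 1) / 2 < ?q F x y n" "1 - 1 / (real k + 1) / 2 < ?q G y z n"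
      using m1[of n] m2[of n] n by auto
    ultimately show "1 - 1 / (real k + 1) < ?q H x z n" by linarith
  qed
qed

lemma dense_at_mono:
  assumes "F \<subseteq> G" "F \<in> sets borel" "G \<in> sets borel" "dense_at F x y"
  shows "dense_at G x y"
  unfolding dense_at_def
proof
  fix k
  obtain m where m: "\<And>n. n \<ge> m \<Longrightarrow> 1 - 1 / (real k + 1) < enn2real (sq_mass F (1 / (real n + 1)) x y) * (real n + 1)\<^sup>2"
    using assms(4) unfolding dense_at_def by blast
  show "\<exists>m. \<forall>n\<ge>m. 1 - 1 / (real k + 1) < enn2real (sq_mass G (1 / (real n + 1)) x y) * (real n + 1)\<^sup>2"
  proof (intro exI allI impI)
    fix n assume "n \<ge> m"
    have "sq_mass G (1 / (real n + 1)) x y < \<top>"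
      using sq_mass_le[of "1 / (real n + 1)" G x y] assms by (auto intro: le_less_trans)
    then have "enn2real (sq_mass F (1 / (real n + 1)) x y) \<le> enn2real (sq_mass G (1 / (real n + 1)) x y)"
      using sq_mass_mono[OF assms(1-3)] by (intro enn2real_mono) auto
    then have "enn2real (sq_mass F (1 / (real n + 1)) x y) * (real n + 1)\<^sup>2 \<le> enn2real (sq_mass G (1 / (real n + 1)) x y) * (real n + 1)\<^sup>2"
      by (intro mult_right_mono) auto
    then show "1 - 1 / (real k + 1) < enn2real (sq_mass G (1 / (real n + 1)) x y) * (real n + 1)\<^sup>2"
      using m[OF \<open>n \<ge> m\<close>] by linarith
  qed
qed

text \<open>At a diagonal density point, two applications of the triangle estimate would fill
  a small square more than completely.\<close>

lemma not_dense_at_diagonal: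
  assumes F: "F \<in> sets borel"
    and cyc: "(\<integral>\<^sup>+x. \<integral>\<^sup>+y. \<integral>\<^sup>+z. indicator F (x, y) * indicator F (y, z) * indicator F (z, x) \<partial>lborel \<partial>lborel \<partial>lborel) = 0"
  shows "\<not> dense_at F x x"
proof
  assume d: "dense_at F x x"
  \<comment> \<open>The cyclic condition says that \<open>F\<close> followed by \<open>F\<close>
    excludes \<open>F\<close> on the reversed outer pair, so \<open>?H\<close> is dense at
    \<open>(x, x)\<close> too. Reversal does not change the mass of a square on the diagonal, so
    \<open>F\<close> and \<open>?H\<close> have complementary masses there and cannot both exceed
    one half.\<close>
  let ?H = "- (prod.swap -` F)"
  have "prod.swap \<in> measurable borel (borel :: (real \<times> real) measure)"
    by (rule borel_measurable_continuous_onI) (rule continuous_on_swap)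
  from measurable_sets[OF this F] have H: "?H \<in> sets borel"
    by (intro borel_comp) simp
  have "(\<integral>\<^sup>+x. \<integral>\<^sup>+y. \<integral>\<^sup>+z. indicator F (x, y) * indicator F (y, z) * indicator (- ?H) (x, z) \<partial>lborel \<partial>lborel \<partial>lborel) = (0::ennreal)"
    using cyc by (simp add: indicator_def)
  then have "dense_at ?H x x" by (rule dense_at_triangle[OF F F H _ d d])
  then obtain m1 m2 where
    m1: "\<And>n. n \<ge> m1 \<Longrightarrow> 1 - 1 / (real 1 + 1) < enn2real (sq_mass ?H (1 / (real n + 1)) x x) * (real n + 1)\<^sup>2" and
    m2: "\<And>n. n \<ge> m2 \<Longrightarrow> 1 - 1 / (real 1 + 1) < enn2real (sq_mass F (1 / (real n + 1)) x x) * (real n + 1)\<^sup>2"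
    using d unfolding dense_at_def by meson
  define n where "n = max m1 m2"
  let ?h = "1 / (real n + 1)"
  have "sq_mass F ?h x x + sq_mass ?H ?h x x = ennreal (?h\<^sup>2)"
    using sq_mass_compl[of ?h "prod.swap -` F" x x] H F borel_comp[OF H] by (simp add: sq_mass_swap)
  moreover have "sq_mass F ?h x x < \<top>" "sq_mass ?H ?h x x < \<top>"
    using sq_mass_le[of ?h F x x] sq_mass_le[of ?h ?H x x] F H by (auto intro: le_less_trans)
  ultimately have "enn2real (sq_mass F ?h x x) + enn2real (sq_mass ?H ?h x x) = ?h\<^sup>2"
    by (simp flip: enn2real_plus)
  then have "(enn2real (sq_mass F ?h x x) + enn2real (sq_mass ?H ?h x x)) * (real n + 1)\<^sup>2 = 1"
    by (simp add: power_divide)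
  then show False
    using m1[of n] m2[of n] by (simp add: n_def distrib_right)
qed

text \<open>Lebesgue's density theorem, in the version for cubes with the point as their lower
  corner; hence the one-sided squares in \<open>sq_mass\<close>.\<close>

lemma AE_dense_at:
  assumes F: "F \<in> sets borel"
  shows "AE p in lborel. dense_at F (fst p) (snd p) \<longleftrightarrow> p \<in> F"
proof -
  have F': "F \<inter> cbox a b \<in> lmeasurable" for a b
    using F by (subst Int_commute, intro fmeasurable_Int_fmeasurable lmeasurable_cbox) (simp add: sets_completionI_sets)
  have "indicat_real F integrable_on cbox a b" for a b
    using F' by (simp add: integrable_on_indicator Int_commute)
  then obtain N where N: "negligible N"
    "\<And>p \<epsilon>. p \<notin> N \<Longrightarrow> 0 < \<epsilon> \<Longrightarrow> \<exists>d>0. \<forall>h. 0 < h \<and> h < d \<longrightarrow>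
       norm (integral (cbox p (p + h *\<^sub>R One)) (indicat_real F) /\<^sub>R h ^ DIM(real \<times> real) - indicat_real F p) < \<epsilon>"
    using integrable_ccontinuous_explicit[of "indicat_real F"] by metis
  have q: "integral (cbox (x, y) ((x, y) + h *\<^sub>R One)) (indicat_real F) = enn2real (sq_mass F h x y)" if "h > 0" for x y h
  proof -
    have One: "(One :: real \<times> real) = (1, 1)"
      by (simp add: Basis_prod_def sum.union_disjoint disjoint_iff sum.reindex inj_on_def)
    have box: "cbox (x, y) ((x, y) + h *\<^sub>R One) = {x..x + h} \<times> {y..y + h}"
      by (auto simp: One cbox_Pair_eq)
    have "integral (cbox (x, y) ((x, y) + h *\<^sub>R One)) (indicat_real F) = measure lebesgue (F \<inter> {x..x + h} \<times> {y..y + h})"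
      using F'[of "(x, y)" "(x, y) + h *\<^sub>R One"] unfolding box by (subst integral_indicator) (auto simp: Int_commute)
    also have "\<dots> = enn2real (sq_mass F h x y)"
      using F sets_square[of x h y] by (simp add: sq_mass_eq_emeasure measure_def)
    finally show ?thesis .
  qed
  have "dense_at F (fst p) (snd p) \<longleftrightarrow> p \<in> F" if p: "p \<notin> N" for p
  proof -
    obtain x y where xy: "p = (x, y)" by (cases p)
    let ?q = "\<lambda>n. enn2real (sq_mass F (1 / (real n + 1)) x y) * (real n + 1)\<^sup>2"
    have lim: "\<exists>m. \<forall>n\<ge>m. \<bar>?q n - indicat_real F p\<bar> < \<epsilon>" if \<epsilon>: "\<epsilon> > 0" for \<epsilon>
    proof -
      obtain d where d: "d > 0" "\<And>h. 0 < h \<Longrightarrow> h < d \<Longrightarrow>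
        norm (integral (cbox p (p + h *\<^sub>R One)) (indicat_real F) /\<^sub>R h ^ DIM(real \<times> real) - indicat_real F p) < \<epsilon>"
        using N(2)[OF p \<epsilon>] by metis
      obtain m :: nat where m: "1 / d < real m" using reals_Archimedean2 by blast
      show ?thesis
      proof (intro exI allI impI)
        fix n assume "n \<ge> m"
        then have "1 / d < real n + 1" using m by simp
        then have h: "0 < 1 / (real n + 1)" "1 / (real n + 1) < d" using d(1) by (auto simp: field_simps)
        show "\<bar>?q n - indicat_real F p\<bar> < \<epsilon>"
          using d(2)[OF h] unfolding xy q[OF h(1)] by (simp add: power_divide power2_eq_square mult_ac)
      qed
    qed
    show ?thesis
    proof (cases "p \<in> F")
      case True
      have "\<exists>m. \<forall>n\<ge>m. 1 - 1 / (real k + 1) < ?q n" for k :: nat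
      proof -
        obtain m where m: "\<And>n. n \<ge> m \<Longrightarrow> \<bar>?q n - 1\<bar> < 1 / (real k + 1)"
          using lim[of "1 / (real k + 1)"] True by auto
        show ?thesis
          using m by (intro exI[of _ m] allI impI) (smt (verit))
      qed
      then show ?thesis using True by (simp add: dense_at_def xy)
    next
      case False
      obtain m where m: "\<And>n. n \<ge> m \<Longrightarrow> \<bar>?q n\<bar> < 1 / 2"
        using lim[of "1 / 2"] False by auto
      have "\<not> dense_at F x y"
      proof
        assume "dense_at F x y"
        then obtain m' where "\<And>n. n \<ge> m' \<Longrightarrow> 1 - 1 / (real 1 + 1) < ?q n"
          unfolding dense_at_def by meson
        from this[of "max m m'"] m[of "max m m'"] show False by auto
      qed
      then show ?thesis using False by (simp add: xy)
    qed
  qed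
  then have "AE p in lebesgue. dense_at F (fst p) (snd p) \<longleftrightarrow> p \<in> F"
    using N(1) unfolding negligible_iff_null_sets by (intro AE_I'[of N]) auto
  then show ?thesis by (simp add: AE_completion_iff)
qed

lemma measurable_dense_at [measurable]:
  assumes F: "F \<in> sets borel"
  shows "Measurable.pred (borel \<Otimes>\<^sub>M borel) (\<lambda>p. dense_at F (fst p) (snd p))"
proof -
  have [measurable]: "F \<in> sets (borel \<Otimes>\<^sub>M borel)" using F by (simp only: sets_borel_pair)
  have "(\<lambda>p. sq_mass F h (fst p) (snd p)) \<in> borel_measurable (borel \<Otimes>\<^sub>M borel)" for h
  proof -
    have "(\<lambda>p. \<integral>\<^sup>+x'. \<integral>\<^sup>+y'. indicator F (x', y') * (if fst p \<le> x' \<and> x' \<le> fst p + h then 1 else 0) *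
        (if snd p \<le> y' \<and> y' \<le> snd p + h then 1 else 0) \<partial>lborel \<partial>lborel) \<in> borel_measurable (borel \<Otimes>\<^sub>M borel)"
      by measurable
    moreover have "sq_mass F h (fst p) (snd p) = (\<integral>\<^sup>+x'. \<integral>\<^sup>+y'. indicator F (x', y') * (if fst p \<le> x' \<and> x' \<le> fst p + h then 1 else 0) *
        (if snd p \<le> y' \<and> y' \<le> snd p + h then 1 else 0) \<partial>lborel \<partial>lborel)" for p
      unfolding sq_mass_def by (intro nn_integral_cong) (auto simp: indicator_def)
    ultimately show ?thesis by simp
  qed
  then show ?thesis unfolding dense_at_def by measurable
qed


section \<open>Transfer between sampled triples and iterated integrals\<close>

lemma nn_integral_unif01: "f \<in> borel_measurable borel \<Longrightarrow> (\<integral>\<^sup>+x. f x \<partial>unif01) = (\<integral>\<^sup>+x. f x * indicator {0<..<1} x \<partial>lborel)"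
  by (subst nn_integral_uniform_measure) (auto simp: divide_ennreal_def)

lemma nn_integral_PiM_unif01_3:
  assumes k [measurable]: "k \<in> borel_measurable (borel \<Otimes>\<^sub>M (borel \<Otimes>\<^sub>M borel))"
  shows "(\<integral>\<^sup>+x. k (x 0, x 1, x 2) \<partial>PiM {..<3::nat} (\<lambda>_. unif01)) =
    (\<integral>\<^sup>+x. \<integral>\<^sup>+y. \<integral>\<^sup>+z. k (x, y, z) * indicator {0<..<1} z * indicator {0<..<1} y * indicator {0<..<1} x
      \<partial>lborel \<partial>lborel \<partial>lborel)"
proof -
  interpret U: prob_space unif01 by (rule prob_space_unif01)
  interpret product_sigma_finite "\<lambda>_::nat. unif01" by unfold_locales
  have [measurable_cong]: "sets unif01 = sets borel" by simp
  have three: "{..<3::nat} = insert 2 (insert 1 {0})" by auto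
  have "(\<integral>\<^sup>+x. k (x 0, x 1, x 2) \<partial>PiM {..<3::nat} (\<lambda>_. unif01)) =
     (\<integral>\<^sup>+x. \<integral>\<^sup>+z. k (x 0, x 1, z) \<partial>unif01 \<partial>PiM (insert 1 {0::nat}) (\<lambda>_. unif01))"
    unfolding three by (subst product_nn_integral_insert) auto
  also have "\<dots> = (\<integral>\<^sup>+x. \<integral>\<^sup>+y. \<integral>\<^sup>+z. k (x 0, y, z) \<partial>unif01 \<partial>unif01 \<partial>PiM {0::nat} (\<lambda>_. unif01))"
    by (subst product_nn_integral_insert) auto
  also have "\<dots> = (\<integral>\<^sup>+x. \<integral>\<^sup>+y. \<integral>\<^sup>+z. k (x, y, z) \<partial>unif01 \<partial>unif01 \<partial>unif01)"
    by (rule product_nn_integral_singleton[where f = "\<lambda>x. \<integral>\<^sup>+y. \<integral>\<^sup>+z. k (x, y, z) \<partial>unif01 \<partial>unif01"]) measurable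
  also have "\<dots> = (\<integral>\<^sup>+x. \<integral>\<^sup>+y. \<integral>\<^sup>+z. k (x, y, z) * indicator {0<..<1} z * indicator {0<..<1} y * indicator {0<..<1} x
      \<partial>lborel \<partial>lborel \<partial>lborel)"
    by (simp add: nn_integral_unif01 nn_integral_multc)
  finally show ?thesis .
qed

text \<open>The factor \<open>\<top>\<close> turns the weight \<open>k\<close> into a multiple of
  the indicator of its support, so every integrand supported where \<open>k\<close> is non-zero
  inherits the zero integral.\<close>

lemma nn_integral3_eq_0:
  assumes [measurable]: "k \<in> borel_measurable (borel \<Otimes>\<^sub>M (borel \<Otimes>\<^sub>M borel))"
    and 0: "(\<integral>\<^sup>+x. k (x 0, x 1, x 2) \<partial>PiM {..<3::nat} (\<lambda>_. unif01)) = 0"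
    and f: "\<And>x y z. f x y z \<noteq> 0 \<Longrightarrow> 0 < x \<and> x < 1 \<and> 0 < y \<and> y < 1 \<and> 0 < z \<and> z < 1 \<and> k (x, y, z) \<noteq> 0"
  shows "(\<integral>\<^sup>+x. \<integral>\<^sup>+y. \<integral>\<^sup>+z. f x y z \<partial>lborel \<partial>lborel \<partial>lborel) = (0::ennreal)"
proof -
  have "(\<integral>\<^sup>+x. \<integral>\<^sup>+y. \<integral>\<^sup>+z. f x y z \<partial>lborel \<partial>lborel \<partial>lborel) \<le>
    (\<integral>\<^sup>+x. \<integral>\<^sup>+y. \<integral>\<^sup>+z. \<top> * (k (x, y, z) * indicator {0<..<1} z * indicator {0<..<1} y * indicator {0<..<1} x)
      \<partial>lborel \<partial>lborel \<partial>lborel)"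
  proof (intro nn_integral_mono)
    fix x y z :: real
    show "f x y z \<le> \<top> * (k (x, y, z) * indicator {0<..<1} z * indicator {0<..<1} y * indicator {0<..<1} x)"
      using f[of x y z] by (cases "f x y z = 0") (auto simp: ennreal_top_mult)
  qed
  also have "\<dots> = \<top> * (\<integral>\<^sup>+x. \<integral>\<^sup>+y. \<integral>\<^sup>+z. k (x, y, z) * indicator {0<..<1} z * indicator {0<..<1} y * indicator {0<..<1} x
      \<partial>lborel \<partial>lborel \<partial>lborel)"
    by (simp add: nn_integral_cmult)
  also have "\<dots> = 0"
    using 0 unfolding nn_integral_PiM_unif01_3[OF assms(1)] by simp
  finally show ?thesis by simp
qed

text \<open>The modification on a null set replaces \<open>W\<close> by its values at density points; there the relation
  becomes transitive and irreflexive everywhere, not just almost everywhere.\<close>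

lemma exists_kernel_version:
  fixes W :: "real \<Rightarrow> real \<Rightarrow> real"
  assumes meas: "(\<lambda>(x, y). W x y) \<in> borel_measurable (borel \<Otimes>\<^sub>M borel)"
    and W0: "\<And>x y. 0 \<le> W x y" and W1: "\<And>x y. W x y \<le> 1"
    and tri: "(\<integral>x. (\<Prod>(i, j)\<in>{(0, 1), (1, 2), (0, 2)}. W (x i) (x j)) \<partial>PiM {..<3::nat} (\<lambda>_. unif01)) =
       (\<integral>x. (\<Prod>(i, j)\<in>{(0, 1), (1, 2)}. W (x i) (x j)) \<partial>PiM {..<3::nat} (\<lambda>_. unif01))"
    and cyc: "(\<integral>x. (\<Prod>(i, j)\<in>{(0, 1), (1, 2), (2, 0)}. W (x i) (x j)) \<partial>PiM {..<3::nat} (\<lambda>_. unif01)) = 0"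
  obtains lt W' where "is_kernel unif01 lt W'"
    "\<And>(n::nat) S. S \<subseteq> {..<n} \<times> {..<n} \<Longrightarrow> (\<And>i. (i, i) \<notin> S) \<Longrightarrow>
      (\<integral>x. (\<Prod>(i, j)\<in>S. W' (x i) (x j)) \<partial>PiM {..<n} (\<lambda>_. unif01)) =
      (\<integral>x. (\<Prod>(i, j)\<in>S. W (x i) (x j)) \<partial>PiM {..<n} (\<lambda>_. unif01))"
proof -
  define w where "w p = W (fst p) (snd p)" for p
  have w_meas [measurable]: "w \<in> borel_measurable (borel \<Otimes>\<^sub>M borel)"
    using meas by (simp add: w_def[abs_def] case_prod_beta')
  have w: "0 \<le> w p" "w p \<le> 1" for p by (auto simp: w_def W0 W1)
  have [measurable_cong]: "sets unif01 = sets borel" by simp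
  interpret P3: prob_space "PiM {..<3::nat} (\<lambda>_. unif01)"
    by (intro prob_space_PiM prob_space_unif01)
  have coord [measurable]: "(\<lambda>x. w (x i, x j)) \<in> borel_measurable (PiM {..<3::nat} (\<lambda>_. unif01))"
    if "i < 3" "j < 3" for i j
  proof -
    have "(\<lambda>x. x k) \<in> measurable (PiM {..<3::nat} (\<lambda>_. unif01)) borel" if "k < 3" for k
      using measurable_component_singleton[of k "{..<3}" "\<lambda>_. unif01"] that
      by (simp add: measurable_cong_sets[of _ _ unif01 borel])
    then show ?thesis using that by (intro measurable_compose[OF measurable_Pair w_meas])
  qed
  have int: "integrable (PiM {..<3::nat} (\<lambda>_. unif01)) (\<lambda>x. w (x i, x j) * w (x k, x l) * (if b then w (x i', x j') else 1))"
    if "i < 3" "j < 3" "k < 3" "l < 3" "i' < 3" "j' < 3" for i j k l i' j' b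
    using that by (intro P3.integrable_real_bounded[of _ 1]) (auto simp: abs_mult w intro!: mult_le_one)
  \<comment> \<open>The integrand is non-negative, so it vanishes almost everywhere: two consecutive
    positive values force the value one on the outer pair.\<close>
  have tri': "(\<integral>x. w (x 0, x 1) * w (x 1, x 2) * (1 - w (x 0, x 2)) \<partial>PiM {..<3::nat} (\<lambda>_. unif01)) = 0"
  proof -
    have "(\<integral>x. w (x 0, x 1) * w (x 1, x 2) * (1 - w (x 0, x 2)) \<partial>PiM {..<3::nat} (\<lambda>_. unif01)) =
      (\<integral>x. w (x 0, x 1) * w (x 1, x 2) \<partial>PiM {..<3::nat} (\<lambda>_. unif01)) -
      (\<integral>x. w (x 0, x 1) * w (x 1, x 2) * w (x 0, x 2) \<partial>PiM {..<3::nat} (\<lambda>_. unif01))"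
      using int[of 0 1 1 2 0 2 False] int[of 0 1 1 2 0 2 True] by (simp add: right_diff_distrib)
    also have "\<dots> = 0" using tri by (simp add: w_def mult_ac)
    finally show ?thesis .
  qed
  have cyc': "(\<integral>x. w (x 0, x 1) * w (x 1, x 2) * w (x 2, x 0) \<partial>PiM {..<3::nat} (\<lambda>_. unif01)) = 0"
    using cyc by (simp add: w_def mult_ac)
  define k1 where "k1 = (\<lambda>(x, y, z). ennreal (w (x, y) * w (y, z) * (1 - w (x, z))))"
  define k2 where "k2 = (\<lambda>(x, y, z). ennreal (w (x, y) * w (y, z) * w (z, x)))"
  have [measurable]: "k1 \<in> borel_measurable (borel \<Otimes>\<^sub>M (borel \<Otimes>\<^sub>M borel))"
    "k2 \<in> borel_measurable (borel \<Otimes>\<^sub>M (borel \<Otimes>\<^sub>M borel))"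
    unfolding k1_def k2_def by measurable
  have k1: "(\<integral>\<^sup>+x. k1 (x 0, x 1, x 2) \<partial>PiM {..<3::nat} (\<lambda>_. unif01)) = 0"
  proof -
    have "integrable (PiM {..<3::nat} (\<lambda>_. unif01)) (\<lambda>x. w (x 0, x 1) * w (x 1, x 2) * (1 - w (x 0, x 2)))"
      by (intro P3.integrable_real_bounded[of _ 1]) (auto simp: abs_mult w intro!: mult_le_one)
    then show ?thesis
      using tri' by (simp add: k1_def nn_integral_eq_integral w)
  qed
  have k2: "(\<integral>\<^sup>+x. k2 (x 0, x 1, x 2) \<partial>PiM {..<3::nat} (\<lambda>_. unif01)) = 0"
    using int[of 0 1 1 2 2 0 True] cyc' by (simp add: k2_def nn_integral_eq_integral w)
  \<comment> \<open>\<open>E\<close> carries the order and \<open>E1\<close> the forced value.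
    Keeping them apart gives the value exactly one on a composed pair, and not merely a positive
    one.\<close>
  define E where "E = {p. 0 < fst p \<and> fst p < 1 \<and> 0 < snd p \<and> snd p < 1 \<and> 0 < w p}"
  define E1 where "E1 = {p. 0 < fst p \<and> fst p < 1 \<and> 0 < snd p \<and> snd p < 1 \<and> w p = 1}"
  have "{p \<in> space (borel \<Otimes>\<^sub>M borel). 0 < fst p \<and> fst p < 1 \<and> 0 < snd p \<and> snd p < 1 \<and> 0 < w p} \<in> sets (borel \<Otimes>\<^sub>M borel)"
    "{p \<in> space (borel \<Otimes>\<^sub>M borel). 0 < fst p \<and> fst p < 1 \<and> 0 < snd p \<and> snd p < 1 \<and> w p = 1} \<in> sets (borel \<Otimes>\<^sub>M borel)"
    by measurable
  then have sets_E: "E \<in> sets borel" "E1 \<in> sets borel"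
    unfolding sets_borel_pair[symmetric] by (simp_all add: E_def E1_def space_pair_measure)
  have "(\<integral>\<^sup>+x. \<integral>\<^sup>+y. \<integral>\<^sup>+z. indicator E (x, y) * indicator E (y, z) * indicator (- E1) (x, z) \<partial>lborel \<partial>lborel \<partial>lborel) = (0::ennreal)"
  proof (rule nn_integral3_eq_0[OF _ k1])
    fix x y z :: real
    assume "indicator E (x, y) * indicator E (y, z) * indicator (- E1) (x, z) \<noteq> (0::ennreal)"
    then have "(x, y) \<in> E" "(y, z) \<in> E" "(x, z) \<notin> E1" by (auto simp: indicator_def split: if_splits)
    then show "0 < x \<and> x < 1 \<and> 0 < y \<and> y < 1 \<and> 0 < z \<and> z < 1 \<and> k1 (x, y, z) \<noteq> 0"
      using w(2)[of "(x, z)"] by (auto simp: E_def E1_def k1_def not_le less_le)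
  qed measurable
  then have dense_trans: "dense_at E1 x z" if "dense_at E x y" "dense_at E y z" for x y z
    by (rule dense_at_triangle[OF sets_E(1) sets_E(1) sets_E(2) _ that])
  have "(\<integral>\<^sup>+x. \<integral>\<^sup>+y. \<integral>\<^sup>+z. indicator E (x, y) * indicator E (y, z) * indicator E (z, x) \<partial>lborel \<partial>lborel \<partial>lborel) = (0::ennreal)"
  proof (rule nn_integral3_eq_0[OF _ k2])
    fix x y z :: real
    assume "indicator E (x, y) * indicator E (y, z) * indicator E (z, x) \<noteq> (0::ennreal)"
    then have "(x, y) \<in> E" "(y, z) \<in> E" "(z, x) \<in> E" by (auto simp: indicator_def split: if_splits)
    then show "0 < x \<and> x < 1 \<and> 0 < y \<and> y < 1 \<and> 0 < z \<and> z < 1 \<and> k2 (x, y, z) \<noteq> 0"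
      by (auto simp: E_def k2_def not_le)
  qed measurable
  then have irrefl: "\<not> dense_at E x x" for x
    by (rule not_dense_at_diagonal[OF sets_E(1)])
  have "E1 \<subseteq> E" by (auto simp: E_def E1_def)
  then have E1_E: "dense_at E x y" if "dense_at E1 x y" for x y
    using dense_at_mono[OF _ sets_E(2,1) that] by blast
  \<comment> \<open>At density points of \<open>E1\<close> the value one is imposed, since
    \<open>W\<close> may differ from one at some of them, though only on a null set.\<close>
  define W' where "W' x y = (if dense_at E1 x y then 1 else if dense_at E x y then W x y else 0)" for x y
  have W'_meas: "(\<lambda>p. W' (fst p) (snd p)) \<in> borel_measurable (borel \<Otimes>\<^sub>M borel)"
    unfolding W'_def using measurable_dense_at[OF sets_E(1)] measurable_dense_at[OF sets_E(2)] w_meas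
    unfolding w_def[abs_def] by measurable
  have sets_UU: "sets (unif01 \<Otimes>\<^sub>M unif01) = sets (borel \<Otimes>\<^sub>M borel)"
    by (intro sets_pair_measure_cong) auto
  have kernel: "is_kernel unif01 (dense_at E) W'"
    unfolding is_kernel_def ord_prob_space_def
  proof (intro conjI ballI impI)
    show "prob_space unif01" by (rule prob_space_unif01)
    show "\<not> dense_at E x x" for x by (rule irrefl)
    show "dense_at E x z" if "dense_at E x y" "dense_at E y z" for x y z
      using E1_E dense_trans that by blast
    show "{(x, y). x \<in> space unif01 \<and> y \<in> space unif01 \<and> dense_at E x y} \<in> sets (unif01 \<Otimes>\<^sub>M unif01)"
      using measurable_dense_at[OF sets_E(1)] unfolding sets_UU
      by (simp add: pred_def space_pair_measure case_prod_beta')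
    show "(\<lambda>(x, y). W' x y) \<in> borel_measurable (unif01 \<Otimes>\<^sub>M unif01)"
      using W'_meas by (simp add: measurable_cong_sets[OF sets_UU refl] case_prod_beta')
    show "0 \<le> W' x y" "W' x y \<le> 1" for x y by (auto simp: W'_def W0 W1)
    show "dense_at E x y" if "0 < W' x y" for x y
      using that E1_E by (auto simp: W'_def split: if_splits)
    show "W' x z = 1" if "0 < W' x y" "0 < W' y z" for x y z
    proof -
      have "dense_at E x y" "dense_at E y z"
        using that E1_E by (auto simp: W'_def split: if_splits)
      then show ?thesis by (simp add: W'_def dense_trans)
    qed
  qed
  have AE_lborel: "AE p in lborel. 0 < fst p \<and> fst p < 1 \<and> 0 < snd p \<and> snd p < 1 \<longrightarrow> W' (fst p) (snd p) = W (fst p) (snd p)"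
    using AE_dense_at[OF sets_E(1)] AE_dense_at[OF sets_E(2)]
  proof eventually_elim
    case (elim p)
    then show ?case
      using w[of p] by (auto simp: W'_def E_def E1_def w_def)
  qed
  have AE: "AE p in unif01 \<Otimes>\<^sub>M unif01. W' (fst p) (snd p) = W (fst p) (snd p)"
  proof -
    interpret U: prob_space unif01 by (rule prob_space_unif01)
    interpret pair_sigma_finite unif01 unif01 ..
    have "AE x in lborel. AE y in lborel. 0 < x \<and> x < 1 \<and> 0 < y \<and> y < 1 \<longrightarrow> W' x y = W x y"
      using lborel_pair.AE_pair[OF AE_lborel[folded lborel_prod]] by simp
    then have "AE x in unif01. AE y in unif01. W' x y = W x y"
      by (intro AE_uniform_measureI) (auto elim!: eventually_mono intro!: AE_uniform_measureI)
    moreover have "{p \<in> space (borel \<Otimes>\<^sub>M borel). W' (fst p) (snd p) = W (fst p) (snd p)} \<in> sets (borel \<Otimes>\<^sub>M borel)"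
      using W'_meas w_meas unfolding w_def[abs_def] by (rule borel_measurable_eq)
    ultimately show ?thesis
      by (intro AE_pair_measure) (simp_all add: sets_UU space_pair_measure)
  qed
  show ?thesis
  proof (rule that[OF kernel])
    fix n and S :: "(nat \<times> nat) set" assume S: "S \<subseteq> {..<n} \<times> {..<n}" "\<And>i. (i, i) \<notin> S"
    have finS: "finite S" using S(1) finite_subset by blast
    have coord: "(\<lambda>x. (x i, x j)) \<in> measurable (PiM {..<n} (\<lambda>_. unif01)) (borel \<Otimes>\<^sub>M borel)"
      if "(i, j) \<in> S" for i j
    proof -
      have "i < n" "j < n" using that S(1) by auto
      then have "(\<lambda>x. (x i, x j)) \<in> measurable (PiM {..<n} (\<lambda>_. unif01)) (unif01 \<Otimes>\<^sub>M unif01)"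
        by (intro measurable_Pair measurable_component_singleton) auto
      then show ?thesis by (simp add: measurable_cong_sets[OF refl sets_UU])
    qed
    have prod_meas: "(\<lambda>x. \<Prod>(i, j)\<in>S. V (x i) (x j)) \<in> borel_measurable (PiM {..<n} (\<lambda>_. unif01))"
      if "(\<lambda>p. V (fst p) (snd p)) \<in> borel_measurable (borel \<Otimes>\<^sub>M borel)" for V :: "real \<Rightarrow> real \<Rightarrow> real"
      using measurable_compose[OF coord that] by (intro borel_measurable_prod) (auto split: prod.splits)
    have "AE x in PiM {..<n} (\<lambda>_. unif01). \<forall>p\<in>S. W' (x (fst p)) (x (snd p)) = W (x (fst p)) (x (snd p))"
    proof (intro AE_finite_allI finS)
      fix p assume "p \<in> S"
      then have p: "fst p \<in> {..<n}" "snd p \<in> {..<n}" "fst p \<noteq> snd p"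
        using S(1) S(2)[of "fst p"] by (cases p; auto)+
      from AE_PiM_pair[OF prob_space_unif01 p AE]
      show "AE x in PiM {..<n} (\<lambda>_. unif01). W' (x (fst p)) (x (snd p)) = W (x (fst p)) (x (snd p))" by simp
    qed
    then show "(\<integral>x. (\<Prod>(i, j)\<in>S. W' (x i) (x j)) \<partial>PiM {..<n} (\<lambda>_. unif01)) =
      (\<integral>x. (\<Prod>(i, j)\<in>S. W (x i) (x j)) \<partial>PiM {..<n} (\<lambda>_. unif01))"
      using W'_meas w_meas unfolding w_def[abs_def]
      by (intro integral_cong_AE prod_meas) (auto elim!: eventually_mono intro!: prod.cong)
  qed
qed

section \<open>Random relations sampled from a kernel\<close>

definition superrel :: "(nat \<times> nat) set \<Rightarrow> nrel set" where
  "superrel S = {r. \<forall>e\<in>S. r e}"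

lemma space_Rel [simp]: "space Rel = UNIV"
  by (auto simp: Rel_def space_PiM)

lemma measurable_Rel_component [measurable]: "(\<lambda>r. r e) \<in> measurable Rel (count_space UNIV)"
  unfolding Rel_def by (rule measurable_component_singleton) simp

lemma sets_superrel: "finite S \<Longrightarrow> superrel S \<in> sets Rel"
proof -
  assume "finite S"
  then have "{r \<in> space Rel. \<forall>e\<in>S. r e} \<in> sets Rel" by measurable
  then show ?thesis by (simp add: superrel_def)
qed

lemma superrel_Int: "superrel S \<inter> superrel T = superrel (S \<union> T)"
  by (auto simp: superrel_def)

lemma Int_stable_superrel: "Int_stable {superrel S | S. finite S}"
  unfolding Int_stable_def by (auto simp: superrel_Int)

text \<open>Presence of edges generates everything, as absence is its complement. Containment events
  are stable under intersection, so their probabilities identify a law.\<close>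

lemma sets_Rel_eq_sigma: "sets Rel = sigma_sets UNIV {superrel S | S. finite S}"
proof
  have 1: "{r. r e \<in> A} \<in> sigma_sets UNIV {superrel S | S. finite S}" for e and A :: "bool set"
  proof -
    let ?\<Sigma> = "sigma_sets UNIV {superrel S | S. finite S}"
    have b: "superrel {e} \<in> ?\<Sigma>" by (rule sigma_sets.Basic) auto
    have c: "UNIV - superrel {e} \<in> ?\<Sigma>" using b by (rule sigma_sets.Compl)
    have "r e \<in> A \<longleftrightarrow> r e \<and> True \<in> A \<or> \<not> r e \<and> False \<in> A" for r :: nrel
      by (cases "r e") auto
    then have "{r. r e \<in> A} = (if True \<in> A then superrel {e} else {}) \<union> (if False \<in> A then UNIV - superrel {e} else {})"
      by (auto simp: superrel_def)
    then show ?thesis using b c by (simp add: sigma_sets_Un sigma_sets.Empty)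
  qed
  show "sets Rel \<subseteq> sigma_sets UNIV {superrel S | S. finite S}"
    unfolding Rel_def sets_PiM_single
    using 1 by (simp add: space_Rel[unfolded Rel_def space_PiM, simplified] PiE_UNIV_domain) (intro sigma_sets_mono, auto)
  show "sigma_sets UNIV {superrel S | S. finite S} \<subseteq> sets Rel"
    using sets_superrel sets.sigma_sets_subset[of "{superrel S | S. finite S}" Rel] by auto
qed

lemma Rel_eqI:
  assumes "prob_space R1" "prob_space R2" "sets R1 = sets Rel" "sets R2 = sets Rel"
    and eq: "\<And>S. finite S \<Longrightarrow> measure R1 (superrel S) = measure R2 (superrel S)"
  shows "R1 = R2"
proof (rule measure_eqI_generator_eq[OF Int_stable_superrel])
  interpret R1: prob_space R1 by fact
  interpret R2: prob_space R2 by fact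
  show "{superrel S |S. finite S} \<subseteq> Pow UNIV" by auto
  show "emeasure R1 X = emeasure R2 X" if "X \<in> {superrel S |S. finite S}" for X
    using that eq by (auto simp: R1.emeasure_eq_measure R2.emeasure_eq_measure)
  show "sets R1 = sigma_sets UNIV {superrel S |S. finite S}" "sets R2 = sigma_sets UNIV {superrel S |S. finite S}"
    using assms sets_Rel_eq_sigma by auto
  show "range (\<lambda>_. superrel {}) \<subseteq> {superrel S |S. finite S}" by auto
  show "(\<Union>i::nat. superrel {}) = UNIV" by (auto simp: superrel_def)
  show "emeasure R1 (superrel {}) \<noteq> \<infinity>" for i :: nat by simp
qed

lemma measurable_Rel_I:
  assumes "\<And>e. (\<lambda>x. f x e) \<in> measurable M (count_space UNIV)"
  shows "f \<in> measurable M Rel"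
  unfolding Rel_def by (rule measurable_PiM_single') (use assms in auto)

lemma pred_is_poset_N: "Measurable.pred Rel is_poset_N"
  unfolding is_poset_N_def by measurable

section \<open>The law sampled from a kernel\<close>

locale poset_kernel =
  fixes M :: "'a measure" and lt :: "'a \<Rightarrow> 'a \<Rightarrow> bool" and W :: "'a \<Rightarrow> 'a \<Rightarrow> real"
  assumes kernel: "is_kernel M lt W"
begin

lemma prob_space_M: "prob_space M"
  using kernel by (simp add: is_kernel_def ord_prob_space_def)

sublocale M: prob_space M by (rule prob_space_M)

lemma W_measurable: "(\<lambda>p. W (fst p) (snd p)) \<in> borel_measurable (M \<Otimes>\<^sub>M M)"
  using kernel by (simp add: is_kernel_def case_prod_beta')

lemma W_bounds: "x \<in> space M \<Longrightarrow> y \<in> space M \<Longrightarrow> 0 \<le> W x y" "x \<in> space M \<Longrightarrow> y \<in> space M \<Longrightarrow> W x y \<le> 1"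
proof -
  have "\<forall>x\<in>space M. \<forall>y\<in>space M. 0 \<le> W x y \<and> W x y \<le> 1"
    using kernel unfolding is_kernel_def by (elim conjE) assumption
  then show "x \<in> space M \<Longrightarrow> y \<in> space M \<Longrightarrow> 0 \<le> W x y" "x \<in> space M \<Longrightarrow> y \<in> space M \<Longrightarrow> W x y \<le> 1"
    by simp_all
qed

lemma W_irrefl: "x \<in> space M \<Longrightarrow> W x x = 0"
proof -
  assume x: "x \<in> space M"
  have "\<forall>x\<in>space M. \<not> lt x x"
    using kernel unfolding is_kernel_def ord_prob_space_def by (elim conjE) assumption
  moreover have "\<forall>x\<in>space M. \<forall>y\<in>space M. W x y > 0 \<longrightarrow> lt x y"
    using kernel unfolding is_kernel_def by (elim conjE) assumption
  ultimately have "\<not> W x x > 0" using x by blast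
  then show ?thesis using W_bounds(1)[OF x x] by simp
qed

lemma W_trans: "x \<in> space M \<Longrightarrow> y \<in> space M \<Longrightarrow> z \<in> space M \<Longrightarrow> W x y > 0 \<Longrightarrow> W y z > 0 \<Longrightarrow> W x z = 1"
proof -
  have "\<forall>x\<in>space M. \<forall>y\<in>space M. \<forall>z\<in>space M. W x y > 0 \<longrightarrow> W y z > 0 \<longrightarrow> W x z = 1"
    using kernel unfolding is_kernel_def by (elim conjE) assumption
  then show "x \<in> space M \<Longrightarrow> y \<in> space M \<Longrightarrow> z \<in> space M \<Longrightarrow> W x y > 0 \<Longrightarrow> W y z > 0 \<Longrightarrow> W x z = 1"
    by blast
qed

abbreviation PX :: "(nat \<Rightarrow> 'a) measure" where "PX \<equiv> PiM UNIV (\<lambda>_. M)"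
abbreviation PXi :: "(nat \<times> nat \<Rightarrow> real) measure" where "PXi \<equiv> PiM UNIV (\<lambda>_. unif01)"

sublocale X: product_prob_space "\<lambda>_::nat. M" UNIV by unfold_locales
sublocale Xi: product_prob_space "\<lambda>_::nat \<times> nat. unif01" UNIV
  by (intro product_prob_spaceI prob_space_unif01)
sublocale XXi: pair_prob_space PX PXi ..

lemma W_coord_measurable: "i \<in> I \<Longrightarrow> j \<in> I \<Longrightarrow> (\<lambda>x. W (x i) (x j)) \<in> borel_measurable (PiM I (\<lambda>_. M))"
proof -
  assume "i \<in> I" "j \<in> I"
  then have "(\<lambda>x. (x i, x j)) \<in> measurable (PiM I (\<lambda>_. M)) (M \<Otimes>\<^sub>M M)"
    by (intro measurable_Pair measurable_component_singleton)
  from measurable_compose[OF this W_measurable] show ?thesis by simp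
qed

lemma prod_W_measurable:
  "S \<subseteq> I \<times> I \<Longrightarrow> (\<lambda>x. \<Prod>(i, j)\<in>S. W (x i) (x j)) \<in> borel_measurable (PiM I (\<lambda>_. M))"
  by (intro borel_measurable_prod) (auto intro!: W_coord_measurable)

lemma prod_W_bounds:
  assumes "S \<subseteq> I \<times> I" "x \<in> space (PiM I (\<lambda>_. M))"
  shows "0 \<le> (\<Prod>(i, j)\<in>S. W (x i) (x j))" "(\<Prod>(i, j)\<in>S. W (x i) (x j)) \<le> 1"
proof -
  have "0 \<le> W (x i) (x j)" "W (x i) (x j) \<le> 1" if "(i, j) \<in> S" for i j
    using that assms by (auto simp: space_PiM PiE_iff intro!: W_bounds)
  then show "0 \<le> (\<Prod>(i, j)\<in>S. W (x i) (x j))" "(\<Prod>(i, j)\<in>S. W (x i) (x j)) \<le> 1"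
    by (auto intro!: prod_nonneg prod_le_1)
qed

lemma prod_W_integrable:
  assumes "S \<subseteq> I \<times> I"
  shows "integrable (PiM I (\<lambda>_. M)) (\<lambda>x. \<Prod>(i, j)\<in>S. W (x i) (x j))"
proof -
  interpret P: prob_space "PiM I (\<lambda>_. M)" by (intro prob_space_PiM prob_space_M)
  show ?thesis
    using prod_W_bounds[OF assms] prod_W_measurable[OF assms]
    by (intro P.integrable_real_bounded[of _ 1]) auto
qed

text \<open>Independent points with the same distribution keep their joint law when they are
  relabelled by an injection; this is the source of exchangeability.\<close>

lemma integral_prod_W_reindex:
  assumes f: "inj_on f I" "f ` I \<subseteq> K" and S: "S \<subseteq> I \<times> I"
  shows "(\<integral>x. (\<Prod>(i, j)\<in>S. W (x i) (x j)) \<partial>PiM I (\<lambda>_. M)) =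
    (\<integral>x. (\<Prod>(i, j)\<in>map_prod f f ` S. W (x i) (x j)) \<partial>PiM K (\<lambda>_. M))"
proof -
  let ?t = "\<lambda>x. \<lambda>n\<in>I. x (f n)"
  have t: "?t \<in> measurable (PiM K (\<lambda>_. M)) (PiM I (\<lambda>_. M))"
    using f by (intro measurable_restrict measurable_component_singleton) auto
  have "distr (PiM K (\<lambda>_. M)) (PiM I (\<lambda>_. M)) ?t = PiM I (\<lambda>_. M)"
    using f by (intro distr_PiM_reindex prob_space_M) auto
  then have "(\<integral>x. (\<Prod>(i, j)\<in>S. W (x i) (x j)) \<partial>PiM I (\<lambda>_. M)) =
    (\<integral>x. (\<Prod>(i, j)\<in>S. W (x i) (x j)) \<partial>distr (PiM K (\<lambda>_. M)) (PiM I (\<lambda>_. M)) ?t)" by simp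
  also have "\<dots> = (\<integral>x. (\<Prod>(i, j)\<in>S. W (?t x i) (?t x j)) \<partial>PiM K (\<lambda>_. M))"
    by (rule integral_distr[OF t prod_W_measurable[OF S]])
  also have "\<dots> = (\<integral>x. (\<Prod>(i, j)\<in>map_prod f f ` S. W (x i) (x j)) \<partial>PiM K (\<lambda>_. M))"
  proof (rule Bochner_Integration.integral_cong[OF refl])
    fix x
    have "inj_on (map_prod f f) S"
      using map_prod_inj_on[OF f(1) f(1)] S by (rule inj_on_subset)
    then have "(\<Prod>(i, j)\<in>map_prod f f ` S. W (x i) (x j)) = (\<Prod>(i, j)\<in>S. W (x (f i)) (x (f j)))"
      by (simp add: prod.reindex case_prod_beta' o_def)
    also have "\<dots> = (\<Prod>(i, j)\<in>S. W (?t x i) (?t x j))"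
      using S by (intro prod.cong) auto
    finally show "(\<Prod>(i, j)\<in>S. W (?t x i) (?t x j)) = (\<Prod>(i, j)\<in>map_prod f f ` S. W (x i) (x j))" ..
  qed
  finally show ?thesis .
qed

lemma integral_prod_W_disjoint:
  fixes I J :: "nat set"
  assumes "I \<inter> J = {}" "finite I" "finite J" "S \<subseteq> I \<times> I" "T \<subseteq> J \<times> J"
  shows "(\<integral>x. (\<Prod>(i, j)\<in>S \<union> T. W (x i) (x j)) \<partial>PiM (I \<union> J) (\<lambda>_. M)) =
    (\<integral>x. (\<Prod>(i, j)\<in>S. W (x i) (x j)) \<partial>PiM I (\<lambda>_. M)) * (\<integral>x. (\<Prod>(i, j)\<in>T. W (x i) (x j)) \<partial>PiM J (\<lambda>_. M))"
proof -
  have fin: "finite S" "finite T" "S \<inter> T = {}"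
    using assms by (auto dest: finite_subset)
  have "(\<integral>x. (\<Prod>(i, j)\<in>S \<union> T. W (x i) (x j)) \<partial>PiM (I \<union> J) (\<lambda>_. M)) =
    (\<integral>x. (\<integral>y. (\<Prod>(i, j)\<in>S \<union> T. W (merge I J (x, y) i) (merge I J (x, y) j)) \<partial>PiM J (\<lambda>_. M)) \<partial>PiM I (\<lambda>_. M))"
    by (rule X.product_integral_fold[OF assms(1-3) prod_W_integrable]) (use assms in auto)
  also have "\<dots> = (\<integral>x. (\<integral>y. (\<Prod>(i, j)\<in>S. W (x i) (x j)) * (\<Prod>(i, j)\<in>T. W (y i) (y j)) \<partial>PiM J (\<lambda>_. M)) \<partial>PiM I (\<lambda>_. M))"
  proof (intro Bochner_Integration.integral_cong refl)
    fix x y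
    have "(\<Prod>(i, j)\<in>S. W (merge I J (x, y) i) (merge I J (x, y) j)) = (\<Prod>(i, j)\<in>S. W (x i) (x j))"
      using assms by (intro prod.cong) auto
    moreover have "(\<Prod>(i, j)\<in>T. W (merge I J (x, y) i) (merge I J (x, y) j)) = (\<Prod>(i, j)\<in>T. W (y i) (y j))"
      using assms by (intro prod.cong) auto
    ultimately show "(\<Prod>(i, j)\<in>S \<union> T. W (merge I J (x, y) i) (merge I J (x, y) j)) =
      (\<Prod>(i, j)\<in>S. W (x i) (x j)) * (\<Prod>(i, j)\<in>T. W (y i) (y j))"
      using fin by (simp add: prod.union_disjoint)
  qed
  finally show ?thesis by simp
qed

definition edges :: "(nat \<Rightarrow> 'a) \<times> (nat \<times> nat \<Rightarrow> real) \<Rightarrow> nrel" where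
  "edges = (\<lambda>(x, \<xi>) (i, j). \<xi> (i, j) < W (x i) (x j))"

lemma edges_measurable: "edges \<in> measurable (PX \<Otimes>\<^sub>M PXi) Rel"
proof (rule measurable_Rel_I)
  fix e :: "nat \<times> nat"
  obtain i j where e: "e = (i, j)" by (cases e)
  have "(\<lambda>x. W (x i) (x j)) \<in> borel_measurable PX" by (rule W_coord_measurable) auto
  from measurable_compose[OF measurable_fst this]
  have 1: "(\<lambda>p. W (fst p i) (fst p j)) \<in> borel_measurable (PX \<Otimes>\<^sub>M PXi)" .
  have "(\<lambda>\<xi>. \<xi> e) \<in> measurable PXi unif01" by (rule measurable_component_singleton) simp
  then have "(\<lambda>\<xi>. \<xi> e) \<in> borel_measurable PXi" by (simp add: measurable_cong_sets[of _ _ unif01 borel])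
  from measurable_compose[OF measurable_snd this]
  have 2: "(\<lambda>p. snd p e) \<in> borel_measurable (PX \<Otimes>\<^sub>M PXi)" .
  from borel_measurable_pred_less[OF 2 1] show "(\<lambda>p. edges p e) \<in> measurable (PX \<Otimes>\<^sub>M PXi) (count_space UNIV)"
    by (simp add: edges_def e case_prod_beta')
qed

lemma law_kernel_eq: "law_kernel M W = distr (PX \<Otimes>\<^sub>M PXi) Rel edges"
  by (simp add: law_kernel_def edges_def)

lemma prob_space_law: "prob_space (law_kernel M W)"
  unfolding law_kernel_eq by (rule XXi.prob_space_distr[OF edges_measurable])

lemma sets_law: "sets (law_kernel M W) = sets Rel"
  by (simp add: law_kernel_eq)

lemma emeasure_unif01_less:
  assumes "0 \<le> a" "a \<le> 1"
  shows "emeasure unif01 {..<a} = ennreal a"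
proof -
  have "{0<..<1} \<inter> {..<a} = {0<..<a}" using assms by auto
  then show ?thesis
    using assms divide_ennreal[of a 1] by (simp add: emeasure_uniform_measure)
qed

text \<open>Given the points, distinct edges use distinct uniform variables, so the conditional
  probability of containing \<open>S\<close> is a product of kernel values.\<close>

lemma measure_law_superrel:
  assumes S: "finite S"
  shows "measure (law_kernel M W) (superrel S) = (\<integral>x. (\<Prod>(i, j)\<in>S. W (x i) (x j)) \<partial>PX)"
proof -
  have "emeasure (law_kernel M W) (superrel S) = emeasure (PX \<Otimes>\<^sub>M PXi) (edges -` superrel S \<inter> space (PX \<Otimes>\<^sub>M PXi))"
    unfolding law_kernel_eq by (rule emeasure_distr[OF edges_measurable sets_superrel[OF S]])
  also have "\<dots> = (\<integral>\<^sup>+x. emeasure PXi (Pair x -` (edges -` superrel S \<inter> space (PX \<Otimes>\<^sub>M PXi))) \<partial>PX)"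
    by (intro Xi.P.emeasure_pair_measure_alt measurable_sets[OF edges_measurable] sets_superrel S)
  also have "\<dots> = (\<integral>\<^sup>+x. ennreal (\<Prod>(i, j)\<in>S. W (x i) (x j)) \<partial>PX)"
  proof (rule nn_integral_cong)
    fix x assume x: "x \<in> space PX"
    have xs: "x i \<in> space M" for i using x by (auto simp: space_PiM)
    have "Pair x -` (edges -` superrel S \<inter> space (PX \<Otimes>\<^sub>M PXi)) =
      {\<xi> \<in> space PXi. \<forall>e\<in>S. \<xi> e \<in> {..<W (x (fst e)) (x (snd e))}}"
      using x by (auto simp: superrel_def edges_def space_pair_measure)
    also have "emeasure PXi \<dots> = (\<Prod>e\<in>S. emeasure unif01 {..<W (x (fst e)) (x (snd e))})"
      using S by (intro Xi.emeasure_PiM_Collect) auto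
    also have "\<dots> = (\<Prod>e\<in>S. ennreal (W (x (fst e)) (x (snd e))))"
      by (intro prod.cong refl emeasure_unif01_less W_bounds xs)
    also have "\<dots> = ennreal (\<Prod>(i, j)\<in>S. W (x i) (x j))"
      by (subst prod_ennreal) (auto simp: case_prod_beta' intro!: W_bounds xs)
    finally show "emeasure PXi (Pair x -` (edges -` superrel S \<inter> space (PX \<Otimes>\<^sub>M PXi))) = ennreal (\<Prod>(i, j)\<in>S. W (x i) (x j))" .
  qed
  also have "\<dots> = ennreal (\<integral>x. (\<Prod>(i, j)\<in>S. W (x i) (x j)) \<partial>PX)"
    using prod_W_integrable[of S UNIV] prod_W_bounds(1)[of S UNIV] by (intro nn_integral_eq_integral) auto
  finally show ?thesis
    using prod_W_bounds(1)[of S UNIV]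
    by (simp add: measure_def integral_nonneg_AE)
qed

lemma measure_law_superrel_map:
  assumes "finite S" "S \<subseteq> I \<times> I" "inj_on f I"
  shows "measure (law_kernel M W) (superrel (map_prod f f ` S)) = (\<integral>x. (\<Prod>(i, j)\<in>S. W (x i) (x j)) \<partial>PiM I (\<lambda>_. M))"
  using assms by (simp add: measure_law_superrel integral_prod_W_reindex[of f I UNIV S])

lemma measure_law_superrel_restrict:
  assumes "finite S" "S \<subseteq> I \<times> I"
  shows "measure (law_kernel M W) (superrel S) = (\<integral>x. (\<Prod>(i, j)\<in>S. W (x i) (x j)) \<partial>PiM I (\<lambda>_. M))"
proof -
  have "map_prod id id ` S = S" by (simp add: prod.map_id0)
  then show ?thesis using measure_law_superrel_map[OF assms, of id] by simp
qed

text \<open>Presence of edges on disjoint index sets is independent. Later this independence makes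
  the limit of a sampled poset deterministic.\<close>

lemma measure_law_superrel_disjoint:
  assumes "I \<inter> J = {}" "finite I" "finite J" "S \<subseteq> I \<times> I" "T \<subseteq> J \<times> J"
  shows "measure (law_kernel M W) (superrel (S \<union> T)) =
    measure (law_kernel M W) (superrel S) * measure (law_kernel M W) (superrel T)"
proof -
  have "finite S" "finite T" using assms by (auto dest: finite_subset)
  then show ?thesis
    using assms integral_prod_W_disjoint[OF assms]
      measure_law_superrel_restrict[of "S \<union> T" "I \<union> J"] measure_law_superrel_restrict[of S I]
      measure_law_superrel_restrict[of T J]
    by auto
qed

lemma measure_law_valid:
  assumes "valid Q"
  shows "measure (law_kernel M W) (superrel (set (snd Q))) = fst (kernel_pt M W) Q"
proof -
  have "set (snd Q) \<subseteq> {0..<psize Q} \<times> {0..<psize Q}"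
    using assms by (auto simp: valid_def)
  then show ?thesis
    using assms measure_law_superrel_restrict[of "set (snd Q)" "{0..<psize Q}"] by (simp add: kernel_pt_def)
qed

text \<open>Almost surely all uniform variables lie strictly between zero and one. Positivity rules
  out loops and makes the kernel positive at every edge; being below one makes an edge present
  wherever the kernel has the value one.\<close>

lemma AE_law_poset: "AE r in law_kernel M W. is_poset_N r"
proof -
  have "AE \<xi> in PXi. 0 < \<xi> e \<and> \<xi> e < 1" for e
    by (rule AE_PiM_component[where P = "\<lambda>u. 0 < u \<and> u < 1"]) (auto intro: prob_space_unif01 AE_uniform_measureI)
  then have AE: "AE \<xi> in PXi. \<forall>e. 0 < \<xi> e \<and> \<xi> e < 1"
    by (simp add: AE_all_countable)
  have poset: "is_poset_N (edges (x, \<xi>))" if x: "x \<in> space PX" and \<xi>: "\<forall>e. 0 < \<xi> e \<and> \<xi> e < 1" for x \<xi>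
    unfolding is_poset_N_def
  proof (intro conjI allI impI)
    have xs: "x i \<in> space M" for i using x by (auto simp: space_PiM)
    show "\<not> edges (x, \<xi>) (i, i)" for i
      using \<xi>[rule_format, of "(i, i)"] by (simp add: edges_def W_irrefl xs)
    fix i j k assume e: "edges (x, \<xi>) (i, j)" "edges (x, \<xi>) (j, k)"
    have "0 < W (x i) (x j)" "0 < W (x j) (x k)"
      using e \<xi>[rule_format, of "(i, j)"] \<xi>[rule_format, of "(j, k)"] by (auto simp: edges_def)
    then have "W (x i) (x k) = 1" by (intro W_trans[of _ "x j"] xs)
    then show "edges (x, \<xi>) (i, k)"
      using \<xi>[rule_format, of "(i, k)"] by (simp add: edges_def)
  qed
  have meas: "{p \<in> space (PX \<Otimes>\<^sub>M PXi). is_poset_N (edges p)} \<in> sets (PX \<Otimes>\<^sub>M PXi)"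
    using measurable_compose[OF edges_measurable pred_is_poset_N] by (simp add: pred_def)
  have "AE p in PX \<Otimes>\<^sub>M PXi. is_poset_N (edges p)"
  proof (rule XXi.AE_pair_measure[OF meas])
    show "AE x in PX. AE \<xi> in PXi. is_poset_N (edges (x, \<xi>))"
    proof (rule AE_I2)
      fix x assume "x \<in> space PX"
      then show "AE \<xi> in PXi. is_poset_N (edges (x, \<xi>))"
        using AE poset by (auto elim!: eventually_mono)
    qed
  qed
  then show ?thesis
    unfolding law_kernel_eq using pred_is_poset_N
    by (subst AE_distr_iff[OF edges_measurable]) (auto simp: pred_def)
qed

end

lemma measurable_relabel: "(\<lambda>r (i, j). r (\<pi> i, \<pi> j)) \<in> measurable Rel Rel"
  by (rule measurable_Rel_I) (auto simp: case_prod_beta')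

lemma vimage_relabel: "(\<lambda>r (i, j). r (\<pi> i, \<pi> j)) -` superrel S = superrel (map_prod \<pi> \<pi> ` S)"
  by (auto simp: superrel_def)

lemma (in poset_kernel) exch_law_kernel: "exch_law (law_kernel M W)"
  unfolding exch_law_def
proof (intro conjI allI impI prob_space_law sets_law AE_law_poset)
  fix \<pi> :: "nat \<Rightarrow> nat" assume \<pi>: "bij \<pi>"
  have m: "(\<lambda>r (i, j). r (\<pi> i, \<pi> j)) \<in> measurable (law_kernel M W) Rel"
    using measurable_relabel by (simp add: measurable_cong_sets[OF sets_law refl])
  show "distr (law_kernel M W) Rel (\<lambda>r (i, j). r (\<pi> i, \<pi> j)) = law_kernel M W"
  proof (rule Rel_eqI)
    show "prob_space (distr (law_kernel M W) Rel (\<lambda>r (i, j). r (\<pi> i, \<pi> j)))"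
      by (rule prob_space.prob_space_distr[OF prob_space_law m])
    fix S :: "(nat \<times> nat) set" assume S: "finite S"
    have "space (law_kernel M W) = UNIV" by (simp add: law_kernel_eq)
    then have "measure (distr (law_kernel M W) Rel (\<lambda>r (i, j). r (\<pi> i, \<pi> j))) (superrel S) =
      measure (law_kernel M W) (superrel (map_prod \<pi> \<pi> ` S))"
      by (simp add: measure_distr[OF m sets_superrel[OF S]] vimage_relabel)
    also have "\<dots> = measure (law_kernel M W) (superrel S)"
      using measure_law_superrel_map[of S UNIV \<pi>] S \<pi> by (simp add: measure_law_superrel bij_is_inj)
    finally show "measure (distr (law_kernel M W) Rel (\<lambda>r (i, j). r (\<pi> i, \<pi> j))) (superrel S) =
      measure (law_kernel M W) (superrel S)" .
  qed (auto simp: prob_space_law sets_law)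
qed

section \<open>Counting maps, and convergence along fourth powers\<close>

text \<open>Prescribing a value, or identifying two values as in the next lemma, removes one degree
  of freedom. The factor \<open>M\<close> on the left avoids division in the naturals.\<close>

lemma card_PiE_fixed_value:
  assumes "j < k"
  shows "M * card {\<psi> \<in> {0..<k} \<rightarrow>\<^sub>E {0..<M}. \<psi> j = c} \<le> M ^ k"
proof -
  have "{\<psi> \<in> {0..<k} \<rightarrow>\<^sub>E {0..<M}. \<psi> j = c} \<subseteq> PiE {0..<k} (\<lambda>i. if i = j then {c} else {0..<M})"
    using assms by (auto simp: PiE_iff extensional_def)
  then have "card {\<psi> \<in> {0..<k} \<rightarrow>\<^sub>E {0..<M}. \<psi> j = c} \<le> card (PiE {0..<k} (\<lambda>i. if i = j then {c} else {0..<M}))"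
    by (intro card_mono finite_PiE) auto
  also have "\<dots> = (\<Prod>i\<in>{0..<k}. card (if i = j then {c} else {0..<M}))"
    by (simp add: card_PiE)
  also have "\<dots> = (\<Prod>i\<in>{0..<k} - {j}. M)"
    using assms by (subst prod.remove[of _ j]) (auto intro!: prod.cong)
  also have "\<dots> = M ^ (k - 1)"
    using assms by simp
  finally have "M * card {\<psi> \<in> {0..<k} \<rightarrow>\<^sub>E {0..<M}. \<psi> j = c} \<le> M * M ^ (k - 1)"
    by (rule mult_le_mono2)
  also have "\<dots> = M ^ k" using assms by (cases k) auto
  finally show ?thesis .
qed

lemma card_PiE_collision:
  assumes "i < k" "j < k" "i \<noteq> j"
  shows "M * card {\<phi> \<in> {0..<k} \<rightarrow>\<^sub>E {0..<M}. \<phi> i = \<phi> j} \<le> M ^ k"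
proof -
  let ?F = "\<lambda>c. PiE {0..<k} (\<lambda>l. if l \<in> {i, j} then {c} else {0..<M})"
  have "{\<phi> \<in> {0..<k} \<rightarrow>\<^sub>E {0..<M}. \<phi> i = \<phi> j} \<subseteq> (\<Union>c\<in>{0..<M}. ?F c)"
  proof safe
    fix \<phi> assume \<phi>: "\<phi> \<in> {0..<k} \<rightarrow>\<^sub>E {0..<M}" "\<phi> i = \<phi> j"
    then have "\<phi> \<in> ?F (\<phi> i)" "\<phi> i \<in> {0..<M}" using assms by (auto simp: PiE_iff)
    then show "\<phi> \<in> (\<Union>c\<in>{0..<M}. ?F c)" by blast
  qed
  then have "card {\<phi> \<in> {0..<k} \<rightarrow>\<^sub>E {0..<M}. \<phi> i = \<phi> j} \<le> card (\<Union>c\<in>{0..<M}. ?F c)"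
    by (intro card_mono finite_UN_I finite_PiE) auto
  also have "\<dots> \<le> (\<Sum>c\<in>{0..<M}. card (?F c))"
    by (rule card_UN_le) simp
  also have "\<dots> = (\<Sum>c\<in>{0..<M}. M ^ (k - 2))"
  proof (rule sum.cong[OF refl])
    fix c
    have "card (?F c) = (\<Prod>l\<in>{0..<k}. card (if l \<in> {i, j} then {c} else {0..<M}))"
      by (simp add: card_PiE)
    also have "\<dots> = (\<Prod>l\<in>{0..<k} - {i, j}. M)"
      using assms by (intro prod.mono_neutral_cong_right) auto
    also have "\<dots> = M ^ (k - 2)"
      using assms by (simp add: card_Diff_subset numeral_2_eq_2)
    finally show "card (?F c) = M ^ (k - 2)" .
  qed
  finally have "M * card {\<phi> \<in> {0..<k} \<rightarrow>\<^sub>E {0..<M}. \<phi> i = \<phi> j} \<le> M * (M * M ^ (k - 2))"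
    by simp
  also have "\<dots> = M ^ k"
  proof -
    obtain l where "k = Suc (Suc l)" using assms by (cases k; cases "k - 1") auto
    then show ?thesis by simp
  qed
  finally show ?thesis .
qed

lemma finite_PiE_nat: "finite ({0..<k} \<rightarrow>\<^sub>E {0..<M::nat})" for k :: nat
  by (rule finite_PiE) auto

lemma card_PiE_not_inj:
  "M * card {\<phi> \<in> {0..<k} \<rightarrow>\<^sub>E {0..<M}. \<not> inj_on \<phi> {0..<k}} \<le> k\<^sup>2 * M ^ k"
proof -
  let ?I = "{p \<in> {0..<k} \<times> {0..<k}. fst p \<noteq> snd p}"
  let ?F = "\<lambda>p. {\<phi> \<in> {0..<k} \<rightarrow>\<^sub>E {0..<M}. \<phi> (fst p) = \<phi> (snd p)}"
  have "card ?I \<le> card ({0..<k} \<times> {0..<k})" by (intro card_mono) auto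
  then have cI: "card ?I \<le> k\<^sup>2" by (simp add: power2_eq_square)
  have "{\<phi> \<in> {0..<k} \<rightarrow>\<^sub>E {0..<M}. \<not> inj_on \<phi> {0..<k}} \<subseteq> (\<Union>p\<in>?I. ?F p)"
    by (auto simp: inj_on_def)
  then have "card {\<phi> \<in> {0..<k} \<rightarrow>\<^sub>E {0..<M}. \<not> inj_on \<phi> {0..<k}} \<le> card (\<Union>p\<in>?I. ?F p)"
    by (intro card_mono finite_UN_I) (auto intro: finite_subset[OF _ finite_PiE_nat])
  also have "\<dots> \<le> (\<Sum>p\<in>?I. card (?F p))" by (rule card_UN_le) simp
  finally have "M * card {\<phi> \<in> {0..<k} \<rightarrow>\<^sub>E {0..<M}. \<not> inj_on \<phi> {0..<k}} \<le> (\<Sum>p\<in>?I. M * card (?F p))"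
    unfolding sum_distrib_left[symmetric] by (rule mult_le_mono2)
  also have "\<dots> \<le> (\<Sum>p\<in>?I. M ^ k)"
    by (intro sum_mono card_PiE_collision) auto
  also have "\<dots> \<le> k\<^sup>2 * M ^ k" using cI by simp
  finally show ?thesis .
qed

lemma card_PiE_not_inj_real:
  assumes "M > 0"
  shows "real (card {\<phi> \<in> {0..<k} \<rightarrow>\<^sub>E {0..<M}. \<not> inj_on \<phi> {0..<k}}) \<le> real k ^ 2 / real M * real M ^ k"
proof -
  have "real (M * card {\<phi> \<in> {0..<k} \<rightarrow>\<^sub>E {0..<M}. \<not> inj_on \<phi> {0..<k}}) \<le> real (k\<^sup>2 * M ^ k)"
    by (rule of_nat_mono[OF card_PiE_not_inj])
  then show ?thesis using assms by (simp add: field_simps)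
qed

lemma card_PiE_pair_collision_real:
  assumes "M > 0"
  shows "real (card {(\<phi>, \<psi>) \<in> ({0..<k} \<rightarrow>\<^sub>E {0..<N}) \<times> ({0..<k} \<rightarrow>\<^sub>E {0..<M}). \<exists>i<k. \<exists>j<k. \<phi> i = \<psi> j})
    \<le> real k ^ 2 / real M * (real N ^ k * real M ^ k)"
proof -
  let ?A = "{0..<k} \<rightarrow>\<^sub>E {0..<N}" and ?B = "{0..<k} \<rightarrow>\<^sub>E {0..<M}"
  have eq: "{(\<phi>, \<psi>) \<in> ?A \<times> ?B. \<exists>i<k. \<exists>j<k. \<phi> i = \<psi> j} =
    (SIGMA \<phi>:?A. {\<psi> \<in> ?B. \<exists>i<k. \<exists>j<k. \<phi> i = \<psi> j})" by auto
  have "M * card {\<psi> \<in> ?B. \<exists>i<k. \<exists>j<k. \<phi> i = \<psi> j} \<le> k\<^sup>2 * M ^ k" for \<phi>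
  proof -
    let ?F = "\<lambda>p. {\<psi> \<in> ?B. \<psi> (snd p) = \<phi> (fst p)}"
    have "{\<psi> \<in> ?B. \<exists>i<k. \<exists>j<k. \<phi> i = \<psi> j} \<subseteq> (\<Union>p\<in>{0..<k} \<times> {0..<k}. ?F p)" by force
    then have "card {\<psi> \<in> ?B. \<exists>i<k. \<exists>j<k. \<phi> i = \<psi> j} \<le> card (\<Union>p\<in>{0..<k} \<times> {0..<k}. ?F p)"
      by (intro card_mono finite_UN_I) (auto intro: finite_subset[OF _ finite_PiE_nat])
    also have "\<dots> \<le> (\<Sum>p\<in>{0..<k} \<times> {0..<k}. card (?F p))" by (rule card_UN_le) simp
    finally have "M * card {\<psi> \<in> ?B. \<exists>i<k. \<exists>j<k. \<phi> i = \<psi> j} \<le> (\<Sum>p\<in>{0..<k} \<times> {0..<k}. M * card (?F p))"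
      unfolding sum_distrib_left[symmetric] by (rule mult_le_mono2)
    also have "\<dots> \<le> (\<Sum>p\<in>{0..<k} \<times> {0..<k}. M ^ k)"
      by (intro sum_mono card_PiE_fixed_value) auto
    finally show ?thesis by (simp add: power2_eq_square)
  qed
  then have "(\<Sum>\<phi>\<in>?A. M * card {\<psi> \<in> ?B. \<exists>i<k. \<exists>j<k. \<phi> i = \<psi> j}) \<le> (\<Sum>\<phi>\<in>?A. k\<^sup>2 * M ^ k)"
    by (intro sum_mono)
  then have "M * card {(\<phi>, \<psi>) \<in> ?A \<times> ?B. \<exists>i<k. \<exists>j<k. \<phi> i = \<psi> j} \<le> N ^ k * (k\<^sup>2 * M ^ k)"
    unfolding eq by (subst card_SigmaI) (auto simp: sum_distrib_left card_PiE finite_PiE_nat intro: finite_subset[OF _ finite_PiE_nat])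
  then have "real (M * card {(\<phi>, \<psi>) \<in> ?A \<times> ?B. \<exists>i<k. \<exists>j<k. \<phi> i = \<psi> j}) \<le> real (N ^ k * (k\<^sup>2 * M ^ k))"
    by (rule of_nat_mono)
  then show ?thesis using assms by (simp add: field_simps)
qed

text \<open>The ratio of consecutive fourth powers tends to one, so the gap condition ties each term
  to the one at the largest fourth power not exceeding its index.\<close>

lemma convergent_of_fourth_powers:
  fixes u :: "nat \<Rightarrow> real"
  assumes conv: "(\<lambda>j. u (Suc j ^ 4)) \<longlonglongrightarrow> L"
    and gap: "\<And>M N. 0 < M \<Longrightarrow> M \<le> N \<Longrightarrow> \<bar>u N - u M\<bar> \<le> 1 - (real M / real N) ^ k"
  shows "u \<longlonglongrightarrow> L"
proof (rule tendstoI)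
  fix \<epsilon> :: real assume \<epsilon>: "\<epsilon> > 0"
  have "(\<lambda>j. 1 - ((real (Suc j) / real (Suc (Suc j))) ^ 4) ^ k) \<longlonglongrightarrow> 1 - (1 ^ 4) ^ k"
    by (intro tendsto_intros LIMSEQ_Suc[OF LIMSEQ_n_over_Suc_n])
  then have "eventually (\<lambda>j. 1 - ((real (Suc j) / real (Suc (Suc j))) ^ 4) ^ k < \<epsilon> / 2) sequentially"
    using \<epsilon> by (intro order_tendstoD) auto
  moreover have "eventually (\<lambda>j. dist (u (Suc j ^ 4)) L < \<epsilon> / 2) sequentially"
    using conv \<epsilon> by (intro tendstoD) auto
  ultimately have "eventually (\<lambda>j. 1 - ((real (Suc j) / real (Suc (Suc j))) ^ 4) ^ k < \<epsilon> / 2 \<and> dist (u (Suc j ^ 4)) L < \<epsilon> / 2) sequentially"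
    by eventually_elim simp
  then obtain J where J: "\<And>j. j \<ge> J \<Longrightarrow> 1 - ((real (Suc j) / real (Suc (Suc j))) ^ 4) ^ k < \<epsilon> / 2 \<and> dist (u (Suc j ^ 4)) L < \<epsilon> / 2"
    unfolding eventually_sequentially by blast
  show "eventually (\<lambda>n. dist (u n) L < \<epsilon>) sequentially"
    unfolding eventually_sequentially
  proof (intro exI allI impI)
    fix n assume n: "n \<ge> Suc J ^ 4"
    define P where "P j \<longleftrightarrow> Suc j ^ 4 \<le> n" for j
    have "\<exists>j\<ge>J. P j \<and> \<not> P (Suc j)"
    proof -
      have "\<not> P n"
      proof
        assume "P n"
        moreover have "Suc n \<le> Suc n ^ 4" by (rule self_le_power) auto
        ultimately show False by (simp add: P_def)
      qed
      moreover have "P J" using n by (simp add: P_def)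
      ultimately have "J < n" using n by (cases "J = n") (auto simp: P_def intro!: le_neq_implies_less order_trans[OF _ n] order_trans[OF _ self_le_power])
      obtain d where d: "P (J + d)" "\<not> P (J + Suc d)"
      proof -
        have "\<not> P (J + (n - J))" using \<open>\<not> P n\<close> \<open>J < n\<close> by simp
        then have "\<exists>d. \<not> P (J + d)" by blast
        then obtain d where "\<not> P (J + d)" "\<And>d'. d' < d \<Longrightarrow> P (J + d')"
          using exists_least_iff[of "\<lambda>d. \<not> P (J + d)"] by auto
        moreover have "d \<noteq> 0" using \<open>P J\<close> \<open>\<not> P (J + d)\<close> by (cases d) auto
        ultimately show ?thesis using that[of "d - 1"] by (cases d) auto
      qed
      then show ?thesis by (intro exI[of _ "J + d"]) auto
    qed
    then obtain j where j: "j \<ge> J" "Suc j ^ 4 \<le> n" "n < Suc (Suc j) ^ 4" by (auto simp: P_def)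
    have "\<bar>u n - u (Suc j ^ 4)\<bar> \<le> 1 - (real (Suc j ^ 4) / real n) ^ k"
      using j by (intro gap) auto
    also have "\<dots> \<le> 1 - ((real (Suc j) / real (Suc (Suc j))) ^ 4) ^ k"
    proof -
      have "0 < n" using j(2) by (cases n) auto
      have "(real (Suc j) / real (Suc (Suc j))) ^ 4 = real (Suc j ^ 4) / real (Suc (Suc j) ^ 4)"
        by (simp add: power_divide)
      also have "\<dots> \<le> real (Suc j ^ 4) / real n"
        using j(3) \<open>0 < n\<close> by (intro divide_left_mono mult_pos_pos) (auto simp del: of_nat_power of_nat_Suc)
      finally show ?thesis by (intro diff_left_mono power_mono) auto
    qed
    finally show "dist (u n) L < \<epsilon>"
      using J[OF j(1)] unfolding dist_real_def by linarith
  qed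
qed

section \<open>Poset limits and their kernels\<close>

text \<open>Exchangeability speaks of permutations of all naturals, while patterns are moved by
  injections of finite sets.\<close>

lemma extend_inj_on_to_bij:
  fixes f :: "nat \<Rightarrow> nat"
  assumes "finite I" "inj_on f I"
  obtains \<pi> where "bij \<pi>" "\<And>i. i \<in> I \<Longrightarrow> \<pi> i = f i"
proof -
  define C where "C = I \<union> f ` I"
  have C: "finite C" "I \<subseteq> C" "f ` I \<subseteq> C" using assms by (auto simp: C_def)
  have "card (C - I) = card (C - f ` I)"
    using assms C by (simp add: card_Diff_subset card_image)
  then obtain h where h: "bij_betw h (C - I) (C - f ` I)"
    using C finite_same_card_bij[of "C - I" "C - f ` I"] by auto
  define \<pi> where "\<pi> i = (if i \<in> I then f i else if i \<in> C then h i else i)" for i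
  have "bij_betw \<pi> I (f ` I)"
    using assms by (subst bij_betw_cong[of I \<pi> f]) (auto simp: \<pi>_def bij_betw_def)
  moreover have "bij_betw \<pi> (C - I) (C - f ` I)"
    using h by (subst bij_betw_cong[of "C - I" \<pi> h]) (auto simp: \<pi>_def)
  ultimately have "bij_betw \<pi> (I \<union> (C - I)) (f ` I \<union> (C - f ` I))"
    by (rule bij_betw_combine) auto
  moreover have "I \<union> (C - I) = C" "f ` I \<union> (C - f ` I) = C" using C by auto
  moreover have "bij_betw \<pi> (- C) (- C)"
    using C by (subst bij_betw_cong[of "- C" \<pi> id]) (auto simp: \<pi>_def)
  ultimately have "bij_betw \<pi> (C \<union> - C) (C \<union> - C)"
    by (intro bij_betw_combine) auto
  then show ?thesis using that[of \<pi>] by (simp add: \<pi>_def)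
qed

section \<open>Exchangeable laws and finite strict orders\<close>

lemma exch_lawD:
  assumes "exch_law R"
  shows "prob_space R" "sets R = sets Rel" "AE r in R. is_poset_N r"
    "bij \<pi> \<Longrightarrow> distr R Rel (\<lambda>r (i, j). r (\<pi> i, \<pi> j)) = R"
  using assms by (simp_all add: exch_law_def)

lemma exch_measure_relabel:
  assumes "exch_law R" "bij \<pi>" "B \<in> sets Rel"
  shows "measure R ((\<lambda>r (i, j). r (\<pi> i, \<pi> j)) -` B) = measure R B"
proof -
  have space: "space R = UNIV" using sets_eq_imp_space_eq[OF exch_lawD(2)[OF assms(1)]] by simp
  have m: "(\<lambda>r (i, j). r (\<pi> i, \<pi> j)) \<in> measurable R Rel"
    using measurable_relabel by (simp add: measurable_cong_sets[OF exch_lawD(2)[OF assms(1)] refl])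
  have "measure R B = measure (distr R Rel (\<lambda>r (i, j). r (\<pi> i, \<pi> j))) B"
    by (simp only: exch_lawD(4)[OF assms(1,2)])
  also have "\<dots> = measure R ((\<lambda>r (i, j). r (\<pi> i, \<pi> j)) -` B)"
    using measure_distr[OF m assms(3)] space by simp
  finally show ?thesis ..
qed

lemma exch_superrel_map:
  assumes R: "exch_law R" and S: "S \<subseteq> I \<times> I" and f: "finite I" "inj_on f I"
  shows "measure R (superrel (map_prod f f ` S)) = measure R (superrel S)"
proof -
  obtain \<pi> where \<pi>: "bij \<pi>" "\<And>i. i \<in> I \<Longrightarrow> \<pi> i = f i" using extend_inj_on_to_bij[OF f] by metis
  have "finite S" using S f(1) by (auto dest: finite_subset)
  have "map_prod f f ` S = map_prod \<pi> \<pi> ` S"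
    using S by (intro image_cong refl) (auto simp: \<pi>(2))
  then show ?thesis
    using exch_measure_relabel[OF R \<pi>(1) sets_superrel[OF \<open>finite S\<close>]] by (simp add: vimage_relabel)
qed

lemma is_poset_N_trancl:
  assumes "is_poset_N r" "r \<in> superrel S" "e \<in> S\<^sup>+"
  shows "r e"
proof -
  obtain a b where e: "e = (a, b)" by (cases e)
  have "(a, b) \<in> S\<^sup>+" using assms(3) e by simp
  then have "r (a, b)"
  proof induction
    case (base y)
    then show ?case using assms(2) by (simp add: superrel_def)
  next
    case (step y z)
    then show ?case using assms(1,2) unfolding is_poset_N_def superrel_def by blast
  qed
  then show ?thesis by (simp add: e)
qed

text \<open>A strict order contains \<open>S\<close> exactly if it contains the transitive closure,
  and it contains no cycle. Arbitrary finite relations thus reduce to finite strict orders.\<close>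

lemma measure_superrel_trancl:
  assumes R: "prob_space R" "sets R = sets Rel" "AE r in R. is_poset_N r" and S: "finite S"
  shows "measure R (superrel S) = (if acyclic S then measure R (superrel (S\<^sup>+)) else 0)"
proof (cases "acyclic S")
  case True
  have "AE r in R. r \<in> superrel S \<longleftrightarrow> r \<in> superrel (S\<^sup>+)"
    using R(3)
  proof eventually_elim
    case (elim r)
    then show ?case using is_poset_N_trancl[OF elim, of S] by (auto simp: superrel_def)
  qed
  then have "measure R (superrel S) = measure R (superrel (S\<^sup>+))"
    using S R(2) by (intro measure_eq_AE) (auto intro!: sets_superrel simp: finite_trancl)
  then show ?thesis using True by simp
next
  case False
  then obtain x where "(x, x) \<in> S\<^sup>+" by (auto simp: acyclic_def)
  have "AE r in R. r \<in> superrel S \<longleftrightarrow> r \<in> {}"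
    using R(3)
  proof eventually_elim
    case (elim r)
    have "\<not> r (x, x)" using elim unfolding is_poset_N_def by blast
    then show ?case using is_poset_N_trancl[OF elim, of S "(x, x)"] \<open>(x, x) \<in> S\<^sup>+\<close> by auto
  qed
  then have "measure R (superrel S) = measure R {}"
    using S R(2) by (intro measure_eq_AE) (auto intro!: sets_superrel)
  then show ?thesis using False by simp
qed

lemma lposet_trancl:
  assumes "finite S" "acyclic S" "S \<noteq> {}"
  shows "lposet (Field S) (\<lambda>x y. (x, y) \<in> S\<^sup>+)"
proof -
  have sub: "S\<^sup>+ \<subseteq> Field S \<times> Field S" by (rule trancl_subset_Field2)
  show ?thesis
    unfolding lposet_def
  proof (intro conjI allI impI)
    show "finite (Field S)" using assms(1) by (rule finite_Field)
    show "Field S \<noteq> {}" using assms(3) by (auto simp: Field_def)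
    show "x \<in> Field S" "y \<in> Field S" if "(x, y) \<in> S\<^sup>+" for x y using sub that by auto
    show "(x, x) \<notin> S\<^sup>+" for x using assms(2) by (simp add: acyclic_def)
    show "(x, z) \<in> S\<^sup>+" if "(x, y) \<in> S\<^sup>+" "(y, z) \<in> S\<^sup>+" for x y z using that by (rule trancl_trans)
  qed
qed

lemma Rel_poset_eqI:
  assumes R1: "prob_space R1" "sets R1 = sets Rel" "AE r in R1. is_poset_N r"
    and R2: "prob_space R2" "sets R2 = sets Rel" "AE r in R2. is_poset_N r"
    and eq: "\<And>A q. lposet A q \<Longrightarrow> measure R1 (superrel {(x, y). q x y}) = measure R2 (superrel {(x, y). q x y})"
  shows "R1 = R2"
proof (rule Rel_eqI[OF R1(1) R2(1) R1(2) R2(2)])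
  fix S :: "(nat \<times> nat) set" assume S: "finite S"
  show "measure R1 (superrel S) = measure R2 (superrel S)"
  \<comment> \<open>The empty relation has an empty field, which \<open>lposet\<close> excludes as a
    ground set.\<close>
  proof (cases "S = {}")
    case True
    have "superrel S = space R1" "superrel S = space R2"
      using sets_eq_imp_space_eq[OF R1(2)] sets_eq_imp_space_eq[OF R2(2)] True by (auto simp: superrel_def)
    then show ?thesis using prob_space.prob_space[OF R1(1)] prob_space.prob_space[OF R2(1)] by metis
  next
    case False
    then show ?thesis
      using eq[OF lposet_trancl[OF S _ False]] measure_superrel_trancl[OF R1 S] measure_superrel_trancl[OF R2 S]
      by simp
  qed
qed

lemma set_lcode: "set (snd (lcode A q)) = {(i, j). i < card A \<and> j < card A \<and>
    q (sorted_list_of_set A ! i) (sorted_list_of_set A ! j)}"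
  by (auto simp: lcode_def Let_def)

lemma psize_lcode: "psize (lcode A q) = card A"
  by (simp add: lcode_def Let_def psize_def)

lemma prel_lcode: "i < card A \<Longrightarrow> j < card A \<Longrightarrow>
    prel (lcode A q) i j \<longleftrightarrow> q (sorted_list_of_set A ! i) (sorted_list_of_set A ! j)"
  by (simp add: prel_def set_lcode)

lemma valid_lcode:
  assumes "lposet A q"
  shows "valid (lcode A q)"
proof -
  have q: "finite A" "A \<noteq> {}" "\<And>x. \<not> q x x" "\<And>x y z. q x y \<Longrightarrow> q y z \<Longrightarrow> q x z"
    using assms unfolding lposet_def by blast+
  have "card A \<ge> 1" using q by (simp add: Suc_le_eq card_gt_0_iff)
  then show ?thesis
    unfolding valid_def psize_lcode prel_def set_lcode using q by blast
qed

lemma sorted_list_of_set_nth: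
  assumes "finite A"
  shows "inj_on ((!) (sorted_list_of_set A)) {..<card A}" "(!) (sorted_list_of_set A) ` {..<card A} = A"
proof -
  have "bij_betw ((!) (sorted_list_of_set A)) {..<card A} A"
    using assms by (intro bij_betw_nth) auto
  then show "inj_on ((!) (sorted_list_of_set A)) {..<card A}" "(!) (sorted_list_of_set A) ` {..<card A} = A"
    by (auto simp: bij_betw_def)
qed

lemma exch_superrel_lcode:
  assumes R: "exch_law R" and q: "lposet A q"
  shows "measure R (superrel {(x, y). q x y}) = measure R (superrel (set (snd (lcode A q))))"
proof -
  let ?e = "sorted_list_of_set A"
  have A: "finite A" "\<And>x y. q x y \<Longrightarrow> x \<in> A \<and> y \<in> A" using q unfolding lposet_def by blast+
  have "{(x, y). q x y} = map_prod ((!) ?e) ((!) ?e) ` set (snd (lcode A q))"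
  proof safe
    fix x y assume "q x y"
    then have "x \<in> (!) ?e ` {..<card A}" "y \<in> (!) ?e ` {..<card A}"
      using A sorted_list_of_set_nth(2)[OF A(1)] by auto
    then obtain i j where "i < card A" "j < card A" "x = ?e ! i" "y = ?e ! j" by auto
    then show "(x, y) \<in> map_prod ((!) ?e) ((!) ?e) ` set (snd (lcode A q))"
      using \<open>q x y\<close> by (intro image_eqI[of _ _ "(i, j)"]) (auto simp: set_lcode)
  qed (auto simp: set_lcode)
  then show ?thesis
    using exch_superrel_map[OF R, of "set (snd (lcode A q))" "{..<card A}" "(!) ?e"] sorted_list_of_set_nth(1)[OF A(1)]
    by (simp add: set_lcode subset_iff)
qed

definition pattern :: "nat \<Rightarrow> (nat \<Rightarrow> nat \<Rightarrow> bool) \<Rightarrow> nrel set" where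
  "pattern n q = {r. \<forall>i<n. \<forall>j<n. r (i, j) = q i j}"

lemma sets_pattern: "pattern n q \<in> sets Rel"
proof -
  have "{r \<in> space Rel. \<forall>i<n. \<forall>j<n. r (i, j) = q i j} \<in> sets Rel" by measurable
  then show ?thesis by (simp add: pattern_def)
qed

lemma exch_pattern_lcode:
  assumes R: "exch_law R" and A: "finite A"
  shows "measure R {r. \<forall>x\<in>A. \<forall>y\<in>A. r (x, y) = q x y} = measure R (pattern (card A) (prel (lcode A q)))"
proof -
  let ?e = "sorted_list_of_set A"
  obtain \<pi> where \<pi>: "bij \<pi>" "\<And>i. i \<in> {..<card A} \<Longrightarrow> \<pi> i = ?e ! i"
    using extend_inj_on_to_bij[OF _ sorted_list_of_set_nth(1)[OF A]] by auto
  have "(\<lambda>r (i, j). r (\<pi> i, \<pi> j)) -` pattern (card A) (prel (lcode A q)) =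
    {r. \<forall>i<card A. \<forall>j<card A. r (?e ! i, ?e ! j) = q (?e ! i) (?e ! j)}"
    using \<pi>(2) by (auto simp: pattern_def prel_lcode)
  also have "\<dots> = {r. \<forall>x\<in>(!) ?e ` {..<card A}. \<forall>y\<in>(!) ?e ` {..<card A}. r (x, y) = q x y}"
    by auto
  finally have eq: "(\<lambda>r (i, j). r (\<pi> i, \<pi> j)) -` pattern (card A) (prel (lcode A q)) =
    {r. \<forall>x\<in>A. \<forall>y\<in>A. r (x, y) = q x y}"
    unfolding sorted_list_of_set_nth(2)[OF A] .
  from exch_measure_relabel[OF R \<pi>(1) sets_pattern[of "card A" "prel (lcode A q)"]]
  show ?thesis unfolding eq .
qed

section \<open>Densities in finite posets\<close>

lemma validD:
  assumes "valid P"
  shows "psize P \<ge> 1" "prel P i j \<Longrightarrow> i < psize P" "prel P i j \<Longrightarrow> j < psize P" "\<not> prel P i i"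
    "prel P i j \<Longrightarrow> prel P j k \<Longrightarrow> prel P i k" "set (snd P) \<subseteq> {..<psize P} \<times> {..<psize P}"
proof -
  show "set (snd P) \<subseteq> {..<psize P} \<times> {..<psize P}" using assms unfolding valid_def by auto
qed (use assms in \<open>unfold valid_def prel_def, blast+\<close>)

text \<open>\<open>hom_t\<close> with the pairs in \<open>T\<close> required to be unrelated. Taking
  for \<open>T\<close> the complement of \<open>S\<close> gives induced densities, except that the
  maps need not be injective.\<close>

definition hom_dens :: "nat \<Rightarrow> (nat \<times> nat) set \<Rightarrow> (nat \<times> nat) set \<Rightarrow> pcode \<Rightarrow> real" where
  "hom_dens n S T P = real (card {\<phi> \<in> {0..<n} \<rightarrow>\<^sub>E {0..<psize P}.
     (\<forall>(i, j)\<in>S. prel P (\<phi> i) (\<phi> j)) \<and> (\<forall>(i, j)\<in>T. \<not> prel P (\<phi> i) (\<phi> j))}) / real (psize P ^ n)"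

lemma hom_t_eq_hom_dens: "hom_t Q P = hom_dens (psize Q) (set (snd Q)) {} P"
proof -
  have "(\<forall>i j. prel Q i j \<longrightarrow> prel P (\<phi> i) (\<phi> j)) \<longleftrightarrow> (\<forall>(i, j)\<in>set (snd Q). prel P (\<phi> i) (\<phi> j))" for \<phi>
    by (auto simp: prel_def)
  then show ?thesis by (simp add: hom_t_def hom_dens_def)
qed

lemma hom_dens_bounds: "0 \<le> hom_dens n S T P" "hom_dens n S T P \<le> 1"
proof -
  have "card {\<phi> \<in> {0..<n} \<rightarrow>\<^sub>E {0..<psize P}. (\<forall>(i, j)\<in>S. prel P (\<phi> i) (\<phi> j)) \<and> (\<forall>(i, j)\<in>T. \<not> prel P (\<phi> i) (\<phi> j))}
    \<le> card ({0..<n} \<rightarrow>\<^sub>E {0..<psize P})"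
    by (intro card_mono finite_PiE_nat) auto
  then show "0 \<le> hom_dens n S T P" "hom_dens n S T P \<le> 1"
    by (auto simp: hom_dens_def card_PiE divide_le_eq_1 simp del: of_nat_power)
qed

lemma hom_t_bounds: "0 \<le> hom_t Q P" "hom_t Q P \<le> 1"
  by (simp_all add: hom_t_eq_hom_dens hom_dens_bounds)

lemma dens_eq_hom_dens:
  assumes "finite S" "psize P \<ge> 1"
  shows "finite_digraph.dens {..<psize P} {..<n} S (\<lambda>u v. of_bool (prel P u v)) = hom_dens n S {} P"
proof -
  have fd: "finite_digraph {..<psize P}"
    using assms(2) by unfold_locales (auto simp: lessThan_empty_iff)
  have prod_eq: "(\<Prod>(i, j)\<in>S. of_bool (prel P (x i) (x j))) = (of_bool (\<forall>(i, j)\<in>S. prel P (x i) (x j)) :: real)" for x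
  proof (cases "\<forall>(i, j)\<in>S. prel P (x i) (x j)")
    case True
    then show ?thesis by (auto intro!: prod.neutral)
  next
    case False
    then obtain a b where "(a, b) \<in> S" "\<not> prel P (x a) (x b)" by auto
    then have "(\<Prod>(i, j)\<in>S. of_bool (prel P (x i) (x j))) = (0 :: real)"
      using assms(1) by (intro prod_zero bexI[of _ "(a, b)"]) auto
    then show ?thesis using False by simp
  qed
  have count: "(\<Sum>x\<in>F. of_bool (Q x)) = real (card {x \<in> F. Q x})" if "finite F" for F :: "(nat \<Rightarrow> nat) set" and Q
    using that by (simp add: Int_def)
  have fin: "finite ({..<n} \<rightarrow>\<^sub>E {..<psize P})" by (rule finite_PiE) auto
  show ?thesis
    unfolding finite_digraph.dens_def[OF fd] hom_dens_def prod_eq count[OF fin] by (simp add: atLeast0LessThan)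
qed

lemma hom_dens_insert:
  assumes "e \<notin> T"
  shows "hom_dens n S (insert e T) P = hom_dens n S T P - hom_dens n (insert e S) T P"
proof -
  let ?C = "\<lambda>S T. {\<phi> \<in> {0..<n} \<rightarrow>\<^sub>E {0..<psize P}. (\<forall>(i, j)\<in>S. prel P (\<phi> i) (\<phi> j)) \<and> (\<forall>(i, j)\<in>T. \<not> prel P (\<phi> i) (\<phi> j))}"
  have fin: "finite (?C S T)" for S T by (rule finite_subset[OF _ finite_PiE_nat[of n "psize P"]]) auto
  have un: "?C S T = ?C S (insert e T) \<union> ?C (insert e S) T" by (cases e) auto
  have disj: "?C S (insert e T) \<inter> ?C (insert e S) T = {}" by (cases e) auto
  have "card (?C S T) = card (?C S (insert e T)) + card (?C (insert e S) T)"
    by (subst un) (rule card_Un_disjoint[OF fin fin disj])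
  then show ?thesis by (simp add: hom_dens_def diff_divide_distrib[symmetric])
qed

text \<open>The finite counterpart of \<open>measure_superrel_trancl\<close>. Together they reduce
  the convergence of all densities to that of the coordinates of \<open>embed\<close>.\<close>

lemma hom_dens_trancl:
  assumes P: "valid P"
  shows "hom_dens n S {} P = (if acyclic S then hom_dens n (S\<^sup>+) {} P else 0)"
proof -
  have tr: "prel P (\<phi> a) (\<phi> b)" if "\<forall>(i, j)\<in>S. prel P (\<phi> i) (\<phi> j)" "(a, b) \<in> S\<^sup>+" for \<phi> a b
    using that(2)
  proof induction
    case (base y)
    then show ?case using that(1) by auto
  next
    case (step y z)
    then have "prel P (\<phi> y) (\<phi> z)" using that(1) by auto
    then show ?case using validD(5)[OF P] step.IH by blast
  qed
  show ?thesis
  proof (cases "acyclic S")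
    case True
    have "(\<forall>(i, j)\<in>S. prel P (\<phi> i) (\<phi> j)) \<longleftrightarrow> (\<forall>(i, j)\<in>S\<^sup>+. prel P (\<phi> i) (\<phi> j))" for \<phi>
    proof
      show "\<forall>(i, j)\<in>S\<^sup>+. prel P (\<phi> i) (\<phi> j)" if "\<forall>(i, j)\<in>S. prel P (\<phi> i) (\<phi> j)"
        using tr[OF that] by auto
      show "\<forall>(i, j)\<in>S. prel P (\<phi> i) (\<phi> j)" if "\<forall>(i, j)\<in>S\<^sup>+. prel P (\<phi> i) (\<phi> j)"
        using bspec[OF that] r_into_trancl' by fastforce
    qed
    then show ?thesis using True by (simp add: hom_dens_def)
  next
    case False
    then obtain x where "(x, x) \<in> S\<^sup>+" by (auto simp: acyclic_def)
    then have "\<not> (\<forall>(i, j)\<in>S. prel P (\<phi> i) (\<phi> j))" for \<phi>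
      using tr[of \<phi> x x] validD(4)[OF P] by blast
    then have "{\<phi> \<in> {0..<n} \<rightarrow>\<^sub>E {0..<psize P}. (\<forall>(i, j)\<in>S. prel P (\<phi> i) (\<phi> j)) \<and>
      (\<forall>(i, j)\<in>{}. \<not> prel P (\<phi> i) (\<phi> j))} = {}" by blast
    then show ?thesis using False by (simp only: hom_dens_def card.empty) simp
  qed
qed

section \<open>Limit points of finite posets and their kernels\<close>

lemma embed_eqI: "psize P = psize P' \<Longrightarrow> set (snd P) = set (snd P') \<Longrightarrow> embed P = embed P'"
proof -
  assume eq: "psize P = psize P'" "set (snd P) = set (snd P')"
  then have "prel P = prel P'" by (intro ext) (simp add: prel_def)
  then have "hom_t Q P = hom_t Q P'" for Q using eq by (simp add: hom_t_def)
  then show ?thesis using eq by (auto simp: embed_def fun_eq_iff)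
qed

text \<open>There can be infinitely many codes of bounded size, as lists may repeat entries, but
  \<open>embed\<close> sees only the size and the set of pairs.\<close>

lemma finite_embed_bounded: "finite (embed ` {P. valid P \<and> psize P \<le> K})"
proof (rule finite_subset)
  show "embed ` {P. valid P \<and> psize P \<le> K} \<subseteq>
    (\<lambda>(n, S). embed (n, SOME l. set l = S)) ` ({..K} \<times> Pow ({..<K} \<times> {..<K}))"
  proof
    fix y assume "y \<in> embed ` {P. valid P \<and> psize P \<le> K}"
    then obtain n l where y: "y = embed (n, l)" and v: "valid (n, l)" "psize (n, l) \<le> K" by auto
    have "set (SOME l'. set l' = set l) = set l" by (rule someI) simp
    then have "embed (n, l) = embed (n, SOME l'. set l' = set l)"
      by (intro embed_eqI) (auto simp: psize_def)
    moreover have "set l \<subseteq> {..<K} \<times> {..<K}" "n \<le> K"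
      using validD(6)[OF v(1)] v(2) by (fastforce simp: psize_def)+
    ultimately show "y \<in> (\<lambda>(n, S). embed (n, SOME l. set l = S)) ` ({..K} \<times> Pow ({..<K} \<times> {..<K}))"
      unfolding y by (intro image_eqI[of _ _ "(n, set l)"]) auto
  qed
qed auto

lemma Pbar_sequence:
  assumes "p \<in> Pbar"
  obtains X where "\<And>n. valid (X n)" "(\<lambda>n. embed (X n)) \<longlonglongrightarrow> p"
proof -
  obtain y where y: "\<And>n. y n \<in> Pfin" "y \<longlonglongrightarrow> p"
    using assms unfolding Pbar_def closure_sequential by blast
  then have "\<forall>n. \<exists>P. valid P \<and> y n = embed P" unfolding Pfin_def by blast
  then obtain X where X: "\<And>n. valid (X n)" "\<And>n. y n = embed (X n)" by metis
  then have "y = (\<lambda>n. embed (X n))" by (intro ext)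
  then show ?thesis using that[OF X(1)] y(2) by simp
qed

lemma embed_tendsto_snd:
  assumes "(\<lambda>n. embed (X n)) \<longlonglongrightarrow> p"
  shows "(\<lambda>n. 1 / real (psize (X n))) \<longlonglongrightarrow> snd p"
  using tendsto_snd[OF assms] by (simp add: embed_def)

lemma embed_tendsto_fst:
  assumes "(\<lambda>n. embed (X n)) \<longlonglongrightarrow> p" "valid Q"
  shows "(\<lambda>n. hom_t Q (X n)) \<longlonglongrightarrow> tlim Q p"
  using tendsto_fun_coordinate[OF tendsto_fst[OF assms(1)], of Q] assms(2) by (simp add: embed_def tlim_def)

text \<open>A positive second coordinate would bound the sizes along an approximating sequence. Only
  finitely many points would remain, a closed set, and \<open>p\<close> would belong to
  \<open>Pfin\<close>.\<close>

lemma Pinf_snd: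
  assumes "p \<in> Pinf"
  shows "snd p = 0"
proof (rule ccontr)
  assume ne: "snd p \<noteq> 0"
  have "p \<in> Pbar" using assms by (simp add: Pinf_def)
  then obtain X where X: "\<And>n. valid (X n)" "(\<lambda>n. embed (X n)) \<longlonglongrightarrow> p" by (rule Pbar_sequence) blast
  note lim = embed_tendsto_snd[OF X(2)]
  have "0 \<le> snd p" by (rule LIMSEQ_le_const[OF lim]) auto
  then have pos: "0 < snd p" using ne by simp
  obtain K :: nat where K: "2 / snd p < real K" using reals_Archimedean2 by blast
  have "eventually (\<lambda>n. snd p / 2 < 1 / real (psize (X n))) sequentially"
    using pos by (intro order_tendstoD(1)[OF lim]) auto
  then have "eventually (\<lambda>n. embed (X n) \<in> embed ` {P. valid P \<and> psize P \<le> K}) sequentially"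
  proof eventually_elim
    case (elim n)
    have "real (psize (X n)) < 2 / snd p"
      using elim pos validD(1)[OF X(1)[of n]] by (simp add: field_simps)
    then have "psize (X n) \<le> K" using K by linarith
    then show ?case using X(1) by auto
  qed
  then have "p \<in> embed ` {P. valid P \<and> psize P \<le> K}"
    by (rule Lim_in_closed_set[OF finite_imp_closed[OF finite_embed_bounded] _ sequentially_bot X(2)])
  then have "p \<in> Pfin" by (auto simp: Pfin_def)
  then show False using assms by (simp add: Pinf_def)
qed

lemma Pinf_fst_invalid:
  assumes "p \<in> Pbar" "\<not> valid Q"
  shows "fst p Q = 0"
proof -
  obtain X where X: "\<And>n. valid (X n)" "(\<lambda>n. embed (X n)) \<longlonglongrightarrow> p" by (rule Pbar_sequence[OF assms(1)]) blast
  have "(\<lambda>n. 0) \<longlonglongrightarrow> fst p Q"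
    using tendsto_fun_coordinate[OF tendsto_fst[OF X(2)], of Q] assms(2) by (simp add: embed_def)
  then show ?thesis using LIMSEQ_unique tendsto_const by blast
qed

text \<open>In a finite poset the path and triangle densities agree and the 3-cycle density is zero.
  These patterns have no loops or 2-cycles, so the identities pass to the limiting function, where
  they allow the correction to a kernel.\<close>

lemma Pinf_kernel:
  assumes p: "p \<in> Pinf"
  obtains lt W where "is_kernel unif01 lt W" "kernel_pt unif01 W = p"
proof -
  have pbar: "p \<in> Pbar" using p by (simp add: Pinf_def)
  then obtain X where X: "\<And>n. valid (X n)" "(\<lambda>n. embed (X n)) \<longlonglongrightarrow> p" by (rule Pbar_sequence) blast
  have size: "psize (X s) \<ge> 1" for s by (rule validD(1)[OF X(1)])
  obtain \<sigma> W where \<sigma>: "strict_mono \<sigma>"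
    and W: "(\<lambda>(x, y). W x y) \<in> borel_measurable (borel \<Otimes>\<^sub>M borel)" "\<And>x y. 0 \<le> W x y" "\<And>x y. W x y \<le> 1"
    and lim: "\<And>n S. S \<subseteq> {..<n} \<times> {..<n} \<Longrightarrow> (\<And>i. (i, i) \<notin> S) \<Longrightarrow> (\<And>i j. (i, j) \<in> S \<Longrightarrow> (j, i) \<notin> S) \<Longrightarrow>
      (\<lambda>s. finite_digraph.dens {..<psize (X (\<sigma> s))} {..<n} S (\<lambda>u v. of_bool (prel (X (\<sigma> s)) u v))) \<longlonglongrightarrow>
      (\<integral>x. (\<Prod>(i, j)\<in>S. W (x i) (x j)) \<partial>PiM {..<n} (\<lambda>_. unif01))"
    by (rule digraph_sequence_kernel[of "\<lambda>s. psize (X s)" "\<lambda>s. prel (X s)", OF size]) blast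
  have lim': "(\<lambda>s. hom_dens n S {} (X (\<sigma> s))) \<longlonglongrightarrow> (\<integral>x. (\<Prod>(i, j)\<in>S. W (x i) (x j)) \<partial>PiM {..<n} (\<lambda>_. unif01))"
    if "S \<subseteq> {..<n} \<times> {..<n}" "\<And>i. (i, i) \<notin> S" "\<And>i j. (i, j) \<in> S \<Longrightarrow> (j, i) \<notin> S" for n S
  proof -
    have "finite S" using that(1) finite_subset by blast
    from lim[OF that] show ?thesis by (simp only: dens_eq_hom_dens[OF \<open>finite S\<close> size])
  qed
  let ?path = "{(0, 1), (1, 2)} :: (nat \<times> nat) set" and ?tri = "{(0, 1), (1, 2), (0, 2)} :: (nat \<times> nat) set"
    and ?cyc = "{(0, 1), (1, 2), (2, 0)} :: (nat \<times> nat) set"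
  have L_tri: "(\<lambda>s. hom_dens 3 ?tri {} (X (\<sigma> s))) \<longlonglongrightarrow> (\<integral>x. (\<Prod>(i, j)\<in>?tri. W (x i) (x j)) \<partial>PiM {..<3::nat} (\<lambda>_. unif01))"
    by (rule lim') auto
  have L_cyc: "(\<lambda>s. hom_dens 3 ?cyc {} (X (\<sigma> s))) \<longlonglongrightarrow> (\<integral>x. (\<Prod>(i, j)\<in>?cyc. W (x i) (x j)) \<partial>PiM {..<3::nat} (\<lambda>_. unif01))"
    by (rule lim') auto
  have tri_path: "hom_dens 3 ?tri {} P = hom_dens 3 ?path {} P" if "valid P" for P
  proof -
    have "prel P (\<phi> 0) (\<phi> 2)" if "prel P (\<phi> 0) (\<phi> 1)" "prel P (\<phi> 1) (\<phi> 2)" for \<phi> :: "nat \<Rightarrow> nat"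
      by (rule validD(5)[OF \<open>valid P\<close> that])
    then have "(\<forall>(i, j)\<in>?tri. prel P (\<phi> i) (\<phi> j)) \<longleftrightarrow> (\<forall>(i, j)\<in>?path. prel P (\<phi> i) (\<phi> j))" for \<phi> :: "nat \<Rightarrow> nat"
      by auto
    then show ?thesis unfolding hom_dens_def by presburger
  qed
  have tri: "(\<integral>x. (\<Prod>(i, j)\<in>?tri. W (x i) (x j)) \<partial>PiM {..<3::nat} (\<lambda>_. unif01)) =
    (\<integral>x. (\<Prod>(i, j)\<in>?path. W (x i) (x j)) \<partial>PiM {..<3::nat} (\<lambda>_. unif01))"
    by (rule LIMSEQ_unique[OF L_tri[unfolded tri_path[OF X(1)]]]) (rule lim', auto)
  have cyc_0: "hom_dens 3 ?cyc {} P = 0" if "valid P" for P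
  proof -
    have "\<not> (prel P (\<phi> 0) (\<phi> 1) \<and> prel P (\<phi> 1) (\<phi> 2) \<and> prel P (\<phi> 2) (\<phi> 0))" for \<phi> :: "nat \<Rightarrow> nat"
    proof
      assume a: "prel P (\<phi> 0) (\<phi> 1) \<and> prel P (\<phi> 1) (\<phi> 2) \<and> prel P (\<phi> 2) (\<phi> 0)"
      then have "prel P (\<phi> 0) (\<phi> 2)" using validD(5)[OF that, of "\<phi> 0" "\<phi> 1" "\<phi> 2"] by simp
      then have "prel P (\<phi> 0) (\<phi> 0)" using a validD(5)[OF that, of "\<phi> 0" "\<phi> 2" "\<phi> 0"] by simp
      then show False using validD(4)[OF that] by simp
    qed
    then have "\<not> (\<forall>(i, j)\<in>?cyc. prel P (\<phi> i) (\<phi> j))" for \<phi> :: "nat \<Rightarrow> nat"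
      by simp
    then have "{\<phi> \<in> {0..<3} \<rightarrow>\<^sub>E {0..<psize P}. (\<forall>(i, j)\<in>?cyc. prel P (\<phi> i) (\<phi> j)) \<and>
      (\<forall>(i, j)\<in>{}. \<not> prel P (\<phi> i) (\<phi> j))} = {}" by blast
    then show ?thesis by (simp only: hom_dens_def card.empty of_nat_0 div_0)
  qed
  have cyc: "(\<integral>x. (\<Prod>(i, j)\<in>?cyc. W (x i) (x j)) \<partial>PiM {..<3::nat} (\<lambda>_. unif01)) = 0"
    by (rule LIMSEQ_unique[OF L_cyc[unfolded cyc_0[OF X(1)]] tendsto_const])
  obtain lt W' where W': "is_kernel unif01 lt W'"
    "\<And>(n::nat) S. S \<subseteq> {..<n} \<times> {..<n} \<Longrightarrow> (\<And>i. (i, i) \<notin> S) \<Longrightarrow>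
      (\<integral>x. (\<Prod>(i, j)\<in>S. W' (x i) (x j)) \<partial>PiM {..<n} (\<lambda>_. unif01)) =
      (\<integral>x. (\<Prod>(i, j)\<in>S. W (x i) (x j)) \<partial>PiM {..<n} (\<lambda>_. unif01))"
    by (rule exists_kernel_version[OF W tri cyc]) blast
  have "fst (kernel_pt unif01 W') Q = fst p Q" for Q
  proof (cases "valid Q")
    case True
    let ?S = "set (snd Q)"
    have S: "?S \<subseteq> {..<psize Q} \<times> {..<psize Q}" by (rule validD(6)[OF True])
    have irr: "(i, i) \<notin> ?S" for i using validD(4)[OF True, of i] by (simp add: prel_def)
    have asym: "(j, i) \<notin> ?S" if "(i, j) \<in> ?S" for i j
      using validD(5)[OF True, of i j i] irr[of i] that by (auto simp: prel_def)
    have "(\<lambda>s. hom_t Q (X s)) \<longlonglongrightarrow> tlim Q p" by (rule embed_tendsto_fst[OF X(2) True])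
    from LIMSEQ_subseq_LIMSEQ[OF this \<sigma>] have "(\<lambda>s. hom_t Q (X (\<sigma> s))) \<longlonglongrightarrow> tlim Q p"
      by (simp only: o_def)
    moreover have "(\<lambda>s. hom_t Q (X (\<sigma> s))) \<longlonglongrightarrow> (\<integral>x. (\<Prod>(i, j)\<in>?S. W (x i) (x j)) \<partial>PiM {..<psize Q} (\<lambda>_. unif01))"
      unfolding hom_t_eq_hom_dens by (rule lim'[OF S irr asym])
    ultimately have "fst p Q = (\<integral>x. (\<Prod>(i, j)\<in>?S. W (x i) (x j)) \<partial>PiM {..<psize Q} (\<lambda>_. unif01))"
      unfolding tlim_def by (rule LIMSEQ_unique)
    also have "\<dots> = fst (kernel_pt unif01 W') Q"
      unfolding W'(2)[OF S irr, symmetric] using True by (simp add: kernel_pt_def atLeast0LessThan)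
    finally show ?thesis ..
  next
    case False
    then show ?thesis by (simp add: kernel_pt_def Pinf_fst_invalid[OF pbar])
  qed
  then have "kernel_pt unif01 W' = p"
    using Pinf_snd[OF p] by (intro prod_eqI ext) (auto simp: kernel_pt_def)
  then show ?thesis using that W'(1) by blast
qed

lemma law_kernel_unique:
  assumes "is_kernel M lt W" "is_kernel M' lt' W'" "kernel_pt M W = kernel_pt M' W'"
  shows "law_kernel M W = law_kernel M' W'"
proof -
  interpret K: poset_kernel M lt W by unfold_locales fact
  interpret K': poset_kernel M' lt' W' by unfold_locales fact
  show ?thesis
  proof (rule Rel_poset_eqI[OF K.prob_space_law K.sets_law K.AE_law_poset K'.prob_space_law K'.sets_law K'.AE_law_poset])
    fix A q assume q: "lposet A q"
    show "measure (law_kernel M W) (superrel {(x, y). q x y}) = measure (law_kernel M' W') (superrel {(x, y). q x y})"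
      using K.measure_law_valid[OF valid_lcode[OF q]] K'.measure_law_valid[OF valid_lcode[OF q]] assms(3)
      by (simp add: exch_superrel_lcode[OF K.exch_law_kernel q] exch_superrel_lcode[OF K'.exch_law_kernel q])
  qed
qed

text \<open>The description in \<open>Plaw\<close> is proper: a kernel exists, and by
  \<open>law_kernel_unique\<close> its law depends only on \<open>p\<close>.\<close>

lemma Plaw_kernel:
  assumes "p \<in> Pinf"
  obtains lt W where "is_kernel unif01 lt W" "kernel_pt unif01 W = p" "Plaw p = law_kernel unif01 W"
proof -
  obtain lt W where W: "is_kernel unif01 lt W" "kernel_pt unif01 W = p" by (rule Pinf_kernel[OF assms])
  have "Plaw p = law_kernel unif01 W"
    unfolding Plaw_def
  proof (rule the_equality)
    show "\<exists>(M :: real measure) lt V. is_kernel M lt V \<and> kernel_pt M V = p \<and> law_kernel unif01 W = law_kernel M V"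
      using W by blast
    fix \<mu> assume "\<exists>(M :: real measure) lt V. is_kernel M lt V \<and> kernel_pt M V = p \<and> \<mu> = law_kernel M V"
    then show "\<mu> = law_kernel unif01 W"
      using W law_kernel_unique by metis
  qed
  then show ?thesis using that W by blast
qed

lemma exch_law_Plaw: "p \<in> Pinf \<Longrightarrow> exch_law (Plaw p)"
proof -
  assume "p \<in> Pinf"
  then obtain lt W where W: "is_kernel unif01 lt W" "Plaw p = law_kernel unif01 W" by (rule Plaw_kernel)
  interpret K: poset_kernel unif01 lt W by unfold_locales fact
  show ?thesis unfolding W(2) by (rule K.exch_law_kernel)
qed

lemma measure_Plaw_valid:
  "p \<in> Pinf \<Longrightarrow> valid Q \<Longrightarrow> measure (Plaw p) (superrel (set (snd Q))) = tlim Q p"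
proof -
  assume "p \<in> Pinf" and Q: "valid Q"
  then obtain lt W where W: "is_kernel unif01 lt W" "kernel_pt unif01 W = p" "Plaw p = law_kernel unif01 W"
    by (elim Plaw_kernel)
  interpret K: poset_kernel unif01 lt W by unfold_locales fact
  show ?thesis using K.measure_law_valid[OF Q] by (simp only: W(2,3) tlim_def)
qed

lemma measure_Plaw_disjoint:
  assumes "p \<in> Pinf" "I \<inter> J = {}" "finite I" "finite J" "S \<subseteq> I \<times> I" "T \<subseteq> J \<times> J"
  shows "measure (Plaw p) (superrel (S \<union> T)) = measure (Plaw p) (superrel S) * measure (Plaw p) (superrel T)"
proof -
  obtain lt W where W: "is_kernel unif01 lt W" "Plaw p = law_kernel unif01 W" by (rule Plaw_kernel[OF assms(1)])
  interpret K: poset_kernel unif01 lt W by unfold_locales fact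
  show ?thesis unfolding W(2) by (rule K.measure_law_superrel_disjoint[OF assms(2-)])
qed

text \<open>Inclusion and exclusion by induction on \<open>T\<close>: forbidding a pair subtracts
  the count in which it is required. For empty \<open>T\<close>, transitive closure turns
  \<open>S\<close> into a valid code, or a cycle makes both sides zero.\<close>

lemma tendsto_hom_dens:
  assumes p: "p \<in> Pinf" and X: "\<And>m. valid (X m)" "(\<lambda>m. embed (X m)) \<longlonglongrightarrow> p"
    and n: "n \<ge> 1" and S: "S \<subseteq> {..<n} \<times> {..<n}" and T: "T \<subseteq> {..<n} \<times> {..<n}"
  shows "(\<lambda>m. hom_dens n S T (X m)) \<longlonglongrightarrow> measure (Plaw p) {r. (\<forall>e\<in>S. r e) \<and> (\<forall>e\<in>T. \<not> r e)}"
proof -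
  note R = exch_lawD(1-3)[OF exch_law_Plaw[OF p]]
  interpret R: prob_space "Plaw p" by (rule R(1))
  have "finite T" using T finite_subset by blast
  then show ?thesis using T S
  proof (induction T arbitrary: S rule: finite_induct)
    case empty
    have finS: "finite S" using empty(2) finite_subset by blast
    have "(\<lambda>m. hom_dens n S {} (X m)) \<longlonglongrightarrow> measure (Plaw p) (superrel S)"
    proof (cases "acyclic S")
      case True
      obtain l where l: "set l = S\<^sup>+" using finite_list[of "S\<^sup>+"] finS by auto
      have sub: "S\<^sup>+ \<subseteq> {..<n} \<times> {..<n}" using empty(2) by (rule trancl_subset_Sigma)
      have "valid (n, l)"
        unfolding valid_def prel_def psize_def fst_conv snd_conv l
      proof (intro conjI allI impI n)
        show "\<forall>(i, j)\<in>S\<^sup>+. i < n \<and> j < n" using sub by auto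
        show "(i, i) \<notin> S\<^sup>+" for i using True by (simp add: acyclic_def)
        show "(i, k) \<in> S\<^sup>+" if "(i, j) \<in> S\<^sup>+" "(j, k) \<in> S\<^sup>+" for i j k using that by (rule trancl_trans)
      qed
      then have "(\<lambda>m. hom_t (n, l) (X m)) \<longlonglongrightarrow> measure (Plaw p) (superrel (S\<^sup>+))"
        using embed_tendsto_fst[OF X(2)] measure_Plaw_valid[OF p, of "(n, l)"] by (simp add: l)
      then show ?thesis
        using True measure_superrel_trancl[OF R finS] hom_dens_trancl[OF X(1), of n S]
        by (simp add: hom_t_eq_hom_dens psize_def l)
    next
      case False
      then show ?thesis
        using measure_superrel_trancl[OF R finS] hom_dens_trancl[OF X(1), of n S] by simp
    qed
    then show ?case by (simp add: superrel_def)
  next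
    case (insert e T)
    let ?E = "\<lambda>S T. {r. (\<forall>e\<in>S. r e) \<and> (\<forall>e\<in>T. \<not> r e)} :: nrel set"
    have ev: "?E S' T' \<in> sets (Plaw p)" if "finite S'" "finite T'" for S' T'
    proof -
      have "{r \<in> space Rel. (\<forall>e\<in>S'. r e) \<and> (\<forall>e\<in>T'. \<not> r e)} \<in> sets Rel" using that by measurable
      then show ?thesis by (simp add: R(2))
    qed
    have finS: "finite S" using insert.prems(2) finite_subset by blast
    have "(\<lambda>m. hom_dens n S T (X m) - hom_dens n (insert e S) T (X m)) \<longlonglongrightarrow>
      measure (Plaw p) (?E S T) - measure (Plaw p) (?E (insert e S) T)"
      using insert by (intro tendsto_diff insert.IH) auto
    moreover have "measure (Plaw p) (?E S T) - measure (Plaw p) (?E (insert e S) T) = measure (Plaw p) (?E S (insert e T))"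
    proof -
      have eq: "?E S (insert e T) = ?E S T - ?E (insert e S) T" by auto
      have fin: "finite (insert e S)" using finS by simp
      show ?thesis
        unfolding eq by (rule R.finite_measure_Diff[OF ev[OF finS insert(1)] ev[OF fin insert(1)], symmetric]) blast
    qed
    ultimately show ?case by (simp add: hom_dens_insert[OF insert(2)])
  qed
qed

text \<open>Non-injective maps are a fraction of at most \<open>(psize Q)\<^sup>2 / psize P\<close>.
  They affect numerator and denominator; the first size condition keeps the injective fraction at
  least one half, which controls the quotient.\<close>

lemma ind_t_hom_dens:
  assumes "valid Q" "psize P \<ge> 2 * (psize Q)\<^sup>2" "psize P \<ge> psize Q"
  shows "\<bar>ind_t Q P - hom_dens (psize Q) (set (snd Q)) ({..<psize Q} \<times> {..<psize Q} - set (snd Q)) P\<bar>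
    \<le> 3 * (real (psize Q))\<^sup>2 / real (psize P)"
proof -
  let ?k = "psize Q" and ?N = "psize P" and ?S = "set (snd Q)"
  have k: "?k \<ge> 1" and S: "?S \<subseteq> {..<?k} \<times> {..<?k}" using validD[OF assms(1)] by auto
  have N: "?N \<ge> 1" using k assms(3) by simp
  define F where "F = {0..<?k} \<rightarrow>\<^sub>E {0..<?N}"
  define G where "G = {\<phi> \<in> F. \<forall>i<?k. \<forall>j<?k. prel Q i j \<longleftrightarrow> prel P (\<phi> i) (\<phi> j)}"
  define J where "J = {\<phi> \<in> F. inj_on \<phi> {0..<?k}}"
  define B where "B = {\<phi> \<in> F. \<not> inj_on \<phi> {0..<?k}}"
  have fin: "finite F" "finite G" "finite J" "finite B"
    using finite_PiE_nat[of ?k ?N] by (auto simp: F_def G_def J_def B_def)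
  have cF: "real (card F) = real ?N ^ ?k" by (simp add: F_def card_PiE)
  have cB: "real (card B) \<le> real ?k ^ 2 / real ?N * real ?N ^ ?k"
    using card_PiE_not_inj_real[of ?N ?k] N by (simp add: B_def F_def)
  have "F = J \<union> B" "J \<inter> B = {}" by (auto simp: J_def B_def)
  then have JB: "real (card J) + real (card B) = real ?N ^ ?k"
    using fin cF card_Un_disjoint[of J B] by simp
  have "G = (G \<inter> J) \<union> (G \<inter> B)" "(G \<inter> J) \<inter> (G \<inter> B) = {}"
    by (auto simp: J_def B_def G_def)
  then have "card G = card (G \<inter> J) + card (G \<inter> B)"
    using fin card_Un_disjoint[of "G \<inter> J" "G \<inter> B"] by simp
  moreover have "card (G \<inter> B) \<le> card B" "card (G \<inter> J) \<le> card J" using fin by (auto intro: card_mono)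
  ultimately have G: "real (card (G \<inter> J)) \<le> real (card G)" "real (card G) \<le> real (card (G \<inter> J)) + real (card B)"
    "real (card (G \<inter> J)) \<le> real (card J)" by simp_all
  have ind: "ind_t Q P = real (card (G \<inter> J)) / real (card J)"
  proof -
    have "{\<phi> \<in> F. inj_on \<phi> {0..<?k} \<and> (\<forall>i<?k. \<forall>j<?k. prel Q i j \<longleftrightarrow> prel P (\<phi> i) (\<phi> j))} = G \<inter> J"
      by (auto simp: G_def J_def)
    then show ?thesis using assms(3) by (simp add: ind_t_def F_def J_def)
  qed
  have hom: "hom_dens ?k ?S ({..<?k} \<times> {..<?k} - ?S) P = real (card G) / real ?N ^ ?k"
  proof -
    have "(\<forall>(i, j)\<in>?S. prel P (\<phi> i) (\<phi> j)) \<and> (\<forall>(i, j)\<in>{..<?k} \<times> {..<?k} - ?S. \<not> prel P (\<phi> i) (\<phi> j)) \<longleftrightarrow>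
      (\<forall>i<?k. \<forall>j<?k. prel Q i j \<longleftrightarrow> prel P (\<phi> i) (\<phi> j))" for \<phi>
      using S unfolding prel_def by blast
    then show ?thesis by (simp add: hom_dens_def G_def F_def)
  qed
  let ?n = "real ?N ^ ?k" and ?\<beta> = "real ?k ^ 2 / real ?N"
  have n: "?n > 0" using N by simp
  have \<beta>: "?\<beta> \<le> 1 / 2" "0 \<le> ?\<beta>"
  proof -
    have "real (2 * ?k\<^sup>2) \<le> real ?N" using assms(2) by (rule of_nat_mono)
    then show "?\<beta> \<le> 1 / 2" using N by (simp add: field_simps)
  qed simp
  \<comment> \<open>\<open>a / c\<close> is the induced density and \<open>b\<close> its analogue
    over all maps. Each exceeds \<open>a\<close> by at most \<open>?\<beta>\<close>.\<close>
  define c where "c = real (card J) / ?n"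
  define a where "a = real (card (G \<inter> J)) / ?n"
  define b where "b = real (card G) / ?n"
  have "c + real (card B) / ?n = 1" using JB n by (simp add: c_def flip: add_divide_distrib)
  moreover have "real (card B) / ?n \<le> ?\<beta>" using cB n by (simp add: pos_divide_le_eq)
  moreover have "0 \<le> real (card B) / ?n" by simp
  ultimately have c: "1 - ?\<beta> \<le> c" "c \<le> 1" by linarith+
  have ab: "0 \<le> a" "a \<le> b" "a \<le> c"
    unfolding a_def b_def c_def using G n by (auto intro: divide_right_mono)
  have "b \<le> (real (card (G \<inter> J)) + real (card B)) / ?n"
    unfolding b_def using G n by (intro divide_right_mono) auto
  then have b: "b \<le> a + ?\<beta>"
    using \<open>real (card B) / ?n \<le> ?\<beta>\<close> by (simp add: a_def add_divide_distrib)
  have c2: "c \<ge> 1 / 2" using c \<beta> by linarith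
  have "a / c - a = a / c * (1 - c)" using c2 by (simp add: field_simps)
  moreover have "a / c \<le> 1" "0 \<le> a / c" using ab c2 by auto
  ultimately have "0 \<le> a / c - a" "a / c - a \<le> ?\<beta>"
    using c mult_left_le_one_le[of "1 - c" "a / c"] mult_nonneg_nonneg[of "a / c" "1 - c"] by linarith+
  then have "\<bar>a / c - b\<bar> \<le> 3 * ?\<beta>" using ab b \<beta> by linarith
  moreover have "ind_t Q P = a / c" using ind n by (simp add: a_def c_def)
  ultimately show ?thesis by (simp add: hom b_def)
qed

text \<open>All approximating sequences give the same limit of induced densities, so the value
  satisfies the description in \<open>tindlim\<close>; since at least one such sequence exists, no
  other value does.\<close>

lemma tindlim_eq:
  assumes p: "p \<in> Pinf" and Q: "valid Q"
  shows "tindlim Q p = measure (Plaw p) (pattern (psize Q) (prel Q))"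
proof -
  let ?k = "psize Q" and ?S = "set (snd Q)"
  let ?T = "{..<?k} \<times> {..<?k} - ?S"
  have k: "?k \<ge> 1" and S: "?S \<subseteq> {..<?k} \<times> {..<?k}" using validD[OF Q] by auto
  have pat: "{r. (\<forall>e\<in>?S. r e) \<and> (\<forall>e\<in>?T. \<not> r e)} = pattern ?k (prel Q)"
    using S unfolding pattern_def prel_def by blast
  have lim: "(\<lambda>n. ind_t Q (X n)) \<longlonglongrightarrow> measure (Plaw p) (pattern ?k (prel Q))"
    if X: "\<And>n. valid (X n)" "(\<lambda>n. embed (X n)) \<longlonglongrightarrow> p" for X
  proof -
    have h: "(\<lambda>n. hom_dens ?k ?S ?T (X n)) \<longlonglongrightarrow> measure (Plaw p) (pattern ?k (prel Q))"
      using tendsto_hom_dens[OF p X k S, of ?T] pat by simp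
    have inv: "(\<lambda>n. 1 / real (psize (X n))) \<longlonglongrightarrow> 0"
      using embed_tendsto_snd[OF X(2)] Pinf_snd[OF p] by simp
    \<comment> \<open>Exceeding this bound meets both size conditions of
      \<open>ind_t_hom_dens\<close>.\<close>
    define K where "K = real (2 * ?k\<^sup>2 + ?k)"
    have K: "K > 0" using k by (simp add: K_def add_nonneg_pos)
    have "eventually (\<lambda>n. 1 / real (psize (X n)) < 1 / K) sequentially"
      using K by (intro order_tendstoD(2)[OF inv]) simp
    then have "eventually (\<lambda>n. norm (ind_t Q (X n) - hom_dens ?k ?S ?T (X n)) \<le> 3 * (real ?k)\<^sup>2 * (1 / real (psize (X n)))) sequentially"
    proof eventually_elim
      case (elim n)
      have "K < real (psize (X n))" using elim K validD(1)[OF X(1)[of n]] by (simp add: field_simps)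
      then have "2 * ?k\<^sup>2 + ?k < psize (X n)" unfolding K_def by (simp only: of_nat_less_iff)
      then show ?case using ind_t_hom_dens[OF Q, of "X n"] by simp
    qed
    moreover have "(\<lambda>n. 3 * (real ?k)\<^sup>2 * (1 / real (psize (X n)))) \<longlonglongrightarrow> 0"
      using tendsto_mult_left[OF inv, of "3 * (real ?k)\<^sup>2"] by simp
    ultimately have "(\<lambda>n. ind_t Q (X n) - hom_dens ?k ?S ?T (X n)) \<longlonglongrightarrow> 0"
      by (rule Lim_null_comparison)
    from tendsto_add[OF this h] show ?thesis by simp
  qed
  have "p \<in> Pbar" using p by (simp add: Pinf_def)
  then obtain X where X: "\<And>n. valid (X n)" "(\<lambda>n. embed (X n)) \<longlonglongrightarrow> p" by (rule Pbar_sequence) blast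
  show ?thesis
    unfolding tindlim_def
  proof (rule the_equality)
    show "\<forall>X. (\<forall>n. valid (X n)) \<longrightarrow> (\<lambda>n. embed (X n)) \<longlonglongrightarrow> p \<longrightarrow>
      (\<lambda>n. ind_t Q (X n)) \<longlonglongrightarrow> measure (Plaw p) (pattern ?k (prel Q))"
      using lim by blast
    fix c assume "\<forall>X. (\<forall>n. valid (X n)) \<longrightarrow> (\<lambda>n. embed (X n)) \<longlonglongrightarrow> p \<longrightarrow> (\<lambda>n. ind_t Q (X n)) \<longlonglongrightarrow> c"
    then have "(\<lambda>n. ind_t Q (X n)) \<longlonglongrightarrow> c" using X by blast
    then show "c = measure (Plaw p) (pattern ?k (prel Q))" using lim[OF X] LIMSEQ_unique by blast
  qed
qed

section \<open>Restrictions of an exchangeable poset\<close>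

lemma psize_rcode: "psize (rcode N r) = N"
  by (simp add: rcode_def psize_def)

lemma prel_rcode: "prel (rcode N r) i j \<longleftrightarrow> i < N \<and> j < N \<and> r (i, j)"
  by (auto simp: rcode_def prel_def)

lemma valid_rcode:
  assumes r: "is_poset_N r" and "N \<ge> 1"
  shows "valid (rcode N r)"
  unfolding valid_def
proof (intro conjI allI impI)
  show "\<forall>(i, j)\<in>set (snd (rcode N r)). i < psize (rcode N r) \<and> j < psize (rcode N r)"
    by (auto simp: rcode_def psize_def)
  show "\<not> prel (rcode N r) i i" for i using r by (simp add: prel_rcode is_poset_N_def)
  show "prel (rcode N r) i k" if "prel (rcode N r) i j" "prel (rcode N r) j k" for i j k
    using r that unfolding prel_rcode is_poset_N_def by blast
qed (use assms in \<open>simp add: psize_rcode\<close>)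

text \<open>As an average of indicators, the density of a restriction has moments that are averages
  of containment probabilities.\<close>

lemma hom_t_rcode:
  assumes Q: "valid Q"
  shows "hom_t Q (rcode N r) =
    (\<Sum>\<phi>\<in>{0..<psize Q} \<rightarrow>\<^sub>E {0..<N}. indicator (superrel (map_prod \<phi> \<phi> ` set (snd Q))) r) / real N ^ psize Q"
proof -
  have "(\<forall>i j. prel Q i j \<longrightarrow> prel (rcode N r) (\<phi> i) (\<phi> j)) \<longleftrightarrow> r \<in> superrel (map_prod \<phi> \<phi> ` set (snd Q))"
    if \<phi>: "\<phi> \<in> {0..<psize Q} \<rightarrow>\<^sub>E {0..<N}" for \<phi>
  proof -
    have "\<phi> i < N" "\<phi> j < N" if "prel Q i j" for i j
      using PiE_mem[OF \<phi>, of i] PiE_mem[OF \<phi>, of j] validD(2,3)[OF Q that] by auto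
    then have "(\<forall>i j. prel Q i j \<longrightarrow> prel (rcode N r) (\<phi> i) (\<phi> j)) \<longleftrightarrow> (\<forall>i j. prel Q i j \<longrightarrow> r (\<phi> i, \<phi> j))"
      by (auto simp: prel_rcode)
    also have "\<dots> \<longleftrightarrow> r \<in> superrel (map_prod \<phi> \<phi> ` set (snd Q))"
      by (auto simp: superrel_def prel_def)
    finally show ?thesis .
  qed
  then have "{\<phi> \<in> {0..<psize Q} \<rightarrow>\<^sub>E {0..<N}. \<forall>i j. prel Q i j \<longrightarrow> prel (rcode N r) (\<phi> i) (\<phi> j)} =
    {\<phi> \<in> {0..<psize Q} \<rightarrow>\<^sub>E {0..<N}. r \<in> superrel (map_prod \<phi> \<phi> ` set (snd Q))}" by blast
  moreover have "(\<Sum>\<phi>\<in>F. indicator (G \<phi>) r) = real (card {\<phi> \<in> F. r \<in> G \<phi>})"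
    if "finite F" for F :: "(nat \<Rightarrow> nat) set" and G
    using that by (simp add: indicator_def Int_def of_bool_def[symmetric])
  ultimately show ?thesis
    by (simp add: hom_t_def psize_rcode finite_PiE_nat)
qed

text \<open>Maps into the first \<open>M\<close> labels are the fraction
  \<open>(real M / real N) ^ psize Q\<close> of the maps into \<open>N\<close> labels; only the
  remaining ones can change the density.\<close>

lemma hom_t_rcode_gap:
  assumes Q: "valid Q" and M: "0 < M" "M \<le> N"
  shows "\<bar>hom_t Q (rcode N r) - hom_t Q (rcode M r)\<bar> \<le> 1 - (real M / real N) ^ psize Q"
proof -
  let ?k = "psize Q"
  define G where "G \<phi> = indicat_real (superrel (map_prod \<phi> \<phi> ` set (snd Q))) r" for \<phi> :: "nat \<Rightarrow> nat"
  define F where "F n = {0..<?k} \<rightarrow>\<^sub>E {0..<n}" for n :: nat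
  have F: "finite (F n)" "card (F n) = n ^ ?k" for n by (simp_all add: F_def finite_PiE_nat card_PiE)
  have sub: "F M \<subseteq> F N" using M by (fastforce simp: F_def PiE_iff)
  have "sum G (F M) \<le> sum G (F N)" using F sub by (intro sum_mono2) (auto simp: G_def)
  moreover have "sum G (F N) = sum G (F M) + sum G (F N - F M)"
    using F sub by (subst sum.subset_diff[of "F M" "F N"]) auto
  moreover have "sum G (F N - F M) \<le> real N ^ ?k - real M ^ ?k"
  proof -
    have "sum G (F N - F M) \<le> (\<Sum>\<phi>\<in>F N - F M. 1)" by (intro sum_mono) (simp add: G_def indicator_def)
    also have "\<dots> = real (card (F N)) - real (card (F M))"
      using F sub M by (simp add: card_Diff_subset card_mono of_nat_diff power_mono)
    finally show ?thesis by (simp add: F)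
  qed
  ultimately have s: "sum G (F M) \<le> sum G (F N)" "sum G (F N) \<le> sum G (F M) + (real N ^ ?k - real M ^ ?k)" by linarith+
  have U: "hom_t Q (rcode n r) = sum G (F n) / real n ^ ?k" for n
    by (simp add: hom_t_rcode[OF Q] G_def F_def)
  let ?\<rho> = "(real M / real N) ^ ?k"
  have N: "real N > 0" "real M > 0" using M by auto
  have \<rho>: "0 \<le> ?\<rho>" "?\<rho> \<le> 1" using M by (auto intro!: power_le_one)
  have UM: "sum G (F M) / real N ^ ?k = hom_t Q (rcode M r) * ?\<rho>"
    using N by (simp add: U power_divide)
  have "hom_t Q (rcode M r) * ?\<rho> \<le> hom_t Q (rcode N r)"
    unfolding UM[symmetric] U[of N] using s(1) N by (intro divide_right_mono) auto
  moreover have "hom_t Q (rcode N r) \<le> hom_t Q (rcode M r) * ?\<rho> + (1 - ?\<rho>)"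
  proof -
    have "hom_t Q (rcode N r) \<le> (sum G (F M) + (real N ^ ?k - real M ^ ?k)) / real N ^ ?k"
      unfolding U[of N] using s(2) N by (intro divide_right_mono) auto
    also have "\<dots> = sum G (F M) / real N ^ ?k + (1 - ?\<rho>)"
      using N by (simp add: add_divide_distrib diff_divide_distrib power_divide)
    finally show ?thesis unfolding UM .
  qed
  moreover have "hom_t Q (rcode M r) * ?\<rho> \<le> hom_t Q (rcode M r)"
    "hom_t Q (rcode M r) - hom_t Q (rcode M r) * ?\<rho> \<le> 1 - ?\<rho>"
  proof -
    show "hom_t Q (rcode M r) * ?\<rho> \<le> hom_t Q (rcode M r)"
      using \<rho> hom_t_bounds by (intro mult_left_le) auto
    have "hom_t Q (rcode M r) * (1 - ?\<rho>) \<le> 1 * (1 - ?\<rho>)"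
      using \<rho> hom_t_bounds by (intro mult_right_mono) auto
    then show "hom_t Q (rcode M r) - hom_t Q (rcode M r) * ?\<rho> \<le> 1 - ?\<rho>"
      by (simp add: algebra_simps)
  qed
  ultimately show ?thesis by linarith
qed

text \<open>The code depends on finitely many pairs, so each fibre is a finite union of
  patterns.\<close>

lemma measurable_rcode: "(\<lambda>r. rcode N r) \<in> measurable Rel (count_space UNIV)"
  unfolding measurable_count_space_eq2_countable
proof (intro conjI ballI)
  fix c :: pcode
  let ?T = "{T \<in> Pow ({..<N} \<times> {..<N}). rcode N (\<lambda>e. e \<in> T) = c}"
  have eq: "rcode N r = rcode N (\<lambda>e. e \<in> {(i, j). i < N \<and> j < N \<and> r (i, j)})" for r
    unfolding rcode_def by (auto intro!: arg_cong[where f = concat] map_cong)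
  have "(\<lambda>r. rcode N r) -` {c} = (\<Union>T\<in>?T. pattern N (\<lambda>i j. (i, j) \<in> T))"
  proof (intro set_eqI iffI)
    fix r assume "r \<in> (\<lambda>r. rcode N r) -` {c}"
    then have "{(i, j). i < N \<and> j < N \<and> r (i, j)} \<in> ?T"
      using eq[of r] by auto
    moreover have "r \<in> pattern N (\<lambda>i j. (i, j) \<in> {(i, j). i < N \<and> j < N \<and> r (i, j)})"
      by (simp add: pattern_def)
    ultimately show "r \<in> (\<Union>T\<in>?T. pattern N (\<lambda>i j. (i, j) \<in> T))"
      by blast
  next
    fix r assume "r \<in> (\<Union>T\<in>?T. pattern N (\<lambda>i j. (i, j) \<in> T))"
    then obtain T where T: "r \<in> pattern N (\<lambda>i j. (i, j) \<in> T)" "T \<subseteq> {..<N} \<times> {..<N}" "rcode N (\<lambda>e. e \<in> T) = c"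
      by blast
    then have "{(i, j). i < N \<and> j < N \<and> r (i, j)} = T" by (auto simp: pattern_def)
    then show "r \<in> (\<lambda>r. rcode N r) -` {c}" using eq[of r] T(3) by simp
  qed
  moreover have "(\<Union>T\<in>?T. pattern N (\<lambda>i j. (i, j) \<in> T)) \<in> sets Rel"
    by (intro sets.finite_UN sets_pattern) auto
  ultimately show "(\<lambda>r. rcode N r) -` {c} \<inter> space Rel \<in> sets Rel" by simp
qed auto

section \<open>Moments of the densities of restrictions\<close>

locale exchangeable =
  fixes R assumes exch: "exch_law R"
begin

sublocale prob_space R by (rule exch_lawD(1)[OF exch])

lemma sets_R [measurable_cong]: "sets R = sets Rel"
  by (rule exch_lawD(2)[OF exch])

lemma space_R [simp]: "space R = UNIV"
  using sets_eq_imp_space_eq[OF sets_R] by simp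

lemma hom_t_rcode_measurable: "(\<lambda>r. hom_t Q (rcode N r)) \<in> borel_measurable R"
  using measurable_compose[OF measurable_rcode, of "hom_t Q" borel N]
  by (simp add: measurable_cong_sets[OF sets_R refl])

lemma hom_t_rcode_integrable: "integrable R (\<lambda>r. hom_t Q (rcode N r))"
  by (rule integrable_real_bounded[of _ 1]) (auto simp: hom_t_rcode_measurable hom_t_bounds)

definition t1 :: "pcode \<Rightarrow> real" where
  "t1 Q = prob (superrel (set (snd Q)))"

text \<open>Two disjoint copies of \<open>Q\<close>, the second shifted out of the way: the expected
  product of the indicators of two injective placements with disjoint images.\<close>

definition t2 :: "pcode \<Rightarrow> real" where
  "t2 Q = prob (superrel (set (snd Q) \<union> map_prod (\<lambda>i. i + psize Q) (\<lambda>i. i + psize Q) ` set (snd Q)))"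

lemma finite_sum_near_const:
  fixes g :: "'b \<Rightarrow> real"
  assumes "finite F" "B \<subseteq> F" "\<And>x. x \<in> F - B \<Longrightarrow> g x = c" "\<And>x. 0 \<le> g x \<and> g x \<le> 1" "0 \<le> c" "c \<le> 1"
  shows "\<bar>sum g F - real (card F) * c\<bar> \<le> real (card B)"
proof -
  have "sum g F - real (card F) * c = (\<Sum>x\<in>F. g x - c)" by (simp add: sum_subtractf)
  also have "\<dots> = (\<Sum>x\<in>B. g x - c)"
    using assms by (intro sum.mono_neutral_right) auto
  finally have "\<bar>sum g F - real (card F) * c\<bar> \<le> (\<Sum>x\<in>B. \<bar>g x - c\<bar>)" by simp
  also have "\<dots> \<le> (\<Sum>x\<in>B. 1)"
  proof (intro sum_mono)
    show "\<bar>g x - c\<bar> \<le> 1" for x using assms(4)[of x] assms(5,6) by linarith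
  qed
  finally show ?thesis by simp
qed

lemma sets_superrel_R: "finite S \<Longrightarrow> superrel S \<in> events"
  using sets_superrel by (simp add: sets_R)

lemma integral_sum_indicator_superrel:
  assumes "finite F" "\<And>\<phi>. finite (h \<phi>)"
  shows "(\<integral>r. (\<Sum>\<phi>\<in>F. indicator (superrel (h \<phi>)) r) \<partial>R) = (\<Sum>\<phi>\<in>F. prob (superrel (h \<phi>)))"
proof -
  have "integrable R (indicat_real (superrel (h \<phi>)))" for \<phi>
    using sets_superrel_R[OF assms(2)] by (intro integrable_real_bounded[of _ 1]) auto
  then show ?thesis
    by (subst Bochner_Integration.integral_sum) auto
qed

text \<open>By exchangeability all injective placements have the same probability
  \<open>t1 Q\<close>; the error bounds the fraction of the others.\<close>

lemma integral_hom_t_near: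
  assumes Q: "valid Q" and N: "N > 0"
  shows "\<bar>(\<integral>r. hom_t Q (rcode N r) \<partial>R) - t1 Q\<bar> \<le> (real (psize Q))\<^sup>2 / real N"
proof -
  let ?k = "psize Q" and ?S = "set (snd Q)"
  let ?F = "{0..<?k} \<rightarrow>\<^sub>E {0..<N}"
  let ?B = "{\<phi> \<in> ?F. \<not> inj_on \<phi> {0..<?k}}"
  let ?g = "\<lambda>\<phi>. prob (superrel (map_prod \<phi> \<phi> ` ?S))"
  have S: "?S \<subseteq> {0..<?k} \<times> {0..<?k}" using validD(6)[OF Q] by (simp add: atLeast0LessThan)
  have "(\<integral>r. hom_t Q (rcode N r) \<partial>R) = (\<Sum>\<phi>\<in>?F. ?g \<phi>) / real N ^ ?k"
    unfolding hom_t_rcode[OF Q] by (simp add: integral_sum_indicator_superrel finite_PiE_nat)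
  moreover have "\<bar>(\<Sum>\<phi>\<in>?F. ?g \<phi>) - real (card ?F) * t1 Q\<bar> \<le> real (card ?B)"
    using exch_superrel_map[OF exch S] finite_PiE_nat
    by (intro finite_sum_near_const) (auto simp: t1_def)
  moreover have "real (card ?B) \<le> (real ?k)\<^sup>2 / real N * real N ^ ?k"
    by (rule card_PiE_not_inj_real[OF N])
  moreover have "real (card ?F) = real N ^ ?k" by (simp add: card_PiE)
  moreover have "\<bar>s / n - c\<bar> \<le> b" if "\<bar>s - n * c\<bar> \<le> b * n" "n > 0" for s n c b :: real
  proof -
    have "s / n - c = (s - n * c) / n" using that by (simp add: field_simps)
    then show ?thesis using that by (simp add: abs_divide pos_divide_le_eq)
  qed
  ultimately show ?thesis using N by force
qed

text \<open>A pair of placements is exceptional if the first or the second is not injective, or if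
  their images meet. Each of these causes has frequency at most
  \<open>(real (psize Q))\<^sup>2 / real n0\<close>, whence the factor 3. All other pairs have
  probability \<open>t2 Q\<close> by exchangeability.\<close>

lemma integral_hom_t_mult_near:
  assumes Q: "valid Q" and N: "N > 0" "M > 0" and n0: "0 < n0" "n0 \<le> N" "n0 \<le> M"
  shows "\<bar>(\<integral>r. hom_t Q (rcode N r) * hom_t Q (rcode M r) \<partial>R) - t2 Q\<bar> \<le> 3 * (real (psize Q))\<^sup>2 / real n0"
proof -
  let ?k = "psize Q" and ?S = "set (snd Q)"
  let ?S2 = "?S \<union> map_prod (\<lambda>i. i + ?k) (\<lambda>i. i + ?k) ` ?S"
  define FN where "FN = {0..<?k} \<rightarrow>\<^sub>E {0..<N}"
  define FM where "FM = {0..<?k} \<rightarrow>\<^sub>E {0..<M}"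
  define B1 where "B1 = {\<phi> \<in> FN. \<not> inj_on \<phi> {0..<?k}}"
  define B2 where "B2 = {\<phi> \<in> FM. \<not> inj_on \<phi> {0..<?k}}"
  define B3 where "B3 = {(\<phi>, \<psi>) \<in> FN \<times> FM. \<exists>i<?k. \<exists>j<?k. \<phi> i = \<psi> j}"
  define B where "B = B1 \<times> FM \<union> FN \<times> B2 \<union> B3"
  define g where "g = (\<lambda>(\<phi>, \<psi>). prob (superrel (map_prod \<phi> \<phi> ` ?S \<union> map_prod \<psi> \<psi> ` ?S)))"
  have fin: "finite FN" "finite FM" "finite B1" "finite B2" "finite B3"
    using finite_PiE_nat by (auto simp: FN_def FM_def B1_def B2_def B3_def
        intro: finite_subset[of _ "({0..<?k} \<rightarrow>\<^sub>E {0..<N}) \<times> ({0..<?k} \<rightarrow>\<^sub>E {0..<M})"])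
  have S: "?S \<subseteq> {0..<?k} \<times> {0..<?k}" using validD(6)[OF Q] by (simp add: atLeast0LessThan)
  have card: "real (card FN) = real N ^ ?k" "real (card FM) = real M ^ ?k"
    by (simp_all add: FN_def FM_def card_PiE)
  have good: "g (\<phi>, \<psi>) = t2 Q" if "(\<phi>, \<psi>) \<in> FN \<times> FM - B" for \<phi> \<psi>
  proof -
    have inj: "inj_on \<phi> {0..<?k}" "inj_on \<psi> {0..<?k}" and ne: "\<And>i j. i < ?k \<Longrightarrow> j < ?k \<Longrightarrow> \<phi> i \<noteq> \<psi> j"
      using that by (auto simp: B_def B1_def B2_def B3_def)
    \<comment> \<open>Glues the two placements into one injection of the doubled index set.\<close>
    define \<theta> where "\<theta> i = (if i < ?k then \<phi> i else \<psi> (i - ?k))" for i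
    have inj\<theta>: "inj_on \<theta> {0..<2 * ?k}"
    proof (rule inj_onI)
      fix i j assume ij: "i \<in> {0..<2 * ?k}" "j \<in> {0..<2 * ?k}" "\<theta> i = \<theta> j"
      show "i = j"
      proof (cases "i < ?k"; cases "j < ?k")
        assume "i < ?k" "j < ?k"
        then show ?thesis using ij inj_onD[OF inj(1), of i j] by (simp add: \<theta>_def)
      next
        assume a: "i < ?k" "\<not> j < ?k"
        then have "j - ?k < ?k" using ij by auto
        then show ?thesis using a ij ne[of i "j - ?k"] by (simp add: \<theta>_def)
      next
        assume a: "\<not> i < ?k" "j < ?k"
        then have "i - ?k < ?k" using ij by auto
        then show ?thesis using a ij ne[of j "i - ?k"] by (simp add: \<theta>_def)
      next
        assume a: "\<not> i < ?k" "\<not> j < ?k"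
        then have "i - ?k < ?k" "j - ?k < ?k" using ij by auto
        then have "i - ?k = j - ?k" using a ij inj_onD[OF inj(2), of "i - ?k" "j - ?k"] by (simp add: \<theta>_def)
        then show ?thesis using a by simp
      qed
    qed
    have S2: "?S2 \<subseteq> {0..<2 * ?k} \<times> {0..<2 * ?k}" using S by auto
    have "map_prod \<theta> \<theta> ` ?S = map_prod \<phi> \<phi> ` ?S"
      using S by (intro image_cong refl) (auto simp: \<theta>_def)
    moreover have "map_prod \<theta> \<theta> ` map_prod (\<lambda>i. i + ?k) (\<lambda>i. i + ?k) ` ?S = map_prod \<psi> \<psi> ` ?S"
      unfolding image_image by (intro image_cong refl) (auto simp: \<theta>_def)
    ultimately have "map_prod \<theta> \<theta> ` ?S2 = map_prod \<phi> \<phi> ` ?S \<union> map_prod \<psi> \<psi> ` ?S"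
      by (simp only: image_Un)
    then show ?thesis
      using exch_superrel_map[OF exch S2 _ inj\<theta>] by (simp add: g_def t2_def)
  qed
  have "(\<integral>r. hom_t Q (rcode N r) * hom_t Q (rcode M r) \<partial>R) = (\<Sum>p\<in>FN \<times> FM. g p) / (real N ^ ?k * real M ^ ?k)"
  proof -
    have "hom_t Q (rcode N r) * hom_t Q (rcode M r) =
      (\<Sum>\<phi>\<in>FN. \<Sum>\<psi>\<in>FM. indicator (superrel (map_prod \<phi> \<phi> ` ?S \<union> map_prod \<psi> \<psi> ` ?S)) r) / (real N ^ ?k * real M ^ ?k)" for r
      unfolding hom_t_rcode[OF Q] FN_def[symmetric] FM_def[symmetric] times_divide_times_eq sum_product
        superrel_Int[symmetric] indicator_inter_arith ..
    then have "(\<integral>r. hom_t Q (rcode N r) * hom_t Q (rcode M r) \<partial>R) =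
      (\<integral>r. (\<Sum>\<phi>\<in>FN. \<Sum>\<psi>\<in>FM. indicator (superrel (map_prod \<phi> \<phi> ` ?S \<union> map_prod \<psi> \<psi> ` ?S)) r) \<partial>R) / (real N ^ ?k * real M ^ ?k)"
      by simp
    also have "\<dots> = (\<Sum>p\<in>FN \<times> FM. g p) / (real N ^ ?k * real M ^ ?k)"
      unfolding sum.cartesian_product case_prod_beta' g_def using fin
      by (subst integral_sum_indicator_superrel) auto
    finally show ?thesis .
  qed
  moreover have "\<bar>(\<Sum>p\<in>FN \<times> FM. g p) - real (card (FN \<times> FM)) * t2 Q\<bar> \<le> real (card B)"
    using good fin by (intro finite_sum_near_const) (auto simp: t2_def B_def B1_def B2_def B3_def g_def)
  moreover have "real (card B) \<le> 3 * (real ?k)\<^sup>2 / real n0 * (real N ^ ?k * real M ^ ?k)"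
  proof -
    let ?n = "real N ^ ?k * real M ^ ?k" and ?b = "(real ?k)\<^sup>2 / real n0"
    have mono: "(real ?k)\<^sup>2 / real m \<le> ?b" if "n0 \<le> m" for m
      using that n0 by (intro divide_left_mono) auto
    have "card B \<le> card (B1 \<times> FM) + card (FN \<times> B2) + card B3"
      unfolding B_def by (meson add_mono card_Un_le le_trans order_refl)
    then have "real (card B) \<le> real (card B1) * real (card FM) + real (card FN) * real (card B2) + real (card B3)"
      by (simp add: card_cartesian_product flip: of_nat_mult of_nat_add)
    also have "\<dots> \<le> ((real ?k)\<^sup>2 / real N * real N ^ ?k) * real M ^ ?k + real N ^ ?k * ((real ?k)\<^sup>2 / real M * real M ^ ?k)
       + (real ?k)\<^sup>2 / real M * ?n"
      unfolding card using card_PiE_not_inj_real[OF N(1), of ?k] card_PiE_not_inj_real[OF N(2), of ?k]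
        card_PiE_pair_collision_real[OF N(2), of ?k N]
      by (intro add_mono mult_mono) (simp_all add: B1_def B2_def B3_def FN_def FM_def)
    also have "\<dots> = (real ?k)\<^sup>2 / real N * ?n + (real ?k)\<^sup>2 / real M * ?n + (real ?k)\<^sup>2 / real M * ?n"
      by (simp add: mult_ac)
    also have "\<dots> \<le> ?b * ?n + ?b * ?n + ?b * ?n"
      using n0 by (intro add_mono mult_right_mono mono) auto
    finally show ?thesis by (simp add: algebra_simps)
  qed
  moreover have "real (card (FN \<times> FM)) = real N ^ ?k * real M ^ ?k"
    by (simp add: card_cartesian_product card)
  moreover have "\<bar>s / n - c\<bar> \<le> b" if "\<bar>s - n * c\<bar> \<le> b * n" "n > 0" for s n c b :: real
  proof -
    have "s / n - c = (s - n * c) / n" using that by (simp add: field_simps)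
    then show ?thesis using that by (simp add: abs_divide pos_divide_le_eq)
  qed
  moreover have "real N ^ ?k * real M ^ ?k > 0" using N by simp
  ultimately show ?thesis by (metis (no_types, lifting) order_trans)
qed

text \<open>All three moments in the expanded square are close to the same number
  \<open>t2 Q\<close>, which cancels. The coefficients 1, 1 and 2 leave four errors with the
  constant 3.\<close>

lemma integral_hom_t_diff_sq:
  assumes Q: "valid Q" and N: "0 < N" "N \<le> M"
  shows "(\<integral>r. (hom_t Q (rcode M r) - hom_t Q (rcode N r))\<^sup>2 \<partial>R) \<le> 12 * (real (psize Q))\<^sup>2 / real N"
proof -
  let ?U = "\<lambda>N r. hom_t Q (rcode N r)" and ?b = "3 * (real (psize Q))\<^sup>2 / real N"
  have int: "integrable R (\<lambda>r. ?U N r * ?U M r)" for N M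
    by (rule integrable_real_bounded[of _ 1])
      (auto simp: abs_mult hom_t_bounds intro!: mult_le_one borel_measurable_times hom_t_rcode_measurable)
  have "(\<integral>r. (?U M r - ?U N r)\<^sup>2 \<partial>R) = (\<integral>r. ?U M r * ?U M r + ?U N r * ?U N r - 2 * (?U N r * ?U M r) \<partial>R)"
    by (simp add: power2_eq_square algebra_simps)
  also have "\<dots> = (\<integral>r. ?U M r * ?U M r \<partial>R) + (\<integral>r. ?U N r * ?U N r \<partial>R) - 2 * (\<integral>r. ?U N r * ?U M r \<partial>R)"
    using int by simp
  also have "\<dots> \<le> 4 * ?b"
    using integral_hom_t_mult_near[OF Q, of M M N] integral_hom_t_mult_near[OF Q, of N N N]
      integral_hom_t_mult_near[OF Q, of N M N] N by linarith
  finally show ?thesis by simp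
qed

lemma AE_convergent_hom_t:
  assumes Q: "valid Q"
  shows "AE r in R. convergent (\<lambda>N. hom_t Q (rcode N r))"
proof -
  let ?U = "\<lambda>N r. hom_t Q (rcode N r)" and ?k = "real (psize Q)"
  \<comment> \<open>Along fourth powers the mean absolute increment is at most a constant times
    \<open>inverse (real (Suc j) ^ 2)\<close>, which is summable.\<close>
  define f where "f j r = ?U (Suc (Suc j) ^ 4) r - ?U (Suc j ^ 4) r" for j r
  have f_meas: "f j \<in> borel_measurable R" for j
    unfolding f_def by (intro borel_measurable_diff hom_t_rcode_measurable)
  have f_le: "\<bar>f j r\<bar> \<le> 1" for j r
    unfolding f_def using hom_t_bounds[of Q "rcode (Suc (Suc j) ^ 4) r"] hom_t_bounds[of Q "rcode (Suc j ^ 4) r"] by linarith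
  have L1: "(\<integral>r. \<bar>f j r\<bar> \<partial>R) \<le> sqrt (12 * ?k\<^sup>2) * inverse (real (Suc j) ^ 2)" for j
  proof -
    have "(\<integral>r. \<bar>f j r\<bar> \<partial>R) \<le> sqrt (\<integral>r. (f j r)\<^sup>2 \<partial>R)"
      by (intro expectation_abs_le_sqrt integrable_real_bounded[of _ 1] f_meas borel_measurable_power)
        (auto simp: f_le abs_square_le_1)
    also have "\<dots> \<le> sqrt (12 * ?k\<^sup>2 / real (Suc j ^ 4))"
      unfolding f_def by (intro real_sqrt_le_mono integral_hom_t_diff_sq[OF Q] power_mono) auto
    also have "\<dots> = sqrt (12 * ?k\<^sup>2) * inverse (real (Suc j) ^ 2)"
    proof -
      have "sqrt (real (Suc j ^ 4)) = real (Suc j) ^ 2"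
        by (rule real_sqrt_unique) (simp_all flip: power_mult)
      then show ?thesis unfolding real_sqrt_divide by (simp only: divide_inverse)
    qed
    finally show ?thesis .
  qed
  have "AE r in R. summable (\<lambda>j. \<bar>f j r\<bar>)"
  proof (rule AE_summable_of_summable_integral)
    show "integrable R (f j)" for j
      by (rule integrable_real_bounded[of _ 1]) (auto simp: f_meas f_le)
    have "summable (\<lambda>j. inverse (real (Suc j) ^ 2))"
      using inverse_power_summable[of 2, where 'a = real] by (subst summable_Suc_iff) simp
    then have "summable (\<lambda>j. sqrt (12 * ?k\<^sup>2) * inverse (real (Suc j) ^ 2))"
      by (rule summable_mult)
    then show "summable (\<lambda>j. \<integral>r. \<bar>f j r\<bar> \<partial>R)"
      by (rule summable_comparison_test'[where N = 0]) (simp add: L1 del: of_nat_Suc)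
  qed
  then show ?thesis
  proof eventually_elim
    case (elim r)
    from iffD1[OF summable_iff_convergent summable_rabs_cancel[OF elim]]
    have "convergent (\<lambda>n. ?U (Suc 0 ^ 4) r + (\<Sum>j<n. f j r))"
      by (rule convergent_add[OF convergent_const])
    moreover have "?U (Suc 0 ^ 4) r + (\<Sum>j<n. f j r) = ?U (Suc n ^ 4) r" for n
      unfolding f_def sum_lessThan_telescope[of "\<lambda>j. ?U (Suc j ^ 4) r"] by simp
    ultimately have "convergent (\<lambda>n. ?U (Suc n ^ 4) r)" by (simp only:)
    then obtain L where "(\<lambda>n. ?U (Suc n ^ 4) r) \<longlonglongrightarrow> L" unfolding convergent_def ..
    from convergent_of_fourth_powers[OF this hom_t_rcode_gap[OF Q]] show ?case by (rule convergentI)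
  qed
qed

end

text \<open>Defined for every relation, but it is the limit of the restrictions only where all
  densities converge. The second coordinate is the limit of \<open>1 / n\<close>.\<close>

definition limit_pt :: "nrel \<Rightarrow> pt" where
  "limit_pt r = ((\<lambda>Q. if valid Q then lim (\<lambda>N. hom_t Q (rcode N r)) else 0), 0)"

lemma tendsto_fun_coordinatewise:
  fixes f :: "'a \<Rightarrow> 'c \<Rightarrow> 'b::topological_space"
  assumes "\<And>c. ((\<lambda>n. f n c) \<longlongrightarrow> l c) F"
  shows "(f \<longlongrightarrow> l) F"
proof -
  have "limitin (product_topology (\<lambda>_. euclidean) UNIV) f l F"
    using assms by (simp add: limitin_componentwise limitin_canonical_iff)
  then show ?thesis by (simp add: euclidean_product_topology limitin_canonical_iff)
qed

lemma limit_pt_measurable: "limit_pt \<in> borel_measurable Rel"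
  unfolding limit_pt_def
proof (intro borel_measurable_Pair measurable_coordinatewise_then_product)
  fix Q
  have "(\<lambda>r. hom_t Q (rcode N r)) \<in> borel_measurable Rel" for N
    using measurable_compose[OF measurable_rcode, of "hom_t Q" borel N] by simp
  then show "(\<lambda>r. if valid Q then lim (\<lambda>N. hom_t Q (rcode N r)) else 0) \<in> borel_measurable Rel"
    by (cases "valid Q") (auto intro: borel_measurable_lim_metric)
qed simp

section \<open>The random limit of the restrictions\<close>

context exchangeable
begin

lemma AE_embed_tendsto: "AE r in R. (\<lambda>n. embed (rcode n r)) \<longlonglongrightarrow> limit_pt r"
proof -
  have "AE r in R. \<forall>Q. valid Q \<longrightarrow> convergent (\<lambda>N. hom_t Q (rcode N r))"
    unfolding AE_all_countable using AE_convergent_hom_t by auto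
  then show ?thesis
  proof eventually_elim
    case (elim r)
    have "(\<lambda>n. if valid Q then hom_t Q (rcode n r) else 0) \<longlonglongrightarrow> (if valid Q then lim (\<lambda>N. hom_t Q (rcode N r)) else 0)" for Q
    proof (cases "valid Q")
      case True
      then show ?thesis using elim[rule_format, OF True] by (simp add: convergent_LIMSEQ_iff)
    qed simp
    moreover have "(\<lambda>n. 1 / real n) \<longlonglongrightarrow> 0" by (rule lim_1_over_n)
    ultimately show ?case
      unfolding embed_def limit_pt_def psize_rcode by (intro tendsto_Pair tendsto_fun_coordinatewise)
  qed
qed

text \<open>Restrictions of a poset to nonempty sets are finite posets, so the limit lies in the
  closure; its second coordinate zero keeps it apart from the finite posets.\<close>

lemma AE_limit_pt_Pinf: "AE r in R. limit_pt r \<in> Pinf"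
  using AE_embed_tendsto exch_lawD(3)[OF exch]
proof eventually_elim
  case (elim r)
  have "eventually (\<lambda>n. embed (rcode n r) \<in> Pbar) sequentially"
    unfolding eventually_sequentially
  proof (intro exI allI impI)
    fix n :: nat assume "n \<ge> 1"
    then have "embed (rcode n r) \<in> Pfin" using valid_rcode[OF elim(2)] by (auto simp: Pfin_def)
    then show "embed (rcode n r) \<in> Pbar" unfolding Pbar_def using closure_subset by blast
  qed
  then have "limit_pt r \<in> Pbar"
    by (rule Lim_in_closed_set[OF _ _ sequentially_bot elim(1), rotated]) (simp add: Pbar_def)
  moreover have "limit_pt r \<notin> Pfin"
  proof
    assume "limit_pt r \<in> Pfin"
    then obtain P where P: "valid P" "limit_pt r = embed P" by (auto simp: Pfin_def)
    then have "1 / real (psize P) = 0" by (simp add: limit_pt_def embed_def)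
    then show False using validD(1)[OF P(1)] by simp
  qed
  ultimately show ?case by (simp add: Pinf_def)
qed

lemma tlim_limit_pt:
  assumes "valid Q"
  shows "AE r in R. (\<lambda>N. hom_t Q (rcode N r)) \<longlonglongrightarrow> tlim Q (limit_pt r)"
  using AE_convergent_hom_t[OF assms]
proof eventually_elim
  case (elim r)
  then show ?case using assms by (simp add: tlim_def limit_pt_def iffD1[OF convergent_LIMSEQ_iff])
qed

lemma tlim_limit_pt_measurable: "(\<lambda>r. tlim Q (limit_pt r)) \<in> borel_measurable R"
proof -
  have "(\<lambda>p::pt. fst p Q) \<in> borel_measurable borel"
    by (rule borel_measurable_continuous_onI)
      (rule continuous_on_product_then_coordinatewise[OF continuous_on_fst[OF continuous_on_id]])
  from measurable_compose[OF limit_pt_measurable this] show ?thesis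
    by (simp add: tlim_def measurable_cong_sets[OF sets_R refl])
qed

text \<open>Both sides are limits of the expected densities of restrictions. This identity makes the
  distribution of \<open>limit_pt\<close> a mixing measure.\<close>

lemma expectation_tlim_limit_pt:
  assumes Q: "valid Q"
  shows "(\<integral>r. tlim Q (limit_pt r) \<partial>R) = t1 Q"
proof -
  have "(\<lambda>N. \<integral>r. hom_t Q (rcode N r) \<partial>R) \<longlonglongrightarrow> (\<integral>r. tlim Q (limit_pt r) \<partial>R)"
    using tlim_limit_pt[OF Q]
    by (intro integral_dominated_convergence[where w = "\<lambda>_. 1"])
      (auto simp: hom_t_rcode_measurable tlim_limit_pt_measurable hom_t_bounds)
  moreover have "(\<lambda>N. \<integral>r. hom_t Q (rcode N r) \<partial>R) \<longlonglongrightarrow> t1 Q"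
  proof (rule Lim_transform2)
    show "(\<lambda>_. t1 Q) \<longlonglongrightarrow> t1 Q" by simp
    show "(\<lambda>N. t1 Q - (\<integral>r. hom_t Q (rcode N r) \<partial>R)) \<longlonglongrightarrow> 0"
    proof (rule Lim_null_comparison)
      show "eventually (\<lambda>N. norm (t1 Q - (\<integral>r. hom_t Q (rcode N r) \<partial>R)) \<le> (real (psize Q))\<^sup>2 * (1 / real N)) sequentially"
        using eventually_gt_at_top[of 0]
      proof eventually_elim
        case (elim N)
        then show ?case using integral_hom_t_near[OF Q, of N] by (simp add: abs_minus_commute)
      qed
      show "(\<lambda>N. (real (psize Q))\<^sup>2 * (1 / real N)) \<longlonglongrightarrow> 0"
        using tendsto_mult_left[OF lim_1_over_n, of "(real (psize Q))\<^sup>2"] by simp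
    qed
  qed
  ultimately show ?thesis by (rule LIMSEQ_unique)
qed

text \<open>If disjoint copies are uncorrelated, the mean square distance of the densities from
  \<open>t1 Q\<close> is at most a constant over \<open>N\<close>; in the constant 5, the second
  moment contributes 3 and the cross term 2. The limit therefore has variance zero.\<close>

lemma AE_tlim_limit_pt_const:
  assumes Q: "valid Q" and ind: "t2 Q = (t1 Q)\<^sup>2"
  shows "AE r in R. tlim Q (limit_pt r) = t1 Q"
proof -
  let ?U = "\<lambda>N r. hom_t Q (rcode N r)" and ?c = "t1 Q" and ?k2 = "(real (psize Q))\<^sup>2"
  have c: "0 \<le> ?c" "?c \<le> 1" by (simp_all add: t1_def)
  have U: "\<bar>?U N r - ?c\<bar> \<le> 1" for N r using hom_t_bounds[of Q "rcode N r"] c by linarith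
  have "(\<lambda>N. \<integral>r. (?U N r - ?c)\<^sup>2 \<partial>R) \<longlonglongrightarrow> (\<integral>r. (tlim Q (limit_pt r) - ?c)\<^sup>2 \<partial>R)"
  proof (rule integral_dominated_convergence[where w = "\<lambda>_. 1"])
    show "AE r in R. (\<lambda>N. (?U N r - ?c)\<^sup>2) \<longlonglongrightarrow> (tlim Q (limit_pt r) - ?c)\<^sup>2"
      using tlim_limit_pt[OF Q] by eventually_elim (intro tendsto_intros)
    show "AE r in R. norm ((?U N r - ?c)\<^sup>2) \<le> 1" for N
      using U by (auto simp: abs_square_le_1)
  qed (auto intro!: borel_measurable_power borel_measurable_diff hom_t_rcode_measurable tlim_limit_pt_measurable)
  moreover have "(\<lambda>N. \<integral>r. (?U N r - ?c)\<^sup>2 \<partial>R) \<longlonglongrightarrow> 0"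
  proof (rule Lim_null_comparison)
    show "eventually (\<lambda>N. norm (\<integral>r. (?U N r - ?c)\<^sup>2 \<partial>R) \<le> 5 * ?k2 * (1 / real N)) sequentially"
      using eventually_gt_at_top[of 0]
    proof eventually_elim
      case (elim N)
      have int: "integrable R (\<lambda>r. ?U N r * ?U N r)"
        by (rule integrable_real_bounded[of _ 1])
          (auto simp: abs_mult hom_t_bounds intro!: mult_le_one borel_measurable_times hom_t_rcode_measurable)
      have "(\<integral>r. (?U N r - ?c)\<^sup>2 \<partial>R) = (\<integral>r. ?U N r * ?U N r + ?c\<^sup>2 - 2 * ?c * ?U N r \<partial>R)"
        by (simp add: power2_eq_square algebra_simps)
      also have "\<dots> = (\<integral>r. ?U N r * ?U N r \<partial>R) + ?c\<^sup>2 - 2 * ?c * (\<integral>r. ?U N r \<partial>R)"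
        using int hom_t_rcode_integrable[of Q N] by (simp add: prob_space[unfolded space_R])
      also have "\<dots> = ((\<integral>r. ?U N r * ?U N r \<partial>R) - t2 Q) - 2 * (?c * ((\<integral>r. ?U N r \<partial>R) - ?c))"
        by (simp add: ind power2_eq_square algebra_simps)
      finally have eq: "(\<integral>r. (?U N r - ?c)\<^sup>2 \<partial>R) = ((\<integral>r. ?U N r * ?U N r \<partial>R) - t2 Q) - 2 * (?c * ((\<integral>r. ?U N r \<partial>R) - ?c))" .
      have "\<bar>?c * ((\<integral>r. ?U N r \<partial>R) - ?c)\<bar> \<le> 1 * (?k2 / real N)"
        unfolding abs_mult using c integral_hom_t_near[OF Q elim] by (intro mult_mono) auto
      moreover have "\<bar>(\<integral>r. ?U N r * ?U N r \<partial>R) - t2 Q\<bar> \<le> 3 * ?k2 / real N"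
        using elim by (intro integral_hom_t_mult_near[OF Q]) auto
      ultimately have "\<bar>\<integral>r. (?U N r - ?c)\<^sup>2 \<partial>R\<bar> \<le> 3 * ?k2 / real N + 2 * (?k2 / real N)"
        unfolding eq by linarith
      then show ?case by simp
    qed
    show "(\<lambda>N. 5 * ?k2 * (1 / real N)) \<longlonglongrightarrow> 0"
      using tendsto_mult_left[OF lim_1_over_n, of "5 * ?k2"] by simp
  qed
  ultimately have 0: "(\<integral>r. (tlim Q (limit_pt r) - ?c)\<^sup>2 \<partial>R) = 0" by (rule LIMSEQ_unique)
  have "AE r in R. 0 \<le> tlim Q (limit_pt r) \<and> tlim Q (limit_pt r) \<le> 1"
    using tlim_limit_pt[OF Q]
  proof eventually_elim
    case (elim r)
    show ?case
      by (intro conjI LIMSEQ_le_const[OF elim] LIMSEQ_le_const2[OF elim] exI[of _ 0] allI impI hom_t_bounds)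
  qed
  then have "AE r in R. norm ((tlim Q (limit_pt r) - ?c)\<^sup>2) \<le> 1"
  proof eventually_elim
    case (elim r)
    then have "\<bar>tlim Q (limit_pt r) - ?c\<bar> \<le> 1" using c by linarith
    then show ?case by (simp add: abs_square_le_1)
  qed
  then have "integrable R (\<lambda>r. (tlim Q (limit_pt r) - ?c)\<^sup>2)"
    by (intro integrable_const_bound[of _ 1])
      (auto intro!: borel_measurable_power borel_measurable_diff tlim_limit_pt_measurable)
  from integral_nonneg_eq_0_iff_AE[OF this] 0 show ?thesis by auto
qed

end

section \<open>Mixtures of poset limits\<close>

lemma Pinf_eqI:
  assumes "p \<in> Pinf" "p' \<in> Pinf" "\<And>Q. valid Q \<Longrightarrow> tlim Q p = tlim Q p'"
  shows "p = p'"
proof (rule prod_eqI)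
  show "fst p = fst p'"
  proof
    fix Q show "fst p Q = fst p' Q"
    proof (cases "valid Q")
      case True
      then show ?thesis using assms(3) by (simp add: tlim_def)
    next
      case False
      then show ?thesis using assms(1,2) Pinf_fst_invalid by (simp add: Pinf_def)
    qed
  qed
  show "snd p = snd p'" using assms Pinf_snd by simp
qed

text \<open>Under sampling from a kernel, disjoint copies are independent, so every coordinate of
  the limit is constant, with the value that \<open>p\<close> prescribes.\<close>

lemma AE_limit_pt_Plaw:
  assumes p: "p \<in> Pinf"
  shows "AE r in Plaw p. limit_pt r = p"
proof -
  interpret exchangeable "Plaw p" by unfold_locales (rule exch_law_Plaw[OF p])
  have t1: "t1 Q = tlim Q p" if "valid Q" for Q
    unfolding t1_def by (rule measure_Plaw_valid[OF p that])
  have t2: "t2 Q = (t1 Q)\<^sup>2" if Q: "valid Q" for Q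
  proof -
    let ?k = "psize Q" and ?S = "set (snd Q)"
    let ?T = "map_prod (\<lambda>i. i + ?k) (\<lambda>i. i + ?k) ` ?S"
    have S: "?S \<subseteq> {..<?k} \<times> {..<?k}" by (rule validD(6)[OF Q])
    have "prob (superrel (?S \<union> ?T)) = prob (superrel ?S) * prob (superrel ?T)"
      using S by (intro measure_Plaw_disjoint[OF p, of "{..<?k}" "{?k..<2 * ?k}"]) auto
    moreover have "prob (superrel ?T) = prob (superrel ?S)"
      by (rule exch_superrel_map[OF exch S]) (auto simp: inj_on_def)
    ultimately show ?thesis by (simp add: t1_def t2_def power2_eq_square)
  qed
  have "AE r in Plaw p. \<forall>Q. valid Q \<longrightarrow> tlim Q (limit_pt r) = t1 Q"
    unfolding AE_all_countable
  proof
    fix Q show "AE r in Plaw p. valid Q \<longrightarrow> tlim Q (limit_pt r) = t1 Q"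
      by (cases "valid Q") (auto dest: AE_tlim_limit_pt_const[OF _ t2])
  qed
  with AE_limit_pt_Pinf show ?thesis
  proof eventually_elim
    case (elim r)
    show ?case by (rule Pinf_eqI[OF elim(1) p]) (simp add: elim(2) t1)
  qed
qed

lemma AE_embed_tendsto_Plaw:
  assumes "p \<in> Pinf"
  shows "AE r in Plaw p. (\<lambda>n. embed (rcode n r)) \<longlonglongrightarrow> p"
proof -
  interpret exchangeable "Plaw p" by unfold_locales (rule exch_law_Plaw[OF assms])
  show ?thesis using AE_embed_tendsto AE_limit_pt_Plaw[OF assms] by eventually_elim simp
qed

lemma sets_Pinf: "Pinf \<in> sets borel"
proof -
  have "countable Pfin" unfolding Pfin_def by (rule countable_image) (rule countableI_type)
  then have "Pfin \<in> sets borel" by (rule sets.countable[rotated]) simp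
  then show ?thesis unfolding Pinf_def Pbar_def by (intro sets.Diff) simp_all
qed

lemma space_PinfM [simp]: "space PinfM = Pinf"
  by (simp add: PinfM_def space_restrict_space)

lemma tlim_measurable: "tlim Q \<in> borel_measurable PinfM"
proof -
  have "(\<lambda>p::pt. fst p Q) \<in> borel_measurable borel"
    by (rule borel_measurable_continuous_onI)
      (rule continuous_on_product_then_coordinatewise[OF continuous_on_fst[OF continuous_on_id]])
  then have "(\<lambda>p::pt. fst p Q) \<in> borel_measurable PinfM"
    unfolding PinfM_def by (rule measurable_restrict_space1)
  moreover have "tlim Q = (\<lambda>p. fst p Q)" by (simp add: fun_eq_iff tlim_def)
  ultimately show ?thesis by simp
qed

lemma measure_Plaw_lposet:
  assumes p: "p \<in> Pinf" and q: "lposet A q"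
  shows "measure (Plaw p) (superrel {(x, y). q x y}) = tlim (lcode A q) p"
  using exch_superrel_lcode[OF exch_law_Plaw[OF p] q] measure_Plaw_valid[OF p valid_lcode[OF q]] by simp

text \<open>It suffices to look at a generator stable under intersection. By transitive closure, the
  probability of containing a finite relation is constantly zero, constantly one, or a coordinate of
  \<open>p\<close>.\<close>

lemma Plaw_measurable: "Plaw \<in> measurable PinfM (prob_algebra Rel)"
proof (rule measurable_prob_algebra_generated[OF sets_Rel_eq_sigma Int_stable_superrel])
  show "{superrel S |S. finite S} \<subseteq> Pow UNIV" by auto
  show "prob_space (Plaw p)" "sets (Plaw p) = sets Rel" if "p \<in> space PinfM" for p
    using that exch_lawD(1,2)[OF exch_law_Plaw] by auto
  fix X assume "X \<in> {superrel S |S. finite S}"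
  then obtain S where S: "X = superrel S" "finite S" by blast
  have eq: "emeasure (Plaw p) X = ennreal (measure (Plaw p) X)" if "p \<in> Pinf" for p
  proof -
    interpret exchangeable "Plaw p" by unfold_locales (rule exch_law_Plaw[OF that])
    show ?thesis by (rule emeasure_eq_measure)
  qed
  have "\<exists>f \<in> borel_measurable PinfM. \<forall>p\<in>Pinf. measure (Plaw p) X = f p"
  proof (cases "acyclic S")
    case False
    then show ?thesis
      using measure_superrel_trancl[OF exch_lawD(1-3)[OF exch_law_Plaw] S(2)]
      by (intro bexI[of _ "\<lambda>_. 0"]) (auto simp: S(1))
  next
    case acyclic: True
    show ?thesis
    proof (cases "S = {}")
      case True
      have "measure (Plaw p) X = 1" if "p \<in> Pinf" for p
      proof -
        interpret exchangeable "Plaw p" by unfold_locales (rule exch_law_Plaw[OF that])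
        have "X = space (Plaw p)" using S True by (auto simp: superrel_def)
        then show ?thesis using prob_space by simp
      qed
      then show ?thesis by (intro bexI[of _ "\<lambda>_. 1"]) auto
    next
      case False
      note l = lposet_trancl[OF S(2) acyclic False]
      have "measure (Plaw p) X = tlim (lcode (Field S) (\<lambda>x y. (x, y) \<in> S\<^sup>+)) p" if "p \<in> Pinf" for p
        using measure_superrel_trancl[OF exch_lawD(1-3)[OF exch_law_Plaw[OF that]] S(2)] acyclic
          measure_Plaw_lposet[OF that l] by (simp add: S(1))
      then show ?thesis using tlim_measurable by (intro bexI[of _ "tlim (lcode (Field S) (\<lambda>x y. (x, y) \<in> S\<^sup>+))"]) auto
    qed
  qed
  then obtain f where f: "f \<in> borel_measurable PinfM" "\<And>p. p \<in> Pinf \<Longrightarrow> measure (Plaw p) X = f p" by blast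
  have "(\<lambda>p. ennreal (f p)) \<in> borel_measurable PinfM" using f(1) by simp
  then show "(\<lambda>p. emeasure (Plaw p) X) \<in> borel_measurable PinfM"
    by (subst measurable_cong[where g = "\<lambda>p. ennreal (f p)"]) (auto simp: eq f(2))
qed

text \<open>A containment event is the disjoint union of the exact patterns on \<open>A\<close> that
  it allows. Patterns that are not strict orders have probability zero, and the others are compared
  by hypothesis.\<close>

lemma lposet_pattern_eqI:
  assumes R1: "exch_law R1" and R2: "exch_law R2"
    and eq: "\<And>A q. lposet A q \<Longrightarrow> measure R1 {r. \<forall>x\<in>A. \<forall>y\<in>A. r (x, y) = q x y} =
      measure R2 {r. \<forall>x\<in>A. \<forall>y\<in>A. r (x, y) = q x y}"
  shows "R1 = R2"
proof (rule Rel_poset_eqI[OF exch_lawD(1-3)[OF R1] exch_lawD(1-3)[OF R2]])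
  fix A q assume q: "lposet A q"
  have A: "finite A" "A \<noteq> {}" "\<And>x y. q x y \<Longrightarrow> x \<in> A \<and> y \<in> A" using q unfolding lposet_def by blast+
  define pat where "pat T = {r. \<forall>x\<in>A. \<forall>y\<in>A. r (x, y) = ((x, y) \<in> T)}" for T :: "(nat \<times> nat) set"
  define D where "D = {T \<in> Pow (A \<times> A). {(x, y). q x y} \<subseteq> T}"
  have un: "superrel {(x, y). q x y} = (\<Union>T\<in>D. pat T)"
  proof (intro set_eqI iffI)
    fix r assume "r \<in> superrel {(x, y). q x y}"
    then have "{(x, y). x \<in> A \<and> y \<in> A \<and> r (x, y)} \<in> D" using A(3) by (auto simp: D_def superrel_def)
    moreover have "r \<in> pat {(x, y). x \<in> A \<and> y \<in> A \<and> r (x, y)}" by (simp add: pat_def)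
    ultimately show "r \<in> (\<Union>T\<in>D. pat T)" by blast
  next
    fix r assume "r \<in> (\<Union>T\<in>D. pat T)"
    then obtain T where T: "T \<subseteq> A \<times> A" "{(x, y). q x y} \<subseteq> T" "r \<in> pat T" by (auto simp: D_def)
    then show "r \<in> superrel {(x, y). q x y}" unfolding superrel_def pat_def by blast
  qed
  have disj: "disjoint_family_on pat D"
    unfolding disjoint_family_on_def
  proof (intro ballI impI)
    fix T T' assume T: "T \<in> D" "T' \<in> D" "T \<noteq> T'"
    then obtain e where "(e \<in> T) \<noteq> (e \<in> T')" by blast
    moreover obtain x y where "e = (x, y)" by (cases e)
    moreover have "T \<subseteq> A \<times> A" "T' \<subseteq> A \<times> A" using T(1,2) by (auto simp: D_def)
    ultimately have xy: "x \<in> A" "y \<in> A" "((x, y) \<in> T) \<noteq> ((x, y) \<in> T')" by auto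
    show "pat T \<inter> pat T' = {}"
    proof (rule ccontr)
      assume "pat T \<inter> pat T' \<noteq> {}"
      then obtain r where "r \<in> pat T" "r \<in> pat T'" by blast
      then have "r (x, y) = ((x, y) \<in> T)" "r (x, y) = ((x, y) \<in> T')" using xy unfolding pat_def by blast+
      then show False using xy(3) by simp
    qed
  qed
  have fin: "finite D" using A(1) by (simp add: D_def)
  have sets_pat: "pat T \<in> sets Rel" for T
  proof -
    have "{r \<in> space Rel. \<forall>x\<in>A. \<forall>y\<in>A. r (x, y) = ((x, y) \<in> T)} \<in> sets Rel" using A(1) by measurable
    then show ?thesis by (simp add: pat_def)
  qed
  have sum: "measure R (superrel {(x, y). q x y}) = (\<Sum>T\<in>D. measure R (pat T))" if "exch_law R" for R
  proof -
    interpret exchangeable R by unfold_locales fact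
    show ?thesis unfolding un
      by (rule finite_measure_finite_Union[OF fin _ disj]) (use sets_pat sets_R in auto)
  qed
  have null: "measure R (pat T) = 0" if R: "exch_law R" and T: "T \<in> D" "\<not> lposet A (\<lambda>x y. (x, y) \<in> T)" for R T
  proof -
    interpret exchangeable R by unfold_locales (rule R)
    have sub: "\<forall>x y. (x, y) \<in> T \<longrightarrow> x \<in> A \<and> y \<in> A" using T(1) by (auto simp: D_def)
    have "AE r in R. r \<in> pat T \<longleftrightarrow> r \<in> {}"
      using exch_lawD(3)[OF R]
    proof eventually_elim
      case (elim r)
      have "r \<notin> pat T"
      proof
        assume "r \<in> pat T"
        then have r: "\<And>x y. x \<in> A \<Longrightarrow> y \<in> A \<Longrightarrow> r (x, y) = ((x, y) \<in> T)" unfolding pat_def by blast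
        have "(x, x) \<notin> T" for x using r[of x x] elim sub unfolding is_poset_N_def by blast
        moreover have "(x, z) \<in> T" if "(x, y) \<in> T" "(y, z) \<in> T" for x y z
        proof -
          have "x \<in> A" "y \<in> A" "z \<in> A" using that sub by blast+
          moreover have "r (x, z)" using elim r that calculation unfolding is_poset_N_def by blast
          ultimately show ?thesis using r by blast
        qed
        ultimately have "lposet A (\<lambda>x y. (x, y) \<in> T)" unfolding lposet_def using A(1,2) sub by blast
        then show False using T(2) by contradiction
      qed
      then show ?case by simp
    qed
    then have "measure R (pat T) = measure R {}"
      using sets_pat sets_R by (intro measure_eq_AE) auto
    then show ?thesis by simp
  qed
  have "measure R1 (pat T) = measure R2 (pat T)" if "T \<in> D" for T
  proof (cases "lposet A (\<lambda>x y. (x, y) \<in> T)")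
    case True
    from eq[OF True] show ?thesis by (simp add: pat_def)
  next
    case False
    then show ?thesis using null[OF R1 that] null[OF R2 that] by simp
  qed
  then show "measure R1 (superrel {(x, y). q x y}) = measure R2 (superrel {(x, y). q x y})"
    unfolding sum[OF R1] sum[OF R2] by (intro sum.cong refl)
qed

lemma tindlim_lposet:
  assumes p: "p \<in> Pinf" and q: "lposet A q"
  shows "tindlim (lcode A q) p = measure (Plaw p) {r. \<forall>x\<in>A. \<forall>y\<in>A. r (x, y) = q x y}"
proof -
  have "finite A" using q unfolding lposet_def by blast
  from exch_pattern_lcode[OF exch_law_Plaw[OF p] this] show ?thesis
    by (simp add: tindlim_eq[OF p valid_lcode[OF q]] psize_lcode)
qed

text \<open>Every value lies in \<open>Pinf\<close> when that set is nonempty, so this is a random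
  element of \<open>PinfM\<close>. Under an exchangeable law the arbitrary value is taken on a null
  set only.\<close>

definition clipped_limit :: "nrel \<Rightarrow> pt" where
  "clipped_limit r = (if limit_pt r \<in> Pinf then limit_pt r else (SOME p. p \<in> Pinf))"

lemma clipped_limit_measurable:
  assumes "Pinf \<noteq> {}"
  shows "clipped_limit \<in> measurable Rel PinfM"
  unfolding PinfM_def
proof (rule measurable_restrict_space2)
  have some: "(SOME p. p \<in> Pinf) \<in> Pinf" using assms by (simp add: some_in_eq)
  then show "clipped_limit \<in> space Rel \<rightarrow> Pinf" by (auto simp: clipped_limit_def)
  have "{r \<in> space Rel. limit_pt r \<in> Pinf} \<in> sets Rel"
    using measurable_sets[OF limit_pt_measurable sets_Pinf] by (simp add: vimage_def)
  then show "clipped_limit \<in> measurable Rel borel"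
    unfolding clipped_limit_def using limit_pt_measurable by (intro measurable_If) auto
qed

text \<open>Both mixing measures and exchangeable laws are recovered through \<open>clipped_limit\<close>,
  the almost sure limit of the finite restrictions.\<close>

locale mixture =
  fixes \<nu> :: "pt measure"
  assumes prob_\<nu>: "prob_space \<nu>" and sets_\<nu>: "sets \<nu> = sets PinfM"
begin

sublocale N: prob_space \<nu> by (rule prob_\<nu>)

lemma space_\<nu>: "space \<nu> = Pinf"
  using sets_eq_imp_space_eq[OF sets_\<nu>] by simp

lemma Pinf_nonempty: "Pinf \<noteq> {}"
  using N.not_empty by (simp add: space_\<nu>)

lemma Plaw_measurable_\<nu>: "Plaw \<in> measurable \<nu> (subprob_algebra Rel)"
  using measurable_prob_algebraD[OF Plaw_measurable] by (simp add: measurable_cong_sets[OF sets_\<nu> refl])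

abbreviation mix :: "nrel measure" where "mix \<equiv> bind \<nu> Plaw"

lemma sets_mix: "sets mix = sets Rel"
  using exch_lawD(2)[OF exch_law_Plaw] by (intro sets_bind) (auto simp: space_\<nu> Pinf_nonempty)

lemma prob_space_mix: "prob_space mix"
proof (rule N.prob_space_bind[OF _ Plaw_measurable_\<nu>])
  show "AE p in \<nu>. prob_space (Plaw p)"
    using exch_lawD(1)[OF exch_law_Plaw] by (intro AE_I2) (simp add: space_\<nu>)
qed

lemma measure_Plaw_measurable:
  assumes "X \<in> sets Rel"
  shows "(\<lambda>p. measure (Plaw p) X) \<in> borel_measurable \<nu>"
  using measurable_compose[OF Plaw_measurable_\<nu> measurable_measure_subprob_algebra[OF assms]] .

lemma measure_mix:
  assumes X: "X \<in> sets Rel"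
  shows "measure mix X = (\<integral>p. measure (Plaw p) X \<partial>\<nu>)"
proof -
  have p: "prob_space (Plaw p)" if "p \<in> space \<nu>" for p
    using that exch_lawD(1)[OF exch_law_Plaw] by (simp add: space_\<nu>)
  have "emeasure mix X = (\<integral>\<^sup>+p. emeasure (Plaw p) X \<partial>\<nu>)"
    using X Plaw_measurable_\<nu> N.not_empty by (intro emeasure_bind) auto
  also have "\<dots> = (\<integral>\<^sup>+p. ennreal (measure (Plaw p) X) \<partial>\<nu>)"
    by (intro nn_integral_cong finite_measure.emeasure_eq_measure prob_space.finite_measure p)
  also have "\<dots> = ennreal (\<integral>p. measure (Plaw p) X \<partial>\<nu>)"
    using measure_Plaw_measurable[OF X] prob_space.prob_le_1[OF p]
    by (intro nn_integral_eq_integral N.integrable_real_bounded[of _ 1]) auto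
  finally show ?thesis by (simp add: measure_def integral_nonneg_AE)
qed

lemma AE_mix:
  assumes "Measurable.pred Rel P"
  shows "(AE r in mix. P r) \<longleftrightarrow> (AE p in \<nu>. AE r in Plaw p. P r)"
  by (rule AE_bind[OF Plaw_measurable_\<nu> assms])

lemma exch_law_mix: "exch_law mix"
  unfolding exch_law_def
proof (intro conjI allI impI prob_space_mix sets_mix)
  show "AE r in mix. is_poset_N r"
    unfolding AE_mix[OF pred_is_poset_N] using exch_lawD(3)[OF exch_law_Plaw]
    by (rule AE_I2) (simp add: space_\<nu>)
  fix \<pi> :: "nat \<Rightarrow> nat" assume \<pi>: "bij \<pi>"
  have m: "(\<lambda>r (i, j). r (\<pi> i, \<pi> j)) \<in> measurable mix Rel"
    using measurable_relabel by (simp add: measurable_cong_sets[OF sets_mix refl])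
  have space: "space mix = UNIV" using sets_eq_imp_space_eq[OF sets_mix] by simp
  show "distr mix Rel (\<lambda>r (i, j). r (\<pi> i, \<pi> j)) = mix"
  proof (rule Rel_eqI)
    show "prob_space (distr mix Rel (\<lambda>r (i, j). r (\<pi> i, \<pi> j)))"
      by (rule prob_space.prob_space_distr[OF prob_space_mix m])
    fix S :: "(nat \<times> nat) set" assume S: "finite S"
    have "measure (distr mix Rel (\<lambda>r (i, j). r (\<pi> i, \<pi> j))) (superrel S) = measure mix (superrel (map_prod \<pi> \<pi> ` S))"
      using space by (simp add: measure_distr[OF m sets_superrel[OF S]] vimage_relabel)
    also have "\<dots> = (\<integral>p. measure (Plaw p) (superrel (map_prod \<pi> \<pi> ` S)) \<partial>\<nu>)"
      using S by (intro measure_mix sets_superrel) auto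
    also have "\<dots> = (\<integral>p. measure (Plaw p) (superrel S) \<partial>\<nu>)"
    proof (rule Bochner_Integration.integral_cong[OF refl])
      fix p assume "p \<in> space \<nu>"
      then show "measure (Plaw p) (superrel (map_prod \<pi> \<pi> ` S)) = measure (Plaw p) (superrel S)"
        using exch_measure_relabel[OF exch_law_Plaw \<pi> sets_superrel[OF S], of p] by (simp add: space_\<nu> vimage_relabel)
    qed
    also have "\<dots> = measure mix (superrel S)"
      using S by (intro measure_mix[symmetric] sets_superrel)
    finally show "measure (distr mix Rel (\<lambda>r (i, j). r (\<pi> i, \<pi> j))) (superrel S) = measure mix (superrel S)" .
  qed (auto simp: prob_space_mix sets_mix)
qed

lemma measure_mix_lposet:
  assumes q: "lposet A q"
  shows "measure mix (superrel {(x, y). q x y}) = (\<integral>p. tlim (lcode A q) p \<partial>\<nu>)"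
proof -
  have "{(x, y). q x y} \<subseteq> A \<times> A" "finite A" using q unfolding lposet_def by auto
  then have "finite {(x, y). q x y}" by (auto dest: finite_subset)
  then have "measure mix (superrel {(x, y). q x y}) = (\<integral>p. measure (Plaw p) (superrel {(x, y). q x y}) \<partial>\<nu>)"
    by (intro measure_mix sets_superrel)
  also have "\<dots> = (\<integral>p. tlim (lcode A q) p \<partial>\<nu>)"
    by (rule Bochner_Integration.integral_cong[OF refl]) (simp add: space_\<nu> measure_Plaw_lposet[OF _ q])
  finally show ?thesis .
qed

lemma measure_mix_pattern:
  assumes q: "lposet A q"
  shows "measure mix {r. \<forall>x\<in>A. \<forall>y\<in>A. r (x, y) = q x y} = (\<integral>p. tindlim (lcode A q) p \<partial>\<nu>)"
proof -
  have "finite A" using q unfolding lposet_def by blast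
  then have "{r \<in> space Rel. \<forall>x\<in>A. \<forall>y\<in>A. r (x, y) = q x y} \<in> sets Rel" by measurable
  then have "measure mix {r. \<forall>x\<in>A. \<forall>y\<in>A. r (x, y) = q x y} =
    (\<integral>p. measure (Plaw p) {r. \<forall>x\<in>A. \<forall>y\<in>A. r (x, y) = q x y} \<partial>\<nu>)"
    by (intro measure_mix) simp
  also have "\<dots> = (\<integral>p. tindlim (lcode A q) p \<partial>\<nu>)"
    by (rule Bochner_Integration.integral_cong[OF refl]) (simp add: space_\<nu> tindlim_lposet[OF _ q])
  finally show ?thesis .
qed

text \<open>Under \<open>Plaw p\<close> the limit is almost surely \<open>p\<close>, so the
  distribution of the limit under the mixture is the mixing measure. This provides a left inverse of
  mixing.\<close>

lemma distr_clipped_limit: "distr mix PinfM clipped_limit = \<nu>"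
proof (rule measure_eqI)
  show "sets (distr mix PinfM clipped_limit) = sets \<nu>" by (simp add: sets_\<nu>)
  have m: "clipped_limit \<in> measurable mix PinfM"
    using clipped_limit_measurable[OF Pinf_nonempty] by (simp add: measurable_cong_sets[OF sets_mix refl])
  have space: "space mix = UNIV" using sets_eq_imp_space_eq[OF sets_mix] by simp
  fix B assume "B \<in> sets (distr mix PinfM clipped_limit)"
  then have B: "B \<in> sets PinfM" by simp
  have X: "clipped_limit -` B \<in> sets Rel"
    using measurable_sets[OF clipped_limit_measurable[OF Pinf_nonempty] B] by simp
  have "measure mix (clipped_limit -` B) = (\<integral>p. measure (Plaw p) (clipped_limit -` B) \<partial>\<nu>)"
    by (rule measure_mix[OF X])
  also have "\<dots> = (\<integral>p. indicator B p \<partial>\<nu>)"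
  proof (rule Bochner_Integration.integral_cong[OF refl])
    fix p assume "p \<in> space \<nu>"
    then have p: "p \<in> Pinf" by (simp add: space_\<nu>)
    interpret exchangeable "Plaw p" by unfold_locales (rule exch_law_Plaw[OF p])
    have "AE r in Plaw p. r \<in> clipped_limit -` B \<longleftrightarrow> r \<in> (if p \<in> B then UNIV else {})"
      using AE_limit_pt_Plaw[OF p] by eventually_elim (auto simp: clipped_limit_def p)
    then have "prob (clipped_limit -` B) = prob (if p \<in> B then UNIV else {})"
      using X sets.top[of "Plaw p"] by (intro measure_eq_AE) (auto simp: sets_R)
    then show "prob (clipped_limit -` B) = indicator B p"
      using prob_space by (auto simp: indicator_def)
  qed
  also have "\<dots> = measure \<nu> B"
    using B sets.sets_into_space[OF B] by (simp add: sets_\<nu> space_\<nu> Int_absorb2)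
  finally have eq: "measure mix (clipped_limit -` B) = measure \<nu> B" .
  have "emeasure (distr mix PinfM clipped_limit) B = emeasure mix (clipped_limit -` B)"
    using emeasure_distr[OF m B] space by simp
  also have "\<dots> = ennreal (measure mix (clipped_limit -` B))"
    by (rule finite_measure.emeasure_eq_measure[OF prob_space.finite_measure[OF prob_space_mix]])
  also have "\<dots> = emeasure \<nu> B"
    unfolding eq by (rule N.emeasure_eq_measure[symmetric])
  finally show "emeasure (distr mix PinfM clipped_limit) B = emeasure \<nu> B" .
qed

lemma conv_distr_mix: "conv_distr (\<lambda>n r. embed (rcode n r)) mix \<nu>"
  unfolding conv_distr_def
proof (intro allI impI)
  fix f :: "pt \<Rightarrow> real" assume f: "continuous_on Pbar f"
  interpret E: exchangeable mix by unfold_locales (rule exch_law_mix)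
  \<comment> \<open>\<open>f\<close> is only known to be continuous on \<open>Pbar\<close>;
    compactness of \<open>Pbar\<close> supplies the bound for dominated convergence.\<close>
  have Pbar_box: "Pbar \<subseteq> PiE UNIV (\<lambda>_. {0..1}) \<times> {0..1}"
    unfolding Pbar_def
  proof (rule closure_minimal)
    show "Pfin \<subseteq> PiE UNIV (\<lambda>_. {0..1}) \<times> {0..1}"
      by (auto simp: Pfin_def embed_def hom_t_bounds divide_le_eq_1 dest: validD(1))
    show "closed (PiE UNIV (\<lambda>_. {0..1::real}) \<times> {0..1::real} :: pt set)"
      by (intro compact_imp_closed compact_Times compact_PiE_unit) auto
  qed
  have "compact Pbar"
    using compact_Int_closed[OF compact_Times[OF compact_PiE_unit compact_Icc[of 0 1]], of Pbar] Pbar_box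
    by (simp add: Int_absorb1 Pbar_def)
  then have "bounded (f ` Pbar)" by (intro compact_imp_bounded compact_continuous_image f)
  then obtain b where b: "\<And>p. p \<in> Pbar \<Longrightarrow> \<bar>f p\<bar> \<le> b" unfolding bounded_real by auto
  have f_meas: "f \<in> borel_measurable PinfM"
    unfolding PinfM_def
    by (rule borel_measurable_continuous_on_restrict[OF continuous_on_subset[OF f]]) (simp add: Pinf_def)
  have clip_meas: "clipped_limit \<in> measurable mix PinfM"
    using clipped_limit_measurable[OF Pinf_nonempty] by (simp add: measurable_cong_sets[OF sets_mix refl])
  \<comment> \<open>The index is shifted because the restriction to the empty set is not
    \<open>valid\<close>, and outside \<open>Pbar\<close> nothing is known about
    \<open>f\<close>.\<close>
  have in_Pbar: "AE r in mix. \<forall>n. embed (rcode (Suc n) r) \<in> Pbar"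
    using exch_lawD(3)[OF exch_law_mix]
  proof eventually_elim
    case (elim r)
    show ?case
    proof
      fix n
      have "embed (rcode (Suc n) r) \<in> Pfin" using valid_rcode[OF elim, of "Suc n"] by (auto simp: Pfin_def)
      then show "embed (rcode (Suc n) r) \<in> Pbar" unfolding Pbar_def using closure_subset by blast
    qed
  qed
  have "(\<lambda>n. \<integral>r. f (embed (rcode (Suc n) r)) \<partial>mix) \<longlonglongrightarrow> (\<integral>r. f (clipped_limit r) \<partial>mix)"
  proof (rule integral_dominated_convergence[where w = "\<lambda>_. b"])
    show "(\<lambda>r. f (clipped_limit r)) \<in> borel_measurable mix"
      by (rule measurable_compose[OF clip_meas f_meas])
    show "(\<lambda>r. f (embed (rcode (Suc n) r))) \<in> borel_measurable mix" for n
      using measurable_compose[OF measurable_rcode, of "\<lambda>c. f (embed c)" borel "Suc n"]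
      by (simp add: measurable_cong_sets[OF sets_mix refl])
    show "AE r in mix. (\<lambda>n. f (embed (rcode (Suc n) r))) \<longlonglongrightarrow> f (clipped_limit r)"
      using in_Pbar E.AE_embed_tendsto E.AE_limit_pt_Pinf
    proof eventually_elim
      case (elim r)
      have "(\<lambda>n. embed (rcode (Suc n) r)) \<longlonglongrightarrow> limit_pt r" by (rule LIMSEQ_Suc[OF elim(2)])
      moreover have "limit_pt r \<in> Pbar" "clipped_limit r = limit_pt r"
        using elim(3) by (simp_all add: Pinf_def clipped_limit_def)
      ultimately show ?case
        using continuous_on_tendsto_compose[OF f, of "\<lambda>n. embed (rcode (Suc n) r)" "limit_pt r" sequentially] elim(1)
        by simp
    qed
    show "AE r in mix. norm (f (embed (rcode (Suc n) r))) \<le> b" for n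
      using in_Pbar by eventually_elim (simp add: b)
  qed simp
  also have "(\<integral>r. f (clipped_limit r) \<partial>mix) = (\<integral>p. f p \<partial>\<nu>)"
    using integral_distr[OF clip_meas f_meas] by (simp add: distr_clipped_limit)
  finally show "(\<lambda>n. \<integral>r. f (embed (rcode n r)) \<partial>mix) \<longlonglongrightarrow> (\<integral>p. f p \<partial>\<nu>)"
    by (rule LIMSEQ_imp_Suc)
qed

end

lemma exch_law_is_mixture:
  assumes R: "exch_law R"
  obtains \<nu> where "prob_space \<nu>" "sets \<nu> = sets PinfM" "R = bind \<nu> Plaw"
proof -
  interpret exchangeable R by unfold_locales (rule R)
  \<comment> \<open>An exchangeable law has its limit in \<open>Pinf\<close> almost surely, so
    \<open>Pinf\<close> has a point that can serve as the default in
    \<open>clipped_limit\<close>.\<close>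
  have ne: "Pinf \<noteq> {}"
  proof
    assume "Pinf = {}"
    then have "AE r in R. False" using AE_limit_pt_Pinf by simp
    then show False by simp
  qed
  have m: "clipped_limit \<in> measurable R PinfM"
    using clipped_limit_measurable[OF ne] by (simp add: measurable_cong_sets[OF sets_R refl])
  define \<nu> where "\<nu> = distr R PinfM clipped_limit"
  interpret M: mixture \<nu>
    by (rule mixture.intro) (simp_all add: \<nu>_def prob_space_distr m)
  have "R = bind \<nu> Plaw"
  proof (rule Rel_poset_eqI[OF exch_lawD(1-3)[OF R] exch_lawD(1-3)[OF M.exch_law_mix]])
    fix A q assume q: "lposet A q"
    have "measure R (superrel {(x, y). q x y}) = t1 (lcode A q)"
      unfolding t1_def by (rule exch_superrel_lcode[OF R q])
    also have "\<dots> = (\<integral>r. tlim (lcode A q) (limit_pt r) \<partial>R)"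
      by (rule expectation_tlim_limit_pt[OF valid_lcode[OF q], symmetric])
    also have "\<dots> = (\<integral>r. tlim (lcode A q) (clipped_limit r) \<partial>R)"
      using AE_limit_pt_Pinf tlim_limit_pt_measurable measurable_compose[OF m tlim_measurable]
      by (intro integral_cong_AE) (auto elim!: eventually_mono simp: clipped_limit_def)
    also have "\<dots> = (\<integral>p. tlim (lcode A q) p \<partial>\<nu>)"
      unfolding \<nu>_def by (rule integral_distr[OF m tlim_measurable, symmetric])
    also have "\<dots> = measure (bind \<nu> Plaw) (superrel {(x, y). q x y})"
      by (rule M.measure_mix_lposet[OF q, symmetric])
    finally show "measure R (superrel {(x, y). q x y}) = measure (bind \<nu> Plaw) (superrel {(x, y). q x y})" .
  qed
  then show ?thesis using that M.prob_\<nu> M.sets_\<nu> by blast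
qed

lemma bij_betw_mixture: "bij_betw (\<lambda>\<nu>. bind \<nu> Plaw) {\<nu>. prob_space \<nu> \<and> sets \<nu> = sets PinfM} {R. exch_law R}"
proof (rule bij_betw_imageI)
  show "inj_on (\<lambda>\<nu>. bind \<nu> Plaw) {\<nu>. prob_space \<nu> \<and> sets \<nu> = sets PinfM}"
  proof (rule inj_on_inverseI)
    fix \<nu> assume "\<nu> \<in> {\<nu>. prob_space \<nu> \<and> sets \<nu> = sets PinfM}"
    then interpret mixture \<nu> by (intro mixture.intro) auto
    show "distr mix PinfM clipped_limit = \<nu>" by (rule distr_clipped_limit)
  qed
  show "(\<lambda>\<nu>. bind \<nu> Plaw) ` {\<nu>. prob_space \<nu> \<and> sets \<nu> = sets PinfM} = {R. exch_law R}"
  proof (intro set_eqI iffI)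
    fix R assume "R \<in> (\<lambda>\<nu>. bind \<nu> Plaw) ` {\<nu>. prob_space \<nu> \<and> sets \<nu> = sets PinfM}"
    then obtain \<nu> where \<nu>: "prob_space \<nu>" "sets \<nu> = sets PinfM" "R = bind \<nu> Plaw" by blast
    then interpret mixture \<nu> by (intro mixture.intro)
    show "R \<in> {R. exch_law R}" using exch_law_mix \<nu>(3) by simp
  next
    fix R assume "R \<in> {R. exch_law R}"
    then obtain \<nu> where "prob_space \<nu>" "sets \<nu> = sets PinfM" "R = bind \<nu> Plaw"
      using exch_law_is_mixture[of R] by auto
    then show "R \<in> (\<lambda>\<nu>. bind \<nu> Plaw) ` {\<nu>. prob_space \<nu> \<and> sets \<nu> = sets PinfM}" by blast
  qed
qed

section \<open>Extreme laws and point masses\<close>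

lemma Plaw_inj:
  assumes "p \<in> Pinf" "p' \<in> Pinf" "Plaw p = Plaw p'"
  shows "p = p'"
proof (rule Pinf_eqI[OF assms(1,2)])
  fix Q assume "valid Q"
  then show "tlim Q p = tlim Q p'"
    using measure_Plaw_valid[OF assms(1), of Q] measure_Plaw_valid[OF assms(2), of Q] assms(3) by simp
qed

text \<open>The event that the limit differs from \<open>p\<close> is null for the combination,
  hence for both components. An exchangeable law whose limit is almost surely \<open>p\<close> has
  the containment probabilities of \<open>Plaw p\<close>.\<close>

lemma extreme_exch_Plaw:
  assumes p: "p \<in> Pinf"
  shows "extreme_exch (Plaw p)"
  unfolding extreme_exch_def
proof (intro conjI allI impI exch_law_Plaw[OF p])
  fix R1 R2 and a :: real
  assume R: "exch_law R1" "exch_law R2" and a: "0 < a" "a < 1"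
    and mix: "\<forall>A\<in>sets Rel. emeasure (Plaw p) A = ennreal a * emeasure R1 A + ennreal (1 - a) * emeasure R2 A"
  interpret P: exchangeable "Plaw p" by unfold_locales (rule exch_law_Plaw[OF p])
  have Z: "{r. limit_pt r \<noteq> p} \<in> sets Rel"
  proof -
    have "limit_pt -` (- {p}) \<inter> space Rel \<in> sets Rel"
      by (rule measurable_sets[OF limit_pt_measurable]) (simp add: borel_comp)
    then show ?thesis by (simp add: vimage_def)
  qed
  have "emeasure (Plaw p) {r. limit_pt r \<noteq> p} = 0"
    using AE_limit_pt_Plaw[OF p] Z by (subst (asm) AE_iff_measurable[where N = "{r. limit_pt r \<noteq> p}"]) (auto simp: P.sets_R)
  then have 0: "ennreal a * emeasure R1 {r. limit_pt r \<noteq> p} = 0" "ennreal (1 - a) * emeasure R2 {r. limit_pt r \<noteq> p} = 0"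
    using mix[rule_format, OF Z] by auto
  have "R' = Plaw p" if R': "exch_law R'" and c: "0 < c" "ennreal c * emeasure R' {r. limit_pt r \<noteq> p} = 0" for R' c
  proof -
    interpret exchangeable R' by unfold_locales (rule R')
    have "emeasure R' {r. limit_pt r \<noteq> p} = 0" using c by (auto simp: ennreal_eq_0_iff)
    then have AE: "AE r in R'. limit_pt r = p"
      using Z by (subst AE_iff_measurable[where N = "{r. limit_pt r \<noteq> p}"]) (auto simp: sets_R)
    show ?thesis
    proof (rule Rel_poset_eqI[OF exch_lawD(1-3)[OF R'] exch_lawD(1-3)[OF exch_law_Plaw[OF p]]])
      fix A q assume q: "lposet A q"
      have "measure R' (superrel {(x, y). q x y}) = (\<integral>r. tlim (lcode A q) (limit_pt r) \<partial>R')"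
        using exch_superrel_lcode[OF R' q] expectation_tlim_limit_pt[OF valid_lcode[OF q]] by (simp add: t1_def)
      also have "\<dots> = (\<integral>r. tlim (lcode A q) p \<partial>R')"
        using AE tlim_limit_pt_measurable by (intro integral_cong_AE) (auto elim!: eventually_mono)
      also have "\<dots> = measure (Plaw p) (superrel {(x, y). q x y})"
        using measure_Plaw_lposet[OF p q] prob_space by simp
      finally show "measure R' (superrel {(x, y). q x y}) = measure (Plaw p) (superrel {(x, y). q x y})" .
    qed
  qed
  from this[OF R(1) a(1) 0(1)] this[OF R(2) _ 0(2)] a show "R1 = R2" by simp
qed

text \<open>If an event had intermediate probability under the mixing measure, conditioning on it and on its complement
  would split the mixture.\<close>

lemma extreme_exch_zero_one:
  assumes \<nu>: "prob_space \<nu>" "sets \<nu> = sets PinfM" and ext: "extreme_exch (bind \<nu> Plaw)" and B: "B \<in> sets PinfM"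
  shows "measure \<nu> B = 0 \<or> measure \<nu> B = 1"
proof (rule ccontr)
  assume ne: "\<not> (measure \<nu> B = 0 \<or> measure \<nu> B = 1)"
  interpret M: mixture \<nu> by (rule mixture.intro[OF \<nu>(1,2)])
  define a where "a = measure \<nu> B"
  have a: "0 < a" "a < 1"
    using ne M.N.prob_le_1[of B] measure_nonneg[of \<nu> B] by (auto simp: a_def less_le)
  define C where "C = space \<nu> - B"
  have B': "B \<in> sets \<nu>" "C \<in> sets \<nu>" using B \<nu>(2) by (auto simp: C_def)
  have mC: "measure \<nu> C = 1 - a" using B' by (simp add: C_def a_def M.N.prob_compl)
  define \<nu>1 where "\<nu>1 = uniform_measure \<nu> B"
  define \<nu>2 where "\<nu>2 = uniform_measure \<nu> C"
  have eB: "emeasure \<nu> B = ennreal a" "emeasure \<nu> C = ennreal (1 - a)"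
    by (simp_all add: M.N.emeasure_eq_measure a_def mC[unfolded a_def])
  interpret M1: mixture \<nu>1
    unfolding \<nu>1_def using a eB by (intro mixture.intro prob_space_uniform_measure) (simp_all add: \<nu>(2))
  interpret M2: mixture \<nu>2
    unfolding \<nu>2_def using a eB by (intro mixture.intro prob_space_uniform_measure) (simp_all add: \<nu>(2))
  have split: "emeasure M.mix X = ennreal a * emeasure M1.mix X + ennreal (1 - a) * emeasure M2.mix X" if X: "X \<in> sets Rel" for X
  proof -
    have f: "(\<lambda>p. emeasure (Plaw p) X) \<in> borel_measurable \<nu>"
      using measurable_compose[OF M.Plaw_measurable_\<nu> measurable_emeasure_subprob_algebra[OF X]] .
    have cond: "ennreal c * (\<integral>\<^sup>+p. emeasure (Plaw p) X \<partial>uniform_measure \<nu> D) = (\<integral>\<^sup>+p. emeasure (Plaw p) X * indicator D p \<partial>\<nu>)"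
      if "D \<in> sets \<nu>" "emeasure \<nu> D = ennreal c" "0 < c" for D c
    proof -
      have "ennreal c * (x / ennreal c) = x" for x
        using that(3) by (simp add: ennreal_times_divide mult_divide_eq_ennreal mult.commute)
      then show ?thesis using that f by (simp add: nn_integral_uniform_measure)
    qed
    have "emeasure M.mix X = (\<integral>\<^sup>+p. emeasure (Plaw p) X \<partial>\<nu>)"
      using X M.Plaw_measurable_\<nu> M.N.not_empty by (intro emeasure_bind) auto
    also have "\<dots> = (\<integral>\<^sup>+p. emeasure (Plaw p) X * indicator B p + emeasure (Plaw p) X * indicator C p \<partial>\<nu>)"
      by (intro nn_integral_cong) (auto simp: C_def indicator_def)
    also have "\<dots> = (\<integral>\<^sup>+p. emeasure (Plaw p) X * indicator B p \<partial>\<nu>) + (\<integral>\<^sup>+p. emeasure (Plaw p) X * indicator C p \<partial>\<nu>)"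
      using f B' by (intro nn_integral_add) auto
    also have "\<dots> = ennreal a * (\<integral>\<^sup>+p. emeasure (Plaw p) X \<partial>\<nu>1) + ennreal (1 - a) * (\<integral>\<^sup>+p. emeasure (Plaw p) X \<partial>\<nu>2)"
      unfolding \<nu>1_def \<nu>2_def using cond[OF B'(1) eB(1) a(1)] cond[OF B'(2) eB(2)] a by simp
    also have "(\<integral>\<^sup>+p. emeasure (Plaw p) X \<partial>\<nu>1) = emeasure M1.mix X"
      using X M1.Plaw_measurable_\<nu> M1.N.not_empty by (intro emeasure_bind[symmetric]) auto
    also have "(\<integral>\<^sup>+p. emeasure (Plaw p) X \<partial>\<nu>2) = emeasure M2.mix X"
      using X M2.Plaw_measurable_\<nu> M2.N.not_empty by (intro emeasure_bind[symmetric]) auto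
    finally show ?thesis .
  qed
  \<comment> \<open>Extremality forces the two conditioned mixtures to agree. Mixing is injective,
    so the two conditioned measures agree as well, although they differ on \<open>B\<close>.\<close>
  have mix_eq: "M1.mix = M2.mix"
    using ext M1.exch_law_mix M2.exch_law_mix a split unfolding extreme_exch_def by blast
  have "distr M1.mix PinfM clipped_limit = distr M2.mix PinfM clipped_limit"
    by (rule arg_cong[OF mix_eq])
  then have "\<nu>1 = \<nu>2"
    unfolding M1.distr_clipped_limit M2.distr_clipped_limit .
  then have "emeasure \<nu>1 B = emeasure \<nu>2 B" by (rule arg_cong)
  moreover have "emeasure \<nu>1 B = 1"
    unfolding \<nu>1_def by (rule emeasure_uniform_measure_1) (use a eB B' in auto)
  moreover have "emeasure \<nu>2 B = 0"
  proof -
    have "C \<inter> B = {}" by (auto simp: C_def)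
    then show ?thesis unfolding \<nu>2_def using B' by (simp add: emeasure_uniform_measure)
  qed
  ultimately show False by (metis zero_neq_one)
qed

text \<open>A point of \<open>Pinf\<close> is determined by countably many coordinates, so it
  suffices that each coordinate is almost surely constant under the mixing measure.\<close>

lemma extreme_exch_imp_Plaw:
  assumes ext: "extreme_exch R"
  shows "\<exists>p\<in>Pinf. R = Plaw p"
proof -
  have "exch_law R" using ext by (simp add: extreme_exch_def)
  then obtain \<nu> where \<nu>: "prob_space \<nu>" "sets \<nu> = sets PinfM" "R = bind \<nu> Plaw" by (rule exch_law_is_mixture)
  interpret M: mixture \<nu> by (rule mixture.intro[OF \<nu>(1,2)])
  have zero_one: "measure \<nu> B = 0 \<or> measure \<nu> B = 1" if "B \<in> sets PinfM" for B
    using extreme_exch_zero_one[OF \<nu>(1,2) _ that] ext \<nu>(3) by simp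
  have AE01: "(AE p in \<nu>. \<not> P p) \<or> (AE p in \<nu>. P p)" if "{p \<in> space \<nu>. P p} \<in> sets \<nu>" for P
  proof -
    have "measure \<nu> {p \<in> space \<nu>. P p} = 0 \<or> measure \<nu> {p \<in> space \<nu>. P p} = 1"
      using zero_one that \<nu>(2) by simp
    then show ?thesis
    proof
      assume "measure \<nu> {p \<in> space \<nu>. P p} = 1"
      then show ?thesis using M.N.AE_prob_1[of "{p \<in> space \<nu>. P p}"] by (auto elim!: eventually_mono)
    next
      assume "measure \<nu> {p \<in> space \<nu>. P p} = 0"
      then have "emeasure \<nu> {p \<in> space \<nu>. P p} = 0" by (simp add: M.N.emeasure_eq_measure)
      then have "AE p in \<nu>. \<not> P p"
        using that by (intro AE_I[of _ _ "{p \<in> space \<nu>. P p}"]) auto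
      then show ?thesis ..
    qed
  qed
  have tl_meas: "tlim Q \<in> borel_measurable \<nu>" for Q
    using tlim_measurable by (simp add: measurable_cong_sets[OF \<nu>(2) refl])
  have tl_bounds: "0 \<le> tlim Q p \<and> tlim Q p \<le> 1" if p: "p \<in> Pinf" and Q: "valid Q" for p Q
  proof -
    interpret exchangeable "Plaw p" by unfold_locales (rule exch_law_Plaw[OF p])
    show ?thesis using measure_Plaw_valid[OF p Q] prob_le_1 measure_nonneg by metis
  qed
  define c where "c Q = (\<integral>p. tlim Q p \<partial>\<nu>)" for Q
  \<comment> \<open>By the zero-one law, lying strictly above the mean has probability zero or one;
    it cannot be one, and the same holds for lying strictly below.\<close>
  have const: "AE p in \<nu>. tlim Q p = c Q" if Q: "valid Q" for Q
  proof -
    have int: "integrable \<nu> (tlim Q)"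
      using tl_bounds[OF _ Q] by (intro M.N.integrable_real_bounded[of _ 1] tl_meas) (auto simp: M.space_\<nu>)
    have pos: "\<not> (AE p in \<nu>. 0 < h p)" if h: "integrable \<nu> h" "(\<integral>p. h p \<partial>\<nu>) = 0" for h :: "pt \<Rightarrow> real"
    proof
      assume ae: "AE p in \<nu>. 0 < h p"
      then have "AE p in \<nu>. 0 \<le> h p" by eventually_elim simp
      then have "AE p in \<nu>. h p = 0" using integral_nonneg_eq_0_iff_AE[OF h(1)] h(2) by simp
      with ae have "AE p in \<nu>. False" by eventually_elim simp
      then show False by simp
    qed
    have "\<not> (AE p in \<nu>. 0 < tlim Q p - c Q)" "\<not> (AE p in \<nu>. 0 < c Q - tlim Q p)"
      using int by (intro pos; simp add: c_def M.N.prob_space)+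
    moreover have "{p \<in> space \<nu>. 0 < tlim Q p - c Q} \<in> sets \<nu>" "{p \<in> space \<nu>. 0 < c Q - tlim Q p} \<in> sets \<nu>"
      using tl_meas[of Q] by measurable
    ultimately have "AE p in \<nu>. \<not> 0 < tlim Q p - c Q" "AE p in \<nu>. \<not> 0 < c Q - tlim Q p"
      using AE01[of "\<lambda>p. 0 < tlim Q p - c Q"] AE01[of "\<lambda>p. 0 < c Q - tlim Q p"] by blast+
    then show ?thesis by eventually_elim simp
  qed
  have "AE p in \<nu>. \<forall>Q. valid Q \<longrightarrow> tlim Q p = c Q"
    unfolding AE_all_countable
  proof
    fix Q show "AE p in \<nu>. valid Q \<longrightarrow> tlim Q p = c Q"
      by (cases "valid Q") (auto dest: const)
  qed
  then have ae: "AE p in \<nu>. p \<in> Pinf \<and> (\<forall>Q. valid Q \<longrightarrow> tlim Q p = c Q)"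
    using AE_space by eventually_elim (simp add: M.space_\<nu>)
  from eventually_happens'[OF M.N.ae_filter_bot this]
  obtain p0 where p0: "p0 \<in> Pinf" "\<And>Q. valid Q \<Longrightarrow> tlim Q p0 = c Q" by blast
  have eq: "AE p in \<nu>. p = p0"
    using ae by eventually_elim (auto intro!: Pinf_eqI simp: p0)
  have "R = Plaw p0"
  proof (rule Rel_poset_eqI)
    show "prob_space R" "sets R = sets Rel" "AE r in R. is_poset_N r" "prob_space (Plaw p0)" "sets (Plaw p0) = sets Rel"
      "AE r in Plaw p0. is_poset_N r"
      using exch_lawD(1-3)[OF \<open>exch_law R\<close>] exch_lawD(1-3)[OF exch_law_Plaw[OF p0(1)]] by simp_all
    fix A q assume q: "lposet A q"
    have "measure R (superrel {(x, y). q x y}) = (\<integral>p. tlim (lcode A q) p \<partial>\<nu>)"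
      unfolding \<nu>(3) by (rule M.measure_mix_lposet[OF q])
    also have "\<dots> = (\<integral>p. tlim (lcode A q) p0 \<partial>\<nu>)"
      using eq tl_meas by (intro integral_cong_AE) (auto elim!: eventually_mono)
    also have "\<dots> = measure (Plaw p0) (superrel {(x, y). q x y})"
      using measure_Plaw_lposet[OF p0(1) q] by (simp add: M.N.prob_space)
    finally show "measure R (superrel {(x, y). q x y}) = measure (Plaw p0) (superrel {(x, y). q x y})" .
  qed
  then show ?thesis using p0(1) by blast
qed

lemma exch_eq_iff_superrel:
  assumes "exch_law R" "exch_law R'"
  shows "R = R' \<longleftrightarrow> (\<forall>A q. lposet A q \<longrightarrow> measure R' (superrel {(x, y). q x y}) = measure R (superrel {(x, y). q x y}))"
proof
  assume eq: "\<forall>A q. lposet A q \<longrightarrow> measure R' (superrel {(x, y). q x y}) = measure R (superrel {(x, y). q x y})"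
  show "R = R'"
    by (rule Rel_poset_eqI[OF exch_lawD(1-3)[OF assms(1)] exch_lawD(1-3)[OF assms(2)]]) (simp add: eq)
qed simp

lemma exch_eq_iff_pattern:
  assumes "exch_law R" "exch_law R'"
  shows "R = R' \<longleftrightarrow> (\<forall>A q. lposet A q \<longrightarrow> measure R' {r. \<forall>x\<in>A. \<forall>y\<in>A. r (x, y) = q x y} =
    measure R {r. \<forall>x\<in>A. \<forall>y\<in>A. r (x, y) = q x y})"
proof
  assume eq: "\<forall>A q. lposet A q \<longrightarrow> measure R' {r. \<forall>x\<in>A. \<forall>y\<in>A. r (x, y) = q x y} =
    measure R {r. \<forall>x\<in>A. \<forall>y\<in>A. r (x, y) = q x y}"
  show "R = R'"
    by (rule lposet_pattern_eqI[OF assms]) (simp add: eq)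
qed simp

lemma superrel_eq: "{r \<in> space Rel. \<forall>x y. q x y \<longrightarrow> r (x, y)} = superrel {(x, y). q x y}"
  by (auto simp: superrel_def)

lemma pattern_eq: "{r \<in> space Rel. \<forall>x\<in>A. \<forall>y\<in>A. r (x, y) = q x y} = {r. \<forall>x\<in>A. \<forall>y\<in>A. r (x, y) = q x y}"
  by simp

theorem theorem1p15:
  shows
  "bij_betw (\<lambda>\<nu>. bind \<nu> Plaw) {\<nu>. prob_space \<nu> \<and> sets \<nu> = sets PinfM} {R. exch_law R}
   \<and> (\<forall>\<nu> R. prob_space \<nu> \<longrightarrow> sets \<nu> = sets PinfM \<longrightarrow> exch_law R \<longrightarrow>
        (R = bind \<nu> Plaw \<longleftrightarrow> (\<forall>A q. lposet A q \<longrightarrow>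
            (\<integral>p. tlim (lcode A q) p \<partial>\<nu>) = measure R {r \<in> space Rel. \<forall>x y. q x y \<longrightarrow> r (x, y)}))
      \<and> (R = bind \<nu> Plaw \<longleftrightarrow> (\<forall>A q. lposet A q \<longrightarrow>
            (\<integral>p. tindlim (lcode A q) p \<partial>\<nu>) = measure R {r \<in> space Rel. \<forall>x\<in>A. \<forall>y\<in>A. r (x, y) = q x y})))
   \<and> (\<forall>\<nu>. prob_space \<nu> \<longrightarrow> sets \<nu> = sets PinfM \<longrightarrow>
        conv_distr (\<lambda>n r. embed (rcode n r)) (bind \<nu> Plaw) \<nu>)
   \<and> bij_betw Plaw Pinf {R. extreme_exch R}
   \<and> (\<forall>p R. p \<in> Pinf \<longrightarrow> exch_law R \<longrightarrow>
        (R = Plaw p \<longleftrightarrow> (\<forall>A q. lposet A q \<longrightarrow>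
            tlim (lcode A q) p = measure R {r \<in> space Rel. \<forall>x y. q x y \<longrightarrow> r (x, y)}))
      \<and> (R = Plaw p \<longleftrightarrow> (\<forall>A q. lposet A q \<longrightarrow>
            tindlim (lcode A q) p = measure R {r \<in> space Rel. \<forall>x\<in>A. \<forall>y\<in>A. r (x, y) = q x y})))
   \<and> (\<forall>p\<in>Pinf. AE r in Plaw p. (\<lambda>n. embed (rcode n r)) \<longlonglongrightarrow> p)"
  unfolding superrel_eq pattern_eq
proof (intro conjI allI impI ballI)
  show "bij_betw (\<lambda>\<nu>. bind \<nu> Plaw) {\<nu>. prob_space \<nu> \<and> sets \<nu> = sets PinfM} {R. exch_law R}"
    by (rule bij_betw_mixture)
next
  fix \<nu> R assume \<nu>: "prob_space \<nu>" "sets \<nu> = sets PinfM" and R: "exch_law R"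
  interpret mixture \<nu> by (rule mixture.intro[OF \<nu>])
  show "R = bind \<nu> Plaw \<longleftrightarrow> (\<forall>A q. lposet A q \<longrightarrow> (\<integral>p. tlim (lcode A q) p \<partial>\<nu>) = measure R (superrel {(x, y). q x y}))"
    unfolding exch_eq_iff_superrel[OF R exch_law_mix] by (simp add: measure_mix_lposet)
  show "R = bind \<nu> Plaw \<longleftrightarrow> (\<forall>A q. lposet A q \<longrightarrow> (\<integral>p. tindlim (lcode A q) p \<partial>\<nu>) =
      measure R {r. \<forall>x\<in>A. \<forall>y\<in>A. r (x, y) = q x y})"
    unfolding exch_eq_iff_pattern[OF R exch_law_mix] by (simp add: measure_mix_pattern)
next
  fix \<nu> assume \<nu>: "prob_space \<nu>" "sets \<nu> = sets PinfM"
  interpret mixture \<nu> by (rule mixture.intro[OF \<nu>])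
  show "conv_distr (\<lambda>n r. embed (rcode n r)) (bind \<nu> Plaw) \<nu>" by (rule conv_distr_mix)
next
  show "bij_betw Plaw Pinf {R. extreme_exch R}"
  proof (rule bij_betw_imageI)
    show "inj_on Plaw Pinf" by (rule inj_onI) (rule Plaw_inj)
    show "Plaw ` Pinf = {R. extreme_exch R}" using extreme_exch_Plaw extreme_exch_imp_Plaw by blast
  qed
next
  fix p R assume p: "p \<in> Pinf" and R: "exch_law R"
  show "R = Plaw p \<longleftrightarrow> (\<forall>A q. lposet A q \<longrightarrow> tlim (lcode A q) p = measure R (superrel {(x, y). q x y}))"
    unfolding exch_eq_iff_superrel[OF R exch_law_Plaw[OF p]] by (simp add: measure_Plaw_lposet[OF p])
  show "R = Plaw p \<longleftrightarrow> (\<forall>A q. lposet A q \<longrightarrow> tindlim (lcode A q) p =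
      measure R {r. \<forall>x\<in>A. \<forall>y\<in>A. r (x, y) = q x y})"
    unfolding exch_eq_iff_pattern[OF R exch_law_Plaw[OF p]] by (simp add: tindlim_lposet[OF p])
next
  fix p assume "p \<in> Pinf"
  then show "AE r in Plaw p. (\<lambda>n. embed (rcode n r)) \<longlonglongrightarrow> p" by (rule AE_embed_tendsto_Plaw)
qed

end
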